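(* The map $\pi:\mathfrak{Z}\to\mathfrak{D}$, the composite of the inclusion $\mathfrak{Z}\hookrightarrow\mathfrak{U}^{\mathfrak{k}}$ and the quotient $\mathfrak{U}^{\mathfrak{k}}\to\mathfrak{D}$, is surjective. In particular, for every $(p,q)$-hook partition $\mu$ there exists $Z_\mu\in\mathfrak{Z}$ with $\pi(Z_\mu)=\mathscr{D}_\mu$.
   Context: Over $\mathbb{C}$, fix $p,q\ge1$, $\mathfrak{g}=\mathfrak{gl}(2p|2q)$ with even indices $1..2p$ and odd indices $2p+1..2p+2q$. Let $J=\tfrac12\mathrm{diag}(I_p,-I_p,I_q,-I_q)$; the $\mathrm{ad}J$-eigenspaces for $-1,0,1$ are $\mathfrak{p}^-,\mathfrak{k},\mathfrak{p}^+$, with $\mathfrak{k}\cong\mathfrak{gl}(p|q)\oplus\mathfrak{gl}(p|q)$. $\mathfrak{U}=\mathfrak{U}(\mathfrak{g})$, $\mathfrak{Z}$ its center, $\mathfrak{D}=\mathfrak{U}^{\mathfrak{k}}/(\mathfrak{U}\mathfrak{k})^{\mathfrak{k}}$. $(p,q)$-hook partitions are partitions $\lambda$ with $\lambda_{p+1}\le q$. For such $\lambda$, $W_\lambda=L(\lambda^\natural)\otimes L(\lambda^\natural)^*$ where $L(\lambda^\natural)$ is the irreducible $\mathfrak{gl}(p|q)$-module of standard-Borel highest weight $\sum_i\lambda_i\epsilon_i+\sum_j\max(\lambda'_j-p,0)\delta_j$ (second copy of $\mathfrak{gl}(p|q)$ acting contragrediently on the dual); $W_\lambda$ occurs exactly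 once in $\mathfrak{S}(\mathfrak{p}^+)$ and $W_\lambda^*$ exactly once in $\mathfrak{S}(\mathfrak{p}^-)$ (dual via the form $\tfrac1{m!}b^{\otimes m}$, $b(X,Y)=\tfrac12\mathrm{str}(XY)$). $D_\lambda=\sum_i\xi_i\eta_i\in\mathfrak{U}^{\mathfrak{k}}$ with $\{\eta_i\}$ a homogeneous basis of $W_\lambda\subseteq\mathfrak{S}(\mathfrak{p}^+)$ and $\{\xi_i\}$ the dual basis of $W_\lambda^*\subseteq\mathfrak{S}(\mathfrak{p}^-)$; $\mathscr{D}_\lambda$ is the image of $D_\lambda$ in $\mathfrak{D}$. *)

theory Defs
  imports Complex_Main
begin

text \<open>Concrete model of U(gl(2p|2q)) as the tensor algebra over the basis
E_ij (1 <= i,j <= 2p+2q) modulo the two-sided ideal generated by the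
super-commutator relations. Elements of the tensor algebra are finitely
supported functions from words (lists of index pairs) to complex numbers.\<close>

type_synonym word = "(nat \<times> nat) list"
type_synonym tens = "word \<Rightarrow> complex"

definition fin_supp :: "tens \<Rightarrow> bool" where
  "fin_supp a \<longleftrightarrow> finite {w. a w \<noteq> 0}"

definition tadd :: "tens \<Rightarrow> tens \<Rightarrow> tens" where
  "tadd a b = (\<lambda>w. a w + b w)"

definition tsub :: "tens \<Rightarrow> tens \<Rightarrow> tens" where
  "tsub a b = (\<lambda>w. a w - b w)"

definition tscale :: "complex \<Rightarrow> tens \<Rightarrow> tens" where
  "tscale c a = (\<lambda>w. c * a w)"

definition tens_ok :: "nat \<Rightarrow> nat \<Rightarrow> tens \<Rightarrow> bool" where
  "tens_ok p q a \<longleftrightarrow> fin_supp a \<and>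
     (\<forall>w. a w \<noteq> 0 \<longrightarrow> (\<forall>x\<in>set w. 1 \<le> fst x \<and> fst x \<le> 2*p+2*q \<and> 1 \<le> snd x \<and> snd x \<le> 2*p+2*q))"

definition tmul :: "tens \<Rightarrow> tens \<Rightarrow> tens" where
  "tmul a b = (\<lambda>w. \<Sum>i\<le>length w. a (take i w) * b (drop i w))"

definition tzero :: tens where "tzero = (\<lambda>w. 0)"

definition gen :: "nat \<Rightarrow> nat \<Rightarrow> tens" where
  "gen i j = (\<lambda>w. if w = [(i, j)] then 1 else 0)"

definition valid_idx :: "nat \<Rightarrow> nat \<Rightarrow> nat \<Rightarrow> bool" where
  "valid_idx p q i \<longleftrightarrow> 1 \<le> i \<and> i \<le> 2*p + 2*q"

definition ipar :: "nat \<Rightarrow> nat \<Rightarrow> nat" where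
  "ipar p i = (if i \<le> 2*p then 0 else 1)"

definition gpar :: "nat \<Rightarrow> nat \<times> nat \<Rightarrow> nat" where
  "gpar p ij = (ipar p (fst ij) + ipar p (snd ij)) mod 2"

definition wpar :: "nat \<Rightarrow> word \<Rightarrow> nat" where
  "wpar p w = (\<Sum>x\<leftarrow>w. gpar p x) mod 2"

definition sflip :: "nat \<Rightarrow> tens \<Rightarrow> tens" where
  "sflip p a = (\<lambda>w. (-1) ^ wpar p w * a w)"

definition kron :: "nat \<Rightarrow> nat \<Rightarrow> complex" where
  "kron a b = (if a = b then 1 else 0)"

definition sbracket :: "nat \<Rightarrow> nat \<Rightarrow> nat \<Rightarrow> nat \<Rightarrow> nat \<Rightarrow> tens" where
  "sbracket p i j k l =
     tsub (tscale (kron j k) (gen i l))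
          (tscale ((-1) ^ (gpar p (i,j) * gpar p (k,l)) * kron l i) (gen k j))"

definition urel :: "nat \<Rightarrow> nat \<Rightarrow> nat \<Rightarrow> nat \<Rightarrow> nat \<Rightarrow> tens" where
  "urel p i j k l =
     tsub (tsub (tmul (gen i j) (gen k l))
                (tscale ((-1) ^ (gpar p (i,j) * gpar p (k,l))) (tmul (gen k l) (gen i j))))
          (sbracket p i j k l)"

definition urels :: "nat \<Rightarrow> nat \<Rightarrow> tens set" where
  "urels p q = {urel p i j k l | i j k l.
     valid_idx p q i \<and> valid_idx p q j \<and> valid_idx p q k \<and> valid_idx p q l}"

inductive_set tideal :: "(tens \<Rightarrow> bool) \<Rightarrow> tens set \<Rightarrow> tens set" for ok R where
  zero: "tzero \<in> tideal ok R"
| base: "r \<in> R \<Longrightarrow> r \<in> tideal ok R"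
| add: "a \<in> tideal ok R \<Longrightarrow> b \<in> tideal ok R \<Longrightarrow> tadd a b \<in> tideal ok R"
| scale: "a \<in> tideal ok R \<Longrightarrow> tscale c a \<in> tideal ok R"
| lmul: "a \<in> tideal ok R \<Longrightarrow> ok x \<Longrightarrow> tmul x a \<in> tideal ok R"
| rmul: "a \<in> tideal ok R \<Longrightarrow> ok x \<Longrightarrow> tmul a x \<in> tideal ok R"

definition Irel :: "nat \<Rightarrow> nat \<Rightarrow> tens set" where
  "Irel p q = tideal (tens_ok p q) (urels p q)"

text \<open>J = 1/2 diag(I_p, -I_p, I_q, -I_q): True for eigenvalue +1/2.\<close>
definition Jplus :: "nat \<Rightarrow> nat \<Rightarrow> nat \<Rightarrow> bool" where
  "Jplus p q i \<longleftrightarrow> i \<le> p \<or> (2*p < i \<and> i \<le> 2*p + q)"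

text \<open>E_ij lies in k (the 0-eigenspace of ad J).\<close>
definition kidx :: "nat \<Rightarrow> nat \<Rightarrow> nat \<Rightarrow> nat \<Rightarrow> bool" where
  "kidx p q i j \<longleftrightarrow> valid_idx p q i \<and> valid_idx p q j \<and> (Jplus p q i \<longleftrightarrow> Jplus p q j)"

text \<open>Preimage in T(g) of the left ideal U(g)k.\<close>
inductive_set Uk_pre :: "nat \<Rightarrow> nat \<Rightarrow> tens set" for p q where
  rel: "a \<in> Irel p q \<Longrightarrow> a \<in> Uk_pre p q"
| kgen: "tens_ok p q a \<Longrightarrow> kidx p q i j \<Longrightarrow> tmul a (gen i j) \<in> Uk_pre p q"
| add: "a \<in> Uk_pre p q \<Longrightarrow> b \<in> Uk_pre p q \<Longrightarrow> tadd a b \<in> Uk_pre p q"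

definition sad :: "nat \<Rightarrow> nat \<Rightarrow> nat \<Rightarrow> tens \<Rightarrow> tens" where
  "sad p i j u = tsub (tmul (gen i j) u)
                      (tmul (if gpar p (i,j) = 1 then sflip p u else u) (gen i j))"

definition k_invariant :: "nat \<Rightarrow> nat \<Rightarrow> tens \<Rightarrow> bool" where
  "k_invariant p q u \<longleftrightarrow> tens_ok p q u \<and> (\<forall>i j. kidx p q i j \<longrightarrow> sad p i j u \<in> Irel p q)"

definition central :: "nat \<Rightarrow> nat \<Rightarrow> tens \<Rightarrow> bool" where
  "central p q u \<longleftrightarrow> tens_ok p q u \<and>
     (\<forall>i j. valid_idx p q i \<and> valid_idx p q j \<longrightarrow> sad p i j u \<in> Irel p q)"

end

theory Submission
  imports Defs "HOL-Library.Function_Algebras" "HOL-Combinatorics.Permutations"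
    "HOL-Library.Multiset"
begin

text \<open>Since \<open>U / Uk\<close> has the associated graded algebra \<open>S(p)\<close>, it suffices to lift the leading term
of an invariant to a central element and to descend by induction on the degree.

The leading term is isolated by letting \<open>U\<close> act by supercommutators on the operators on \<open>V\<close>-tensors
of rank \<open>d\<close>, starting from the \<open>k\<close>-invariant vector \<open>J \<otimes> ... \<otimes> J\<close>: words of degree at most \<open>d\<close> act,
after projection to the tensor power of \<open>p\<close>, by the symmetrisation of their part of degree \<open>d\<close> in \<open>p\<close>.
This replaces the Poincare-Birkhoff-Witt theorem and produces from an invariant of degree \<open>d\<close> an
operator on the tensor power of \<open>V\<close> that commutes with \<open>k\<close>.

By the double commutant theorem (proved with a Maschke average) such an operator is a combination of
products \<open>P \<sigma> * Q F\<close> of a super permutation and a projection to the tensors with the two halves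
\<open>V = V' + V''\<close> distributed according to \<open>F\<close>. Only alternating \<open>F\<close> (the two halves alternate along
every cycle of \<open>\<sigma>\<close>) matter, and all of them give the same element modulo \<open>Uk\<close> and lower degree. Hence
the Gelfand invariant given by \<open>P \<sigma>\<close>, which is central, is a nonzero multiple of each of them.\<close>

section \<open>The ring of linear operators on complex-valued functions\<close>

text \<open>Finite-dimensional modules over \<open>gl(p|q)\<close> need not be completely reducible,
  so semisimplicity is drawn from the other side: the algebra spanned by the
  \<open>P \<sigma> * Q F\<close> comes from a finite group and finitely many orthogonal
  idempotents, over which one can average. As k is a sum of two copies of \<open>gl(p|q)\<close>,
  its commutant is larger than that of \<open>gl(V)\<close>, and the \<open>Q F\<close> supply the
  surplus. They do not commute with \<open>gl(V)\<close>, so their tensors are not visibly central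
  and have to be traded for those of \<open>P \<sigma>\<close>.

  The vector J is chosen because it commutes with k, while the bracket with a letter of p turns J
  into a nonzero multiple of that letter; d letters from p thus fill d sites. The multiple has a
  sign depending on the letter, which a further multiplication by J at every site removes.

  The descent does not preserve k-invariance: subtracting a central element lowers the degree only
  up to an element of \<open>Uk\<close>, and removing that element may destroy invariance. The
  condition carried along is the weaker one that k times u lies in \<open>Uk\<close>, that is,
  invariance of the class of u in \<open>U / Uk\<close>.\<close>

definition smul :: "complex \<Rightarrow> ('i \<Rightarrow> complex) \<Rightarrow> 'i \<Rightarrow> complex" where
  "smul c f = (\<lambda>i. c * f i)"

text \<open>A type of its own makes the operators an instance of \<open>ring_1\<close>, so that the
  ring simplification rules and the distributivity of sums apply to them.\<close>

typedef 'i lop = "{F :: ('i \<Rightarrow> complex) \<Rightarrow> 'i \<Rightarrow> complex.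
    (\<forall>f g. F (f + g) = F f + F g) \<and> (\<forall>c f. F (smul c f) = smul c (F f))}"
  morphisms ap Lop
  by (rule exI[of _ id]) auto

setup_lifting type_definition_lop

lemma ap_add: "ap A (f + g) = ap A f + ap A g"
  and ap_smul: "ap A (smul c f) = smul c (ap A f)"
  using ap[of A] by auto

instantiation lop :: (type) ring_1
begin

lift_definition zero_lop :: "'a lop" is "\<lambda>f. 0"
  by (auto simp: smul_def zero_fun_def fun_eq_iff)
lift_definition one_lop :: "'a lop" is "\<lambda>f. f" by auto
lift_definition plus_lop :: "'a lop \<Rightarrow> 'a lop \<Rightarrow> 'a lop" is "\<lambda>F G f. F f + G f"
  by (auto simp: smul_def fun_eq_iff algebra_simps)
lift_definition uminus_lop :: "'a lop \<Rightarrow> 'a lop" is "\<lambda>F f. - F f"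
  by (auto simp: smul_def fun_eq_iff algebra_simps)
lift_definition minus_lop :: "'a lop \<Rightarrow> 'a lop \<Rightarrow> 'a lop" is "\<lambda>F G f. F f - G f"
  by (auto simp: smul_def fun_eq_iff algebra_simps)
lift_definition times_lop :: "'a lop \<Rightarrow> 'a lop \<Rightarrow> 'a lop" is "\<lambda>F G f. F (G f)"
  by auto

instance
proof
  show "(0::'a lop) \<noteq> 1"
    by transfer (auto simp: fun_eq_iff zero_fun_def intro!: exI[of _ "\<lambda>_. 1"])
qed (transfer; auto simp: fun_eq_iff algebra_simps)+

end

lift_definition sc :: "complex \<Rightarrow> 'i lop \<Rightarrow> 'i lop" is "\<lambda>c F f. smul c (F f)"
  by (auto simp: smul_def fun_eq_iff algebra_simps)

global_interpretation lop: vector_space "sc :: complex \<Rightarrow> 'i lop \<Rightarrow> 'i lop"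
  by standard (transfer; auto simp: smul_def fun_eq_iff algebra_simps)+

lemma sc_mult_left: "sc c A * B = sc c (A * B)"
  by transfer auto

lemma sc_mult_right: "A * sc c B = sc c (A * B)"
  by transfer auto

lemmas sc_simps = sc_mult_left sc_mult_right lop.scale_scale

lemma lop_eqI: "(\<And>f i. ap A f i = ap B f i) \<Longrightarrow> A = B"
  by (transfer) (auto simp: fun_eq_iff)

lemma ap_simps [simp]:
  "ap (A + B) f = ap A f + ap B f" "ap (A - B) f = ap A f - ap B f"
  "ap (A * B) f = ap A (ap B f)" "ap (sc c A) f = smul c (ap A f)" "ap 0 f = 0" "ap 1 f = f"
  "ap (- A) f = - ap A f"
  by (transfer; simp)+

lemma sum_fun_app: "sum f S x = (\<Sum>s\<in>S. f s x)"
  by (induction S rule: infinite_finite_induct) auto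

lemma ap_sum: "ap (sum A S) f = (\<Sum>s\<in>S. ap (A s) f)"
  by (induction S rule: infinite_finite_induct) auto

lemma ap_zero: "ap A 0 = 0"
  using ap_add[of A 0 0] by simp

lemma ap_sum_arg: "ap A (sum f S) = (\<Sum>s\<in>S. ap A (f s))"
proof (induction S rule: infinite_finite_induct)
  case (insert x F)
  then show ?case by (simp only: sum.insert[OF insert(1,2)] ap_add)
qed (simp_all only: sum.infinite sum.empty ap_zero simp_thms)

text \<open>Monomial matrices. They are closed under products, so an identity between products of
  such operators reduces to comparing one index map and one coefficient function.\<close>

lift_definition wcomp :: "('i \<Rightarrow> 'i) \<Rightarrow> ('i \<Rightarrow> complex) \<Rightarrow> 'i lop" is
  "\<lambda>\<phi> c f i. c i * f (\<phi> i)"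
  by (auto simp: smul_def fun_eq_iff algebra_simps)

lemma ap_wcomp [simp]: "ap (wcomp \<phi> c) f i = c i * f (\<phi> i)"
  by transfer auto

lemma wcomp_mult: "wcomp \<phi> c * wcomp \<psi> c' = wcomp (\<lambda>i. \<psi> (\<phi> i)) (\<lambda>i. c i * c' (\<phi> i))"
  by (rule lop_eqI) auto

lemma sc_wcomp: "sc a (wcomp \<phi> c) = wcomp \<phi> (\<lambda>i. a * c i)"
  by (rule lop_eqI) (auto simp: smul_def)

text \<open>The index maps have to agree only where the coefficient is nonzero; conditions such as
  \<open>I \<in> L\<close> can therefore be stored in the coefficient.\<close>

lemma wcomp_eqI:
  assumes "\<And>i. c i = c' i" "\<And>i. c i \<noteq> 0 \<Longrightarrow> \<phi> i = \<psi> i"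
  shows "wcomp \<phi> c = wcomp \<psi> c'"
proof (rule lop_eqI)
  fix f i show "ap (wcomp \<phi> c) f i = ap (wcomp \<psi> c') f i"
    using assms[of i] by (cases "c i = 0") auto
qed

lemma wcomp_zero: "wcomp \<phi> (\<lambda>i. 0) = 0"
  by (rule lop_eqI) auto

definition bv :: "'i \<Rightarrow> 'i \<Rightarrow> complex" where
  "bv J = (\<lambda>I. if I = J then 1 else 0)"

text \<open>The rank-one matrix whose column \<open>J\<close> is \<open>v\<close> and whose other
  columns vanish.\<close>

lift_definition outer :: "('i \<Rightarrow> complex) \<Rightarrow> 'i \<Rightarrow> 'i lop" is "\<lambda>v J f i. f J * v i"
  by (auto simp: smul_def fun_eq_iff algebra_simps)

lemma ap_outer [simp]: "ap (outer v J) f = smul (f J) v"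
  by transfer (auto simp: smul_def)

lemma mult_outer: "A * outer v J = outer (ap A v) J"
  by (rule lop_eqI) (auto simp: ap_smul)

section \<open>Site operators\<close>

locale sites =
  fixes p q d :: nat
begin

definition idx :: "nat set" where "idx = {1..2*p+2*q}"

definition S0 :: "nat set" where "S0 = {..<d}"

definition L :: "(nat \<Rightarrow> nat) set" where "L = S0 \<rightarrow>\<^sub>E idx"

definition letters :: "(nat \<times> nat) set" where "letters = idx \<times> idx"

definition kletters :: "(nat \<times> nat) set" where
  "kletters = {x \<in> letters. Jplus p q (fst x) = Jplus p q (snd x)}"

text \<open>The tensor power of \<open>V\<close> is the space of functions on \<open>L\<close>. Operators act on all functions, so its
  identity is the projection \<open>U\<close> and not \<open>1\<close>.\<close>
definition U :: "(nat \<Rightarrow> nat) lop" where "U = wcomp id (\<lambda>I. if I \<in> L then 1 else 0)"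

text \<open>The Koszul sign of moving the letter \<open>x\<close> past the tensor factors before site \<open>a\<close>.\<close>
definition psg :: "nat \<Rightarrow> nat \<times> nat \<Rightarrow> (nat \<Rightarrow> nat) \<Rightarrow> complex" where
  "psg a x I = (\<Prod>b<a. (-1) ^ (gpar p x * ipar p (I b)))"

text \<open>The matrix unit \<open>x\<close> placed at site \<open>a\<close>. In coordinates it
  reads the entry at the column index \<open>snd x\<close> and writes it at the row index
  \<open>fst x\<close>, which explains the roles of the two components.\<close>

definition e :: "nat \<Rightarrow> nat \<times> nat \<Rightarrow> (nat \<Rightarrow> nat) lop" where
  "e a x = wcomp (\<lambda>I. I(a := snd x)) (\<lambda>I. if I \<in> L \<and> I a = fst x then psg a x I else 0)"

definition ss :: "nat \<times> nat \<Rightarrow> nat \<times> nat \<Rightarrow> complex" where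
  "ss x y = (-1) ^ (gpar p x * gpar p y)"

definition Par :: "(nat \<Rightarrow> nat) lop" where
  "Par = wcomp id (\<lambda>I. if I \<in> L then (\<Prod>b<d. (-1) ^ ipar p (I b)) else 0)"

definition cs :: "nat \<Rightarrow> complex" where
  "cs i = (if Jplus p q i then 1 else -1)"

text \<open>Twice J at site \<open>a\<close>, normalised to the eigenvalues 1 and -1.\<close>

definition D :: "nat \<Rightarrow> (nat \<Rightarrow> nat) lop" where
  "D a = wcomp id (\<lambda>I. if I \<in> L then cs (I a) else 0)"

definition colors :: "(nat \<Rightarrow> nat) \<Rightarrow> nat set" where
  "colors I = {a \<in> S0. Jplus p q (I a)}"

definition Q :: "nat set \<Rightarrow> (nat \<Rightarrow> nat) lop" where
  "Q F = wcomp id (\<lambda>I. if I \<in> L \<and> colors I = F then 1 else 0)"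

definition Delta :: "nat \<times> nat \<Rightarrow> (nat \<Rightarrow> nat) lop" where
  "Delta x = (\<Sum>a\<in>S0. e a x)"

lemma finite_S0 [simp]: "finite S0" by (simp add: S0_def)

lemma finite_L [simp]: "finite L" by (simp add: L_def idx_def finite_PiE)

lemma finite_letters [simp]: "finite letters" by (simp add: letters_def idx_def)

lemma kletters_letters: "x \<in> kletters \<Longrightarrow> x \<in> letters" by (simp add: kletters_def)

lemma lettersD: "x \<in> letters \<Longrightarrow> fst x \<in> idx" "x \<in> letters \<Longrightarrow> snd x \<in> idx"
  by (auto simp: letters_def)

lemma upd_L: "a \<in> S0 \<Longrightarrow> I \<in> L \<Longrightarrow> i \<in> idx \<Longrightarrow> I(a := i) \<in> L"
  by (auto simp: L_def PiE_iff extensional_def)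

lemma ss_sq [simp]: "ss x y * ss x y = 1"
  by (simp add: ss_def flip: power_mult_distrib)

lemma ss_commute: "ss x y = ss y x"
  by (simp add: ss_def mult.commute)

lemma gpar_cases: "gpar p x = 0 \<or> gpar p x = 1"
  by (auto simp: gpar_def)

lemma psg_sq: "psg a x I * psg a x I = 1"
  by (simp add: psg_def flip: prod.distrib power_mult_distrib)

lemma psg_nz [simp]: "psg a x I \<noteq> 0"
  by (simp add: psg_def)

lemma psg_comp: "psg a (i, l) I = psg a (i, j) I * psg a (j, l) I"
  unfolding psg_def prod.distrib[symmetric]
  by (rule prod.cong) (auto simp: gpar_def ipar_def)

lemma psg_upd_ge: "a \<le> b \<Longrightarrow> psg a x (I(b := k)) = psg a x I"
  unfolding psg_def by (rule prod.cong) auto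

text \<open>Replacing the entry at an earlier site changes its parity by that of the matrix unit
  doing the replacement. This is the origin of the sign between operators at different
  sites.\<close>

lemma psg_upd_lt:
  assumes "b < a"
  shows "psg a x (I(b := k)) = ss x (I b, k) * psg a x I"
proof -
  have *: "{..<a} = insert b ({..<a} - {b})" using assms by auto
  have "psg a x (I(b := k)) = (-1) ^ (gpar p x * ipar p k) *
     (\<Prod>c\<in>{..<a}-{b}. (-1) ^ (gpar p x * ipar p (I c)))"
    unfolding psg_def by (subst *, subst prod.insert) (auto intro!: prod.cong)
  moreover have "psg a x I = (-1) ^ (gpar p x * ipar p (I b)) *
     (\<Prod>c\<in>{..<a}-{b}. (-1) ^ (gpar p x * ipar p (I c)))"
    unfolding psg_def by (subst *, subst prod.insert) auto
  ultimately show ?thesis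
    using gpar_cases[of x] by (auto simp: ss_def gpar_def ipar_def)
qed

lemma e_mult_same:
  assumes "a \<in> S0" "x \<in> letters" "y \<in> letters"
  shows "e a x * e a y = sc (kron (snd x) (fst y)) (e a (fst x, snd y))"
  unfolding e_def wcomp_mult sc_wcomp
  using lettersD[OF assms(2)] lettersD[OF assms(3)] assms(1) psg_comp[of a "fst x" "snd y" _ "snd x"]
  by (intro wcomp_eqI) (auto simp: kron_def upd_L psg_upd_ge)

lemma e_mult_lt:
  assumes "a < b" "a \<in> S0" "b \<in> S0" "x \<in> letters" "y \<in> letters"
  shows "e a x * e b y = sc (ss x y) (e b y * e a x)"
proof -
  have "psg a x I * psg b y (I(a := snd x)) =
      ss x y * (psg b y I * psg a x (I(b := snd y)))" if "I a = fst x" for I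
    using assms(1) that by (simp add: psg_upd_lt psg_upd_ge ss_commute)
  then show ?thesis
    unfolding e_def wcomp_mult sc_wcomp
    using lettersD[OF assms(4)] lettersD[OF assms(5)] assms
    by (intro wcomp_eqI) (auto simp: upd_L fun_upd_twist)
qed

lemma e_mult_diff:
  assumes "a \<noteq> b" "a \<in> S0" "b \<in> S0" "x \<in> letters" "y \<in> letters"
  shows "e a x * e b y = sc (ss x y) (e b y * e a x)"
proof (cases "a < b")
  case False
  then have "e b y * e a x = sc (ss x y) (e a x * e b y)"
    using e_mult_lt[of b a y x] assms by (simp add: ss_commute)
  then show ?thesis by (simp add: sc_simps)
qed (use e_mult_lt assms in auto)

lemma U_idem [simp]: "U * U = U"
  unfolding U_def wcomp_mult by (rule wcomp_eqI) auto

lemma U_e [simp]: "U * e a x = e a x"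
  unfolding U_def e_def wcomp_mult by (rule wcomp_eqI) auto

lemma e_U [simp]: "a \<in> S0 \<Longrightarrow> x \<in> letters \<Longrightarrow> e a x * U = e a x"
  unfolding U_def e_def wcomp_mult by (rule wcomp_eqI) (auto simp: upd_L lettersD)

lemma U_D [simp]: "U * D a = D a" "D a * U = D a"
  unfolding U_def D_def wcomp_mult by (rule wcomp_eqI; auto)+

lemma U_Q [simp]: "U * Q F = Q F" "Q F * U = Q F"
  unfolding U_def Q_def wcomp_mult by (rule wcomp_eqI; auto)+

lemma U_Par [simp]: "U * Par = Par" "Par * U = Par"
  unfolding U_def Par_def wcomp_mult by (rule wcomp_eqI; auto)+

lemma Par_Par [simp]: "Par * Par = U"
  unfolding U_def Par_def wcomp_mult
  by (rule wcomp_eqI) (auto simp flip: prod.distrib power_mult_distrib)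

lemma Par_D: "Par * D a = D a * Par"
  unfolding D_def Par_def wcomp_mult by (rule wcomp_eqI) auto

lemma D_e_diff: "a \<noteq> b \<Longrightarrow> a \<in> S0 \<Longrightarrow> x \<in> letters \<Longrightarrow> D b * e a x = e a x * D b"
  unfolding D_def e_def wcomp_mult by (rule wcomp_eqI) (auto simp: upd_L lettersD)

lemma D_e_k: "a \<in> S0 \<Longrightarrow> x \<in> kletters \<Longrightarrow> D b * e a x = e a x * D b"
  unfolding D_def e_def wcomp_mult
  by (rule wcomp_eqI) (auto simp: upd_L lettersD kletters_def cs_def)

lemma e_D_p: "a \<in> S0 \<Longrightarrow> x \<in> letters \<Longrightarrow> e a x * D a = sc (cs (snd x)) (e a x)"
  unfolding D_def e_def wcomp_mult sc_wcomp
  by (rule wcomp_eqI) (auto simp: upd_L lettersD)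

lemma D_e_p: "a \<in> S0 \<Longrightarrow> x \<in> letters \<Longrightarrow> x \<notin> kletters \<Longrightarrow> D a * e a x = sc (- cs (snd x)) (e a x)"
  unfolding D_def e_def wcomp_mult sc_wcomp
  by (rule wcomp_eqI) (auto simp: upd_L lettersD kletters_def cs_def)

lemma Par_e:
  assumes "a \<in> S0" "x \<in> letters"
  shows "Par * e a x = sc ((-1) ^ gpar p x) (e a x * Par)"
proof -
  have "(\<Prod>b<d. (-1) ^ ipar p (I b)) * psg a x I
     = (-1) ^ gpar p x * (psg a x I * (\<Prod>b<d. (-1) ^ ipar p ((I(a := snd x)) b)))"
    if "I a = fst x" for I :: "nat \<Rightarrow> nat"
  proof -
    have *: "{..<d} = insert a ({..<d} - {a})" using assms by (auto simp: S0_def)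
    have 1: "(\<Prod>b<d. (-1::complex) ^ ipar p ((I(a := snd x)) b)) =
        (-1) ^ ipar p (snd x) * (\<Prod>b\<in>{..<d}-{a}. (-1) ^ ipar p (I b))"
      by (subst *, subst prod.insert) (auto intro!: prod.cong)
    have 2: "(\<Prod>b<d. (-1::complex) ^ ipar p (I b)) =
        (-1) ^ ipar p (fst x) * (\<Prod>b\<in>{..<d}-{a}. (-1) ^ ipar p (I b))"
      by (subst *, subst prod.insert) (auto simp: that)
    show ?thesis unfolding 1 2 by (auto simp: gpar_def ipar_def)
  qed
  then show ?thesis
    unfolding Par_def e_def wcomp_mult sc_wcomp
    using assms by (intro wcomp_eqI) (auto simp: upd_L lettersD)
qed

lemma colors_upd: "a \<in> S0 \<Longrightarrow>
    colors (I(a := j)) = (if Jplus p q j then insert a (colors I) else colors I - {a})"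
  by (auto simp: colors_def)

lemma Q_Q: "Q F * Q G = (if F = G then Q F else 0)"
  unfolding Q_def wcomp_mult wcomp_zero[of id, symmetric]
  by (auto intro!: wcomp_eqI split: if_splits)

lemma colors_sub: "colors I \<subseteq> S0" by (auto simp: colors_def)

lemma sum_Q: "(\<Sum>F\<in>Pow S0. Q F) = U"
proof (rule lop_eqI)
  fix f :: "(nat \<Rightarrow> nat) \<Rightarrow> complex" and I
  have "(\<Sum>F\<in>Pow S0. (if I \<in> L \<and> colors I = F then 1 else 0) * f I)
      = (if I \<in> L then f I else 0)"
    using colors_sub[of I] sum.delta'[of "Pow S0" "colors I" "\<lambda>_. 1"]
    by (cases "I \<in> L") (simp_all flip: sum_distrib_right)
  then show "ap (\<Sum>F\<in>Pow S0. Q F) f I = ap U f I"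
    by (simp add: ap_sum sum_fun_app Q_def U_def)
qed

lemma Q_e_k:
  assumes "a \<in> S0" "x \<in> kletters" shows "Q F * e a x = e a x * Q F"
proof -
  have "colors (I(a := snd x)) = colors I" if "I a = fst x" for I
    using assms that by (auto simp: colors_def kletters_def)
  then show ?thesis using assms unfolding Q_def e_def wcomp_mult
    by (intro wcomp_eqI) (auto simp: upd_L lettersD kletters_letters)
qed

lemma D_Q: "a \<in> S0 \<Longrightarrow> D a * Q F = sc (if a \<in> F then 1 else -1) (Q F)"
  "a \<in> S0 \<Longrightarrow> Q F * D a = sc (if a \<in> F then 1 else -1) (Q F)"
  unfolding D_def Q_def wcomp_mult sc_wcomp
  by (intro wcomp_eqI; auto simp: cs_def colors_def)+

section \<open>Super permutations of the tensor factors\<close>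

definition prs :: "(nat \<times> nat) set" where "prs = {(b, c). b < c \<and> c < d}"

text \<open>The Koszul sign of a permutation of tensor factors: one factor -1 for every inversion
  whose two entries are both odd.\<close>

definition ssg :: "(nat \<Rightarrow> nat) \<Rightarrow> (nat \<Rightarrow> nat) \<Rightarrow> complex" where
  "ssg \<sigma> I = (\<Prod>(b, c)\<in>prs. if \<sigma> b > \<sigma> c then (-1) ^ (ipar p (I (\<sigma> b)) * ipar p (I (\<sigma> c))) else 1)"

definition P :: "(nat \<Rightarrow> nat) \<Rightarrow> (nat \<Rightarrow> nat) lop" where
  "P \<sigma> = wcomp (\<lambda>I. I \<circ> \<sigma>) (\<lambda>I. if I \<in> L then ssg \<sigma> I else 0)"

lemma finite_prs [simp]: "finite prs"
  by (rule finite_subset[of _ "{..<d} \<times> {..<d}"]) (auto simp: prs_def)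

lemma permutes_S0_lt: "\<sigma> permutes S0 \<Longrightarrow> a < d \<Longrightarrow> \<sigma> a < d"
  using permutes_in_image[of \<sigma> S0 a] by (simp add: S0_def)

lemma permutes_S0_neq: "\<sigma> permutes S0 \<Longrightarrow> b \<noteq> c \<Longrightarrow> \<sigma> b \<noteq> \<sigma> c"
  using permutes_inj[of \<sigma> S0] by (auto dest: injD)

text \<open>A symmetric \<open>g\<close> is a function on unordered pairs of sites, which
  \<open>\<tau>\<close> permutes; \<open>srt\<close> picks the increasing representative of the
  image pair.\<close>

lemma prod_prs_permute:
  fixes g :: "nat \<Rightarrow> nat \<Rightarrow> complex"
  assumes t: "\<tau> permutes S0" and sym: "\<And>b c. b \<noteq> c \<Longrightarrow> g b c = g c b"
  shows "(\<Prod>(b, c)\<in>prs. g (\<tau> b) (\<tau> c)) = (\<Prod>(b, c)\<in>prs. g b c)"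
proof -
  define srt where "srt \<sigma> = (\<lambda>(b, c). (min (\<sigma> b) (\<sigma> c), max (\<sigma> b) (\<sigma> c)))"
    for \<sigma> :: "nat \<Rightarrow> nat"
  note ti = permutes_inv[OF t]
  note inv = permutes_inverses[OF t]
  have in_prs: "srt \<sigma> z \<in> prs" if "\<sigma> permutes S0" "z \<in> prs" for \<sigma> z
  proof -
    from that(2) obtain b c where "z = (b, c)" "b < c" "c < d" by (auto simp: prs_def)
    moreover have "\<sigma> b < d" "\<sigma> c < d" "\<sigma> b \<noteq> \<sigma> c"
      using calculation permutes_S0_lt[OF that(1)] permutes_S0_neq[OF that(1), of b c] by auto
    ultimately show ?thesis by (auto simp: srt_def prs_def)
  qed
  have 1: "srt (inv \<tau>) (srt \<tau> z) = z" "srt \<tau> (srt (inv \<tau>) z) = z" if "z \<in> prs" for z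
    using that by (auto simp: srt_def prs_def min_def max_def inv)
  show ?thesis
  proof (rule prod.reindex_bij_witness[of _ "srt (inv \<tau>)" "srt \<tau>"])
    fix z assume z: "z \<in> prs"
    then obtain b c where [simp]: "z = (b, c)" and "b \<noteq> c" by (auto simp: prs_def)
    then show "(case srt \<tau> z of (b, c) \<Rightarrow> g b c) = (case z of (b, c) \<Rightarrow> g (\<tau> b) (\<tau> c))"
      using sym[of "\<tau> b" "\<tau> c"] permutes_S0_neq[OF t, of b c] by (auto simp: srt_def min_def max_def)
  qed (use 1 in_prs t ti in auto)
qed

text \<open>A pair is inverted by the composite if and only if exactly one of the two factors
  inverts it on the way. Where both do, the two signs multiply to 1.\<close>

lemma ssg_comp:
  assumes s: "\<sigma> permutes S0" and t: "\<tau> permutes S0"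
  shows "ssg (\<sigma> \<circ> \<tau>) I = ssg \<sigma> I * ssg \<tau> (I \<circ> \<sigma>)"
proof -
  \<comment> \<open>The condition detects an inversion regardless of the order in which the pair is
    listed, so \<open>g\<close> is symmetric and its product can be reindexed along
    \<open>\<tau>\<close>.\<close>
  define g where "g b c = (if (b < c) = (\<sigma> b > \<sigma> c)
      then (-1::complex) ^ (ipar p (I (\<sigma> b)) * ipar p (I (\<sigma> c))) else 1)" for b c
  have "ssg \<sigma> I = (\<Prod>(b, c)\<in>prs. g b c)"
    unfolding ssg_def by (rule prod.cong) (auto simp: g_def prs_def)
  also have "\<dots> = (\<Prod>(b, c)\<in>prs. g (\<tau> b) (\<tau> c))"
    by (rule prod_prs_permute[OF t, symmetric])
      (use permutes_S0_neq[OF s] in \<open>force simp: g_def mult.commute\<close>)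
  finally have 1: "ssg \<sigma> I = (\<Prod>(b, c)\<in>prs. g (\<tau> b) (\<tau> c))" .
  show ?thesis
    unfolding 1 unfolding ssg_def prod.distrib[symmetric]
  proof (rule prod.cong)
    fix z assume "z \<in> prs"
    then obtain b c where z: "z = (b, c)" and "b \<noteq> c" by (auto simp: prs_def)
    then have "\<tau> b \<noteq> \<tau> c" "\<sigma> (\<tau> b) \<noteq> \<sigma> (\<tau> c)"
      using permutes_S0_neq s t by metis+
    then show "(case z of (b, c) \<Rightarrow> if (\<sigma> \<circ> \<tau>) b > (\<sigma> \<circ> \<tau>) c
         then (-1::complex) ^ (ipar p (I ((\<sigma> \<circ> \<tau>) b)) * ipar p (I ((\<sigma> \<circ> \<tau>) c))) else 1) =
      (case z of (b, c) \<Rightarrow> g (\<tau> b) (\<tau> c)) * (case z of (b, c) \<Rightarrow> if \<tau> b > \<tau> c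
         then (-1) ^ (ipar p ((I \<circ> \<sigma>) (\<tau> b)) * ipar p ((I \<circ> \<sigma>) (\<tau> c))) else 1)"
      by (auto simp: z g_def simp flip: power_mult_distrib)
  qed auto
qed

lemma L_comp: "\<sigma> permutes S0 \<Longrightarrow> I \<in> L \<Longrightarrow> I \<circ> \<sigma> \<in> L"
  using permutes_in_image[of \<sigma> S0] by (auto simp: L_def PiE_iff extensional_def)

lemma L_comp_iff: "\<sigma> permutes S0 \<Longrightarrow> I \<circ> \<sigma> \<in> L \<longleftrightarrow> I \<in> L"
  using L_comp[of \<sigma> I] L_comp[OF permutes_inv, of \<sigma> "I \<circ> \<sigma>"]
  by (auto simp: comp_assoc permutes_inv_o)

lemma P_mult: "\<sigma> permutes S0 \<Longrightarrow> \<tau> permutes S0 \<Longrightarrow> P \<sigma> * P \<tau> = P (\<sigma> \<circ> \<tau>)"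
  unfolding P_def wcomp_mult by (rule wcomp_eqI) (auto simp: ssg_comp L_comp comp_assoc)

lemma P_id: "P id = U"
proof -
  have "ssg id I = 1" for I
    unfolding ssg_def by (rule prod.neutral) (auto simp: prs_def)
  then show ?thesis unfolding P_def U_def by (intro wcomp_eqI) auto
qed

lemma P_inv: "\<sigma> permutes S0 \<Longrightarrow> P \<sigma> * P (inv \<sigma>) = U" "\<sigma> permutes S0 \<Longrightarrow> P (inv \<sigma>) * P \<sigma> = U"
  by (auto simp: P_mult permutes_inv permutes_inv_o P_id)

lemma U_P [simp]: "U * P \<sigma> = P \<sigma>" "\<sigma> permutes S0 \<Longrightarrow> P \<sigma> * U = P \<sigma>"
  unfolding U_def P_def wcomp_mult by (rule wcomp_eqI; auto simp: L_comp)+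

lemma P_Q:
  assumes "\<sigma> permutes S0" "F \<subseteq> S0" shows "P \<sigma> * Q F = Q (\<sigma> ` F) * P \<sigma>"
proof -
  have *: "colors I = \<sigma> ` colors (I \<circ> \<sigma>)" for I
  proof -
    have "colors (I \<circ> \<sigma>) = \<sigma> -` colors I"
      using permutes_in_image[OF assms(1)] by (auto simp: colors_def)
    then show ?thesis using permutes_surj[OF assms(1)] by (simp add: surj_image_vimage_eq)
  qed
  have "colors (I \<circ> \<sigma>) = F \<longleftrightarrow> colors I = \<sigma> ` F" for I
    unfolding *[of I] using permutes_inj[OF assms(1)] by (simp add: inj_image_eq_iff)
  then show ?thesis
    unfolding P_def Q_def wcomp_mult using assms by (intro wcomp_eqI) (auto simp: L_comp L_comp_iff)
qed

text \<open>The letter passes the sites before \<open>a\<close> on one side and those with image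
  before \<open>\<sigma> a\<close> on the other. These two sets of sites differ exactly by the sites
  inverted relative to \<open>a\<close>, and those are the ones at which changing the parity of the
  entry at \<open>\<sigma> a\<close> changes the sign of \<open>\<sigma>\<close>.\<close>

lemma ssg_psg:
  assumes s: "\<sigma> permutes S0" and a: "a \<in> S0" and x: "I (\<sigma> a) = fst x"
  shows "ssg \<sigma> I * psg a x (I \<circ> \<sigma>) = psg (\<sigma> a) x I * ssg \<sigma> (I(\<sigma> a := snd x))"
proof -
  define r where "r b = (-1::complex) ^ (gpar p x * ipar p (I (\<sigma> b)))" for b
  define h where "h b c = (if \<sigma> b > \<sigma> c then if b = a then r c else if c = a then r b else 1 else 1)" for b c
  define inverted where "inverted b \<longleftrightarrow> (b < a \<and> \<sigma> b > \<sigma> a) \<or> (b > a \<and> \<sigma> b < \<sigma> a)" for b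
  have rr: "r b * r b = 1" for b by (simp add: r_def flip: power_mult_distrib)
  have neq: "\<sigma> b = \<sigma> c \<longleftrightarrow> b = c" for b c using permutes_S0_neq[OF s] by metis
  have "ssg \<sigma> (I(\<sigma> a := snd x)) = ssg \<sigma> I * (\<Prod>(b, c)\<in>prs. h b c)"
    unfolding ssg_def prod.distrib[symmetric]
    by (rule prod.cong) (auto simp: h_def r_def neq prs_def x gpar_def ipar_def)
  also have "(\<Prod>(b, c)\<in>prs. h b c) = (\<Prod>(b, c)\<in>{(b, c)\<in>prs. b = a \<or> c = a}. h b c)"
    by (rule prod.mono_neutral_right) (auto simp: h_def split: if_splits)
  also have "\<dots> = (\<Prod>b\<in>S0-{a}. if inverted b then r b else 1)"
    by (rule prod.reindex_bij_witness[of _ "\<lambda>b. (min a b, max a b)" "\<lambda>(b, c). if b = a then c else b"])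
      (use a in \<open>auto simp: prs_def h_def inverted_def S0_def min_def max_def\<close>)
  finally have 1: "ssg \<sigma> (I(\<sigma> a := snd x)) = ssg \<sigma> I * \<dots>" .
  have 2: "psg a x (I \<circ> \<sigma>) = (\<Prod>b\<in>S0-{a}. if b < a then r b else 1)"
    unfolding psg_def
    by (rule prod.mono_neutral_cong_left) (use a in \<open>auto simp: S0_def r_def\<close>)
  have "psg (\<sigma> a) x I = (\<Prod>b\<in>{b. \<sigma> b < \<sigma> a}. r b)"
    unfolding psg_def
    by (rule prod.reindex_bij_witness[of _ \<sigma> "inv \<sigma>"]) (auto simp: r_def permutes_inverses[OF s])
  also have "\<dots> = (\<Prod>b\<in>S0-{a}. if \<sigma> b < \<sigma> a then r b else 1)"
  proof (rule prod.mono_neutral_cong_left)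
    show "{b. \<sigma> b < \<sigma> a} \<subseteq> S0 - {a}"
    proof safe
      fix b assume b: "\<sigma> b < \<sigma> a"
      then have "\<sigma> b \<in> S0" using permutes_S0_lt[OF s, of a] a by (auto simp: S0_def)
      then show "b \<in> S0" using permutes_in_image[OF s] by simp
    qed
  qed auto
  finally have 3: "psg (\<sigma> a) x I = (\<Prod>b\<in>S0-{a}. if \<sigma> b < \<sigma> a then r b else 1)" .
  have "(\<Prod>b\<in>S0-{a}. if b < a then r b else 1) =
     (\<Prod>b\<in>S0-{a}. if \<sigma> b < \<sigma> a then r b else 1) * (\<Prod>b\<in>S0-{a}. if inverted b then r b else 1)"
    unfolding prod.distrib[symmetric]
  proof (rule prod.cong)
    fix b assume "b \<in> S0 - {a}"
    then have "b \<noteq> a" "\<sigma> b \<noteq> \<sigma> a" by (auto simp: neq)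
    then show "(if b < a then r b else 1) =
       (if \<sigma> b < \<sigma> a then r b else 1) * (if inverted b then r b else 1)"
      by (auto simp: inverted_def rr)
  qed auto
  then show ?thesis unfolding 1 2 3 by simp
qed

lemma P_e:
  assumes s: "\<sigma> permutes S0" and a: "a \<in> S0" and x: "x \<in> letters"
  shows "P \<sigma> * e a x = e (\<sigma> a) x * P \<sigma>"
proof -
  have sa: "\<sigma> a \<in> S0" using permutes_in_image[OF s] a by simp
  have "(I \<circ> \<sigma>)(a := snd x) = I(\<sigma> a := snd x) \<circ> \<sigma>" for I
    using permutes_S0_neq[OF s] by fastforce
  then show ?thesis
    unfolding P_def e_def wcomp_mult
    using ssg_psg[OF s a, of _ x] s sa x by (intro wcomp_eqI) (auto simp: upd_L lettersD L_comp)
qed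

text \<open>The easy half of super Schur-Weyl duality: by \<open>P_e\<close> conjugation merely
  relabels the sites, and \<open>Delta\<close> sums over all of them.\<close>

lemma P_Delta:
  assumes "\<sigma> permutes S0" "x \<in> letters" shows "P \<sigma> * Delta x = Delta x * P \<sigma>"
proof -
  have "P \<sigma> * Delta x = (\<Sum>a\<in>S0. e (\<sigma> a) x * P \<sigma>)"
    using assms by (simp add: Delta_def sum_distrib_left P_e)
  also have "\<dots> = (\<Sum>a\<in>S0. e a x * P \<sigma>)"
    by (rule sum.reindex_bij_betw[OF permutes_imp_bij[OF assms(1)]])
  finally show ?thesis by (simp add: Delta_def sum_distrib_right)
qed

lemma P_Par:
  assumes "\<sigma> permutes S0" shows "P \<sigma> * Par = Par * P \<sigma>"
proof -
  have "(\<Prod>b<d. (-1::complex) ^ ipar p (I (\<sigma> b))) = (\<Prod>b<d. (-1) ^ ipar p (I b))" for I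
    by (rule prod.reindex_bij_betw) (use permutes_imp_bij[OF assms] in \<open>simp add: S0_def\<close>)
  then show ?thesis unfolding P_def Par_def wcomp_mult
    using assms by (intro wcomp_eqI) (auto simp: L_comp L_comp_iff)
qed

section \<open>Products of site operators\<close>

definition opz :: "(nat \<times> nat \<times> nat) list \<Rightarrow> (nat \<Rightarrow> nat) lop" where
  "opz zs = foldr (\<lambda>(a, x) A. e a x * A) zs U"

text \<open>The isomorphism between \<open>d\<close>-fold tensors over \<open>gl(V)\<close> and operators on the tensor power; its
  inverse is \<open>Ten\<close>.\<close>
definition Op :: "word \<Rightarrow> (nat \<Rightarrow> nat) lop" where
  "Op w = opz (enumerate 0 w)"

section \<open>Matrix entries indexed by words\<close>

definition W :: "word set" where
  "W = {w. length w = d \<and> set w \<subseteq> letters}"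

definition rows :: "word \<Rightarrow> nat \<Rightarrow> nat" where "rows w = (\<lambda>a\<in>S0. fst (w ! a))"
definition cols :: "word \<Rightarrow> nat \<Rightarrow> nat" where "cols w = (\<lambda>a\<in>S0. snd (w ! a))"

definition ent :: "(nat \<Rightarrow> nat) lop \<Rightarrow> word \<Rightarrow> complex" where
  "ent A w = ap A (bv (cols w)) (rows w)"

definition inL :: "(nat \<Rightarrow> nat) lop \<Rightarrow> bool" where
  "inL A \<longleftrightarrow> U * A = A \<and> A * U = A"

lemma finite_W [simp]: "finite W"
  using finite_lists_length_eq[OF finite_letters, of d] by (simp add: W_def conj_commute)

lemma opz_simps [simp]: "opz [] = U" "opz ((a, x) # zs) = e a x * opz zs"
  by (auto simp: opz_def)

lemma inL_opz: "set zs \<subseteq> S0 \<times> letters \<Longrightarrow> inL (opz zs)"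
proof (induction zs)
  case (Cons z zs)
  then show ?case by (cases z) (auto simp: inL_def mult.assoc simp flip: mult.assoc[of U])
qed (simp add: inL_def)

lemma enumerate_S0: "a + length w \<le> d \<Longrightarrow> set w \<subseteq> letters \<Longrightarrow> set (enumerate a w) \<subseteq> S0 \<times> letters"
  by (induction w arbitrary: a) (auto simp: S0_def)

lemma inL_Op: "w \<in> W \<Longrightarrow> inL (Op w)"
  unfolding Op_def by (rule inL_opz, rule enumerate_S0) (auto simp: W_def)

text \<open>Only the square of the coefficient is recorded: it is 0 or 1, which determines the
  coefficient up to a sign, and that sign never has to be computed.\<close>

lemma opz_enumerate:
  assumes "a + length w \<le> d" "set w \<subseteq> letters"
  shows "\<exists>c. opz (enumerate a w) =
      wcomp (\<lambda>I b. if a \<le> b \<and> b < a + length w then snd (w ! (b - a)) else I b) c \<and>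
      (\<forall>I. c I * c I = (if I \<in> L \<and> (\<forall>k<length w. I (a + k) = fst (w ! k)) then 1 else 0))"
  using assms
proof (induction w arbitrary: a)
  case Nil
  show ?case
    by (rule exI[of _ "\<lambda>I. if I \<in> L then 1 else 0"]) (auto simp: U_def intro!: wcomp_eqI)
next
  case (Cons x w)
  let ?\<phi> = "\<lambda>a w I b. if a \<le> b \<and> b < a + length w then snd (w ! (b - a)) else I b"
  from Cons.IH[of "Suc a"] Cons.prems obtain c where
    c: "opz (enumerate (Suc a) w) = wcomp (?\<phi> (Suc a) w) c" and
    c2: "\<And>I. c I * c I = (if I \<in> L \<and> (\<forall>k<length w. I (Suc a + k) = fst (w ! k)) then 1 else 0)"
    by auto
  define c' where "c' I = (if I \<in> L \<and> I a = fst x then psg a x I else 0) * c (I(a := snd x))" for I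
  have aS: "a \<in> S0" and x: "x \<in> letters" using Cons.prems by (auto simp: S0_def)
  have "opz (enumerate a (x # w)) = wcomp (?\<phi> a (x # w)) c'"
    unfolding enumerate_simps opz_simps c unfolding e_def wcomp_mult
    by (rule wcomp_eqI) (auto simp: c'_def fun_eq_iff nth_Cons' Suc_diff_le le_Suc_eq not_less_eq_eq)
  moreover have "c' I * c' I = (if I \<in> L \<and> (\<forall>k<length (x # w). I (a + k) = fst ((x # w) ! k)) then 1 else 0)" for I
  proof -
    have "c' I * c' I = (if I \<in> L \<and> I a = fst x then psg a x I * psg a x I else 0) *
        (c (I(a := snd x)) * c (I(a := snd x)))"
      by (simp add: c'_def)
    also have "\<dots> = (if I \<in> L \<and> I a = fst x \<and> (\<forall>k<length w. I (Suc a + k) = fst (w ! k)) then 1 else 0)"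
      unfolding c2 using upd_L[OF aS _ lettersD(2)[OF x]] by (auto simp: psg_sq)
    also have "I a = fst x \<and> (\<forall>k<length w. I (Suc a + k) = fst (w ! k)) \<longleftrightarrow>
        (\<forall>k<length (x # w). I (a + k) = fst ((x # w) ! k))"
      by (auto simp: less_Suc_eq_0_disj)
    finally show ?thesis .
  qed
  ultimately show ?case by blast
qed

lemma rows_cols_L: "w \<in> W \<Longrightarrow> rows w \<in> L" "w \<in> W \<Longrightarrow> cols w \<in> L"
  by (auto simp: rows_def cols_def L_def W_def S0_def letters_def dest!: subsetD nth_mem)

lemma word_of:
  assumes "I \<in> L" "J \<in> L"
  obtains w where "w \<in> W" "rows w = I" "cols w = J"
proof
  let ?w = "map (\<lambda>a. (I a, J a)) [0..<d]"
  show "?w \<in> W" using assms by (auto simp: W_def letters_def L_def S0_def PiE_iff)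
  show "rows ?w = I" "cols ?w = J"
    using assms by (auto simp: rows_def cols_def L_def S0_def PiE_iff extensional_def fun_eq_iff)
qed

text \<open>Up to sign, \<open>Op w\<close> is the matrix unit in row \<open>rows w\<close> and
  column \<open>cols w\<close>. Hence the \<open>Op w\<close> form a basis of the operators on the
  tensor power.\<close>

lemma ent_Op:
  assumes "w \<in> W"
  shows "v \<in> W \<Longrightarrow> v \<noteq> w \<Longrightarrow> ent (Op w) v = 0" "ent (Op w) w * ent (Op w) w = 1"
proof -
  obtain c where
    c: "Op w = wcomp (\<lambda>I b. if 0 \<le> b \<and> b < 0 + length w then snd (w ! (b - 0)) else I b) c" and
    c2: "\<And>I. c I * c I = (if I \<in> L \<and> (\<forall>k<length w. I (0 + k) = fst (w ! k)) then 1 else 0)"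
    using opz_enumerate[of 0 w] assms unfolding Op_def W_def by auto
  have ent: "ent (Op w) v = (if \<forall>k<d. snd (w ! k) = snd (v ! k) then c (rows v) else 0)" if "v \<in> W" for v
  proof -
    have "(\<lambda>b. if b < d then snd (w ! b) else rows v b) = cols v \<longleftrightarrow> (\<forall>k<d. snd (w ! k) = snd (v ! k))"
      using that by (auto simp: fun_eq_iff cols_def rows_def S0_def W_def)
    moreover have "ent (Op w) v = (if (\<lambda>b. if b < d then snd (w ! b) else rows v b) = cols v then c (rows v) else 0)"
      using assms by (simp add: ent_def c bv_def W_def cong: if_cong)
    ultimately show ?thesis by simp
  qed
  have c3: "c (rows v) * c (rows v) = (if \<forall>k<d. fst (v ! k) = fst (w ! k) then 1 else 0)" if "v \<in> W" for v
    using that assms rows_cols_L[OF that] by (auto simp: c2 rows_def S0_def W_def)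
  show "ent (Op w) v = 0" if "v \<in> W" "v \<noteq> w"
  proof (rule ccontr)
    assume "ent (Op w) v \<noteq> 0"
    with ent[OF that(1)] c3[OF that(1)] have "\<forall>k<d. snd (w ! k) = snd (v ! k)" "\<forall>k<d. fst (v ! k) = fst (w ! k)"
      by (auto split: if_splits)
    then have "v = w" using that assms by (intro nth_equalityI) (auto simp: W_def prod_eq_iff)
    with that show False by simp
  qed
  show "ent (Op w) w * ent (Op w) w = 1"
    by (simp add: ent[OF assms] c3[OF assms])
qed

lemma inL_eqI:
  assumes "inL A" "inL B" "\<And>w. w \<in> W \<Longrightarrow> ent A w = ent B w"
  shows "A = B"
proof (rule lop_eqI)
  fix f :: "(nat \<Rightarrow> nat) \<Rightarrow> complex" and I
  have *: "ap C f I = (if I \<in> L then \<Sum>J\<in>L. f J * ap C (bv J) I else 0)" if "inL C" for C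
  proof -
    have "ap U f = (\<Sum>J\<in>L. smul (f J) (bv J))"
      by (rule ext) (simp add: sum_fun_app U_def smul_def bv_def if_distrib[of "\<lambda>z. _ * z"] cong: if_cong)
    moreover have "ap C f = ap U (ap C (ap U f))"
      using that by (metis ap_simps(3) inL_def)
    ultimately have "ap C f = ap U (\<Sum>J\<in>L. smul (f J) (ap C (bv J)))"
      by (simp add: ap_sum_arg ap_smul)
    then show ?thesis by (simp add: U_def sum_fun_app smul_def)
  qed
  have "ap A (bv J) I = ap B (bv J) I" if "I \<in> L" "J \<in> L" for J
    using word_of[OF that] assms(3) unfolding ent_def by metis
  then show "ap A f I = ap B f I"
    unfolding *[OF assms(1)] *[OF assms(2)] by simp
qed

lemma ent_simps: "ent (A + B) w = ent A w + ent B w" "ent (sc c A) w = c * ent A w" "ent 0 w = 0"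
  "ent (A - B) w = ent A w - ent B w"
  by (auto simp: ent_def smul_def)

lemma ent_sum: "ent (sum f S) w = (\<Sum>s\<in>S. ent (f s) w)"
  by (induction S rule: infinite_finite_induct) (auto simp: ent_simps)

lemma inL_sum: "(\<And>s. s \<in> S \<Longrightarrow> inL (f s)) \<Longrightarrow> inL (sum f S)"
  by (auto simp: inL_def sum_distrib_left sum_distrib_right intro!: sum.cong)

lemma inL_sc: "inL A \<Longrightarrow> inL (sc c A)"
  by (auto simp: inL_def sc_simps)

lemma inL_mult: "inL A \<Longrightarrow> inL B \<Longrightarrow> inL (A * B)"
  unfolding inL_def by (metis mult.assoc)

text \<open>The sign \<open>ent (Op w) w\<close> is its own inverse, so multiplying by it gives the
  coordinates in the basis \<open>Op w\<close>. All words that occur have length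
  \<open>d\<close>.\<close>

definition Ten :: "(nat \<Rightarrow> nat) lop \<Rightarrow> tens" where
  "Ten A = (\<lambda>w. if w \<in> W then ent (Op w) w * ent A w else 0)"

lemma inL_expand:
  assumes "inL A"
  shows "A = (\<Sum>w\<in>W. sc (Ten A w) (Op w))"
proof (rule inL_eqI[OF assms])
  show "inL (\<Sum>w\<in>W. sc (Ten A w) (Op w))" by (intro inL_sum inL_sc inL_Op)
  fix v assume v: "v \<in> W"
  have "ent (\<Sum>w\<in>W. sc (Ten A w) (Op w)) v = (\<Sum>w\<in>W. if w = v then Ten A w * ent (Op w) v else 0)"
    unfolding ent_sum ent_simps by (rule sum.cong) (auto simp: ent_Op(1) v)
  also have "\<dots> = Ten A v * ent (Op v) v" using v by simp
  also have "\<dots> = ent A v" using ent_Op(2)[OF v] v by (simp add: Ten_def mult_ac)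
  finally show "ent A v = ent (\<Sum>w\<in>W. sc (Ten A w) (Op w)) v" ..
qed

section \<open>Symmetrised products\<close>

text \<open>Sum over the placements of the letters at distinct sites in \<open>S\<close>, the sites left over
  contributing \<open>Z\<close>.\<close>
fun Tg :: "(nat set \<Rightarrow> (nat \<Rightarrow> nat) lop) \<Rightarrow> nat set \<Rightarrow> word \<Rightarrow> (nat \<Rightarrow> nat) lop" where
  "Tg Z S [] = Z S"
| "Tg Z S (x # xs) = (\<Sum>a\<in>S. e a x * Tg Z (S - {a}) xs)"

abbreviation Tm :: "nat set \<Rightarrow> word \<Rightarrow> (nat \<Rightarrow> nat) lop" where
  "Tm \<equiv> Tg (\<lambda>_. U)"

text \<open>The terms of \<open>\<Sum>a. e a x\<close> times \<open>Tm\<close> in which \<open>x\<close> meets an already placed letter, as a list of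
  coefficients and words.\<close>
primrec merge :: "nat \<times> nat \<Rightarrow> word \<Rightarrow> (complex \<times> word) list" where
  "merge x [] = []"
| "merge x (y # ys) = (kron (snd x) (fst y), (fst x, snd y) # ys) #
     map (\<lambda>(c, zs). (ss x y * c, y # zs)) (merge x ys)"

lemma sum_sum_list: "(\<Sum>b\<in>S. sum_list (map (f b) l)) = sum_list (map (\<lambda>z. \<Sum>b\<in>S. f b z) l)"
  by (induction l) (auto simp: sum.distrib)

lemma sum_offdiag_swap:
  assumes "finite S"
  shows "(\<Sum>a\<in>S. \<Sum>b\<in>S-{a}. f a b) = (\<Sum>b\<in>S. \<Sum>a\<in>S-{b}. f a b :: 'b :: comm_monoid_add)"
proof -
  have "(\<Sum>a\<in>S. \<Sum>b\<in>{b\<in>S. a \<noteq> b}. f a b) = (\<Sum>b\<in>S. \<Sum>a\<in>{a\<in>S. a \<noteq> b}. f a b)"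
    by (rule sum.swap_restrict[OF assms assms])
  moreover have "{b\<in>S. a \<noteq> b} = S - {a}" "{b\<in>S. b \<noteq> a} = S - {a}" for a by auto
  ultimately show ?thesis by simp
qed

lemma finite_sub_S0: "S \<subseteq> S0 \<Longrightarrow> finite S"
  by (rule finite_subset) auto

lemma Tg_swap:
  assumes "S \<subseteq> S0" "x \<in> letters" "y \<in> letters"
  shows "Tg Z S (x # y # ys) = sc (ss x y) (Tg Z S (y # x # ys))"
proof -
  have "Tg Z S (x # y # ys) = (\<Sum>a\<in>S. \<Sum>b\<in>S-{a}. (e a x * e b y) * Tg Z (S - {a} - {b}) ys)"
    by (simp add: sum_distrib_left mult.assoc)
  also have "\<dots> = (\<Sum>a\<in>S. \<Sum>b\<in>S-{a}. sc (ss x y) (e b y * (e a x * Tg Z (S - {b} - {a}) ys)))"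
  proof (intro sum.cong refl)
    fix a b assume ab: "a \<in> S" "b \<in> S - {a}"
    have "e a x * e b y = sc (ss x y) (e b y * e a x)"
      using ab assms by (intro e_mult_diff) auto
    moreover have "S - {a} - {b} = S - {b} - {a}" by auto
    ultimately show "(e a x * e b y) * Tg Z (S - {a} - {b}) ys =
        sc (ss x y) (e b y * (e a x * Tg Z (S - {b} - {a}) ys))"
      by (simp only: sc_mult_left mult.assoc)
  qed
  also have "\<dots> = sc (ss x y) (Tg Z S (y # x # ys))"
    by (subst sum_offdiag_swap[OF finite_sub_S0[OF assms(1)]]) (simp add: sum_distrib_left lop.scale_sum_right)
  finally show ?thesis .
qed

text \<open>Split by whether the site of \<open>x\<close> is already occupied. A free site gives one
  more placed letter; at an occupied site the two matrix units multiply, which is what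
  \<open>merge\<close> lists.\<close>

lemma Delta_Tm:
  assumes "S \<subseteq> S0" "x \<in> letters" "set xs \<subseteq> letters"
  shows "(\<Sum>a\<in>S. e a x) * Tm S xs = Tm S (x # xs) + (\<Sum>(c, zs)\<leftarrow>merge x xs. sc c (Tm S zs))"
  using assms
proof (induction xs arbitrary: S)
  case Nil
  then show ?case by (simp add: sum_distrib_right)
next
  case (Cons y ys)
  note S = Cons.prems(1)
  have x: "x \<in> letters" and y: "y \<in> letters" using Cons.prems by auto
  have "(\<Sum>a\<in>S. e a x) * Tm S (y # ys) =
      (\<Sum>a\<in>S. \<Sum>b\<in>S. (e a x * e b y) * Tm (S - {b}) ys)"
    by (simp add: sum_product mult.assoc)
  also have "\<dots> = (\<Sum>b\<in>S. \<Sum>a\<in>S. (e a x * e b y) * Tm (S - {b}) ys)"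
    by (rule sum.swap)
  also have "\<dots> = (\<Sum>b\<in>S. (e b x * e b y) * Tm (S - {b}) ys +
      (\<Sum>a\<in>S-{b}. (e a x * e b y) * Tm (S - {b}) ys))"
    using finite_sub_S0[OF S] by (intro sum.cong refl sum.remove) auto
  also have "\<dots> = (\<Sum>b\<in>S. sc (kron (snd x) (fst y)) (e b (fst x, snd y) * Tm (S - {b}) ys) +
      sc (ss x y) (e b y * ((\<Sum>a\<in>S-{b}. e a x) * Tm (S - {b}) ys)))"
  proof (intro sum.cong refl arg_cong2[where f = "(+)"])
    fix b assume b: "b \<in> S"
    then show "e b x * e b y * Tm (S - {b}) ys = sc (kron (snd x) (fst y)) (e b (fst x, snd y) * Tm (S - {b}) ys)"
      using S x y by (subst e_mult_same) (auto simp: sc_simps)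
    have "(e a x * e b y) * Tm (S - {b}) ys = sc (ss x y) (e b y * (e a x * Tm (S - {b}) ys))"
      if "a \<in> S - {b}" for a
      using S x y b that by (subst e_mult_diff) (auto simp: sc_simps mult.assoc)
    then show "(\<Sum>a\<in>S-{b}. (e a x * e b y) * Tm (S - {b}) ys) =
        sc (ss x y) (e b y * ((\<Sum>a\<in>S-{b}. e a x) * Tm (S - {b}) ys))"
      by (simp add: sum_distrib_left sum_distrib_right lop.scale_sum_right)
  qed
  also have "\<dots> = sc (kron (snd x) (fst y)) (Tm S ((fst x, snd y) # ys)) +
     sc (ss x y) (\<Sum>b\<in>S. e b y * ((\<Sum>a\<in>S-{b}. e a x) * Tm (S - {b}) ys))"
    by (simp add: sum.distrib lop.scale_sum_right)
  also have "(\<Sum>b\<in>S. e b y * ((\<Sum>a\<in>S-{b}. e a x) * Tm (S - {b}) ys)) =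
      (\<Sum>b\<in>S. e b y * (Tm (S - {b}) (x # ys) + (\<Sum>(c, zs)\<leftarrow>merge x ys. sc c (Tm (S - {b}) zs))))"
  proof (intro sum.cong refl arg_cong2[where f = "(*)"])
    fix b have "S - {b} \<subseteq> S0" using S by auto
    then show "(\<Sum>a\<in>S-{b}. e a x) * Tm (S - {b}) ys =
        Tm (S - {b}) (x # ys) + (\<Sum>(c, zs)\<leftarrow>merge x ys. sc c (Tm (S - {b}) zs))"
      using Cons.IH[of "S - {b}"] x Cons.prems by simp
  qed
  also have "\<dots> = Tm S (y # x # ys) + (\<Sum>(c, zs)\<leftarrow>merge x ys. sc c (Tm S (y # zs)))"
    by (simp add: distrib_left sum.distrib sum_list_const_mult[symmetric] sum_sum_list
        case_prod_unfold sc_simps lop.scale_sum_right comp_def)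
  also have "sc (ss x y) \<dots> = Tm S (x # y # ys) + (\<Sum>(c, zs)\<leftarrow>merge x ys. sc (ss x y * c) (Tm S (y # zs)))"
  proof -
    have "sc a (sum_list (map f l)) = (\<Sum>z\<leftarrow>l. sc a (f z))" for a and l :: "(complex \<times> word) list" and f
      by (induction l) (auto simp: lop.scale_right_distrib)
    note sc_sum_list = this
    show ?thesis
      unfolding Tg_swap[OF S x y, of _ ys] lop.scale_right_distrib sc_sum_list
      by (simp add: case_prod_unfold)
  qed
  finally show ?case by (simp add: case_prod_unfold comp_def add_ac)
qed

text \<open>The colour-preserving matrices are closed under multiplication. A merged letter with
  coefficient 0 may fall outside k, hence the condition on \<open>c\<close>.\<close>

lemma merge_kletters:
  assumes "x \<in> kletters" "set xs \<subseteq> kletters" "(c, zs) \<in> set (merge x xs)" "c \<noteq> 0"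
  shows "set zs \<subseteq> kletters \<and> length zs = length xs"
  using assms(2-)
proof (induction xs arbitrary: c zs)
  case (Cons y ys)
  show ?case
  proof (cases "(c, zs) = (kron (snd x) (fst y), (fst x, snd y) # ys)")
    case True
    then show ?thesis using Cons.prems assms(1) by (auto simp: kron_def kletters_def letters_def split: if_splits)
  next
    case False
    with Cons.prems obtain c' zs' where "(c', zs') \<in> set (merge x ys)" "zs = y # zs'" "c = ss x y * c'"
      by auto
    then show ?thesis using Cons.IH[of c' zs'] Cons.prems by auto
  qed
qed auto

text \<open>Solving \<open>Delta_Tm\<close> for its longest word shows, by induction on the length,
  that symmetrised words in letters of k are noncommutative polynomials in the
  \<open>Delta x\<close> with \<open>x\<close> in k.\<close>

lemma commute_Tm:
  assumes inL: "inL A" and comm: "\<And>x. x \<in> kletters \<Longrightarrow> A * Delta x = Delta x * A"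
    and "set xs \<subseteq> kletters"
  shows "A * Tm S0 xs = Tm S0 xs * A"
  using assms(3)
proof (induction "length xs" arbitrary: xs)
  case 0
  then show ?case using inL by (simp add: inL_def)
next
  case (Suc n)
  then obtain x ys where xs: "xs = x # ys" and x: "x \<in> kletters" and ys: "set ys \<subseteq> kletters" "length ys = n"
    by (cases xs) auto
  let ?R = "\<Sum>(c, zs)\<leftarrow>merge x ys. sc c (Tm S0 zs)"
  have "A * sc c (Tm S0 zs) = sc c (Tm S0 zs) * A" if "(c, zs) \<in> set (merge x ys)" for c zs
    using Suc.hyps(1)[of zs] merge_kletters[OF x ys(1) that] ys(2) by (cases "c = 0") (auto simp: sc_simps)
  then have R: "A * ?R = ?R * A"
    by (auto simp: sum_list_const_mult[symmetric] sum_list_mult_const[symmetric] case_prod_unfold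
        intro!: arg_cong[where f = sum_list])
  have "Tm S0 xs = Delta x * Tm S0 ys - ?R"
    using Delta_Tm[of S0 x ys] x ys(1) kletters_letters subset_trans[of "set ys" kletters letters]
    unfolding xs Delta_def by (simp add: subset_iff del: Tg.simps)
  moreover have "A * (Delta x * Tm S0 ys) = (Delta x * Tm S0 ys) * A"
    using comm[OF x] Suc.hyps(1)[of ys] ys by (metis mult.assoc)
  ultimately show ?case using R by (simp only: right_diff_distrib left_diff_distrib)
qed

section \<open>The double commutant theorem\<close>

lemma P_opz:
  assumes "\<sigma> permutes S0" "set zs \<subseteq> S0 \<times> letters"
  shows "P \<sigma> * opz zs * P (inv \<sigma>) = opz (map (\<lambda>(a, x). (\<sigma> a, x)) zs)"
proof -
  have "P \<sigma> * opz zs = opz (map (\<lambda>(a, x). (\<sigma> a, x)) zs) * P \<sigma>"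
    using assms(2)
  proof (induction zs)
    case (Cons z zs)
    obtain a x where z: "z = (a, x)" by (cases z)
    have "P \<sigma> * (e a x * opz zs) = e (\<sigma> a) x * (P \<sigma> * opz zs)"
      using Cons.prems P_e[OF assms(1), of a x] by (simp add: z flip: mult.assoc)
    then show ?case using Cons by (simp add: z mult.assoc)
  qed (simp add: assms(1))
  then have "P \<sigma> * opz zs * P (inv \<sigma>) = opz (map (\<lambda>(a, x). (\<sigma> a, x)) zs) * (P \<sigma> * P (inv \<sigma>))"
    by (simp add: mult.assoc)
  also have "\<dots> = opz (map (\<lambda>(a, x). (\<sigma> a, x)) zs)"
  proof -
    have "set (map (\<lambda>(a, x). (\<sigma> a, x)) zs) \<subseteq> S0 \<times> letters"
      using assms permutes_in_image[OF assms(1)] by fastforce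
    then show ?thesis using inL_opz[of "map (\<lambda>(a, x). (\<sigma> a, x)) zs"]
      unfolding P_inv(1)[OF assms(1)] inL_def by blast
  qed
  finally show ?thesis .
qed

section \<open>Placements of letters and permutations of sites\<close>

definition dlists :: "nat set \<Rightarrow> nat \<Rightarrow> nat list set" where
  "dlists S n = {as. distinct as \<and> set as \<subseteq> S \<and> length as = n}"

lemma finite_dlists: "finite S \<Longrightarrow> finite (dlists S n)"
  by (rule finite_subset[OF _ finite_lists_length_eq[of S n]]) (auto simp: dlists_def)

lemma dlists_0: "dlists S 0 = {[]}"
  by (auto simp: dlists_def)

lemma sum_dlists_Suc:
  assumes "finite S"
  shows "(\<Sum>as\<in>dlists S (Suc n). f as) = (\<Sum>a\<in>S. \<Sum>as\<in>dlists (S - {a}) n. f (a # as))"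
proof -
  have "(\<Sum>a\<in>S. \<Sum>as\<in>dlists (S - {a}) n. f (a # as)) =
      (\<Sum>(a, as)\<in>(SIGMA a:S. dlists (S - {a}) n). f (a # as))"
    using assms by (intro sum.Sigma) (auto intro: finite_dlists)
  also have "\<dots> = (\<Sum>as\<in>dlists S (Suc n). f as)"
    by (rule sum.reindex_bij_witness[of _ "\<lambda>as. (hd as, tl as)" "\<lambda>(a, as). a # as"])
      (auto simp: dlists_def length_Suc_conv)
  finally show ?thesis ..
qed

lemma Tm_dlists:
  "S \<subseteq> S0 \<Longrightarrow> Tm S xs = (\<Sum>as\<in>dlists S (length xs). opz (zip as xs))"
proof (induction xs arbitrary: S)
  case Nil
  then show ?case by (simp add: dlists_0)
next
  case (Cons x xs)
  have "Tm (S - {a}) xs = (\<Sum>as\<in>dlists (S - {a}) (length xs). opz (zip as xs))" for a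
    using Cons.IH[of "S - {a}"] Cons.prems by blast
  then show ?case
    by (simp add: sum_dlists_Suc[OF finite_sub_S0[OF Cons.prems]] sum_distrib_left)
qed

lemma dlists_permutes: "bij_betw (\<lambda>\<sigma>. map \<sigma> [0..<d]) {\<sigma>. \<sigma> permutes S0} (dlists S0 d)"
proof (intro bij_betwI')
  fix \<sigma> \<tau> assume "\<sigma> \<in> {\<sigma>. \<sigma> permutes S0}" "\<tau> \<in> {\<sigma>. \<sigma> permutes S0}"
  then have st: "\<sigma> permutes S0" "\<tau> permutes S0" by auto
  show "map \<sigma> [0..<d] = map \<tau> [0..<d] \<longleftrightarrow> \<sigma> = \<tau>"
  proof
    assume *: "map \<sigma> [0..<d] = map \<tau> [0..<d]"
    show "\<sigma> = \<tau>"
    proof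
      fix a show "\<sigma> a = \<tau> a"
      proof (cases "a \<in> S0")
        case True
        then have "a \<in> set [0..<d]" by (simp add: S0_def)
        with * show ?thesis by (metis map_eq_conv)
      qed (use st in \<open>simp add: permutes_not_in\<close>)
    qed
  qed simp
next
  fix \<sigma> assume "\<sigma> \<in> {\<sigma>. \<sigma> permutes S0}"
  then have s: "\<sigma> permutes S0" by simp
  then show "map \<sigma> [0..<d] \<in> dlists S0 d"
    using permutes_S0_lt[OF s] inj_on_subset[OF permutes_inj[OF s] subset_UNIV, of "{0..<d}"]
    by (auto simp: dlists_def distinct_map S0_def)
next
  fix as assume as: "as \<in> dlists S0 d"
  define \<sigma> where "\<sigma> a = (if a < d then as ! a else a)" for a
  have "bij_betw \<sigma> S0 S0"
  proof -
    have inj: "inj_on \<sigma> S0"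
      using as by (auto simp: inj_on_def \<sigma>_def S0_def dlists_def nth_eq_iff_index_eq)
    moreover have "\<sigma> ` S0 \<subseteq> S0"
      using as nth_mem by (fastforce simp: \<sigma>_def S0_def dlists_def)
    ultimately show ?thesis
      by (simp add: bij_betw_def endo_inj_surj)
  qed
  then have "\<sigma> permutes S0" by (rule bij_imp_permutes) (auto simp: \<sigma>_def S0_def)
  moreover have "as = map \<sigma> [0..<d]"
    using as by (intro nth_equalityI) (auto simp: \<sigma>_def dlists_def)
  ultimately show "\<exists>\<sigma>\<in>{\<sigma>. \<sigma> permutes S0}. as = map \<sigma> [0..<d]" by blast
qed

lemma map_enumerate: "map (\<lambda>(a, x). (\<sigma> a, x)) (enumerate n w) = zip (map \<sigma> [n..<n + length w]) w"
proof (induction w arbitrary: n)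
  case (Cons x w)
  have "[n..<n + length (x # w)] = n # [Suc n..<Suc n + length w]"
    by (simp add: upt_conv_Cons del: upt_Suc)
  then show ?case by (simp add: Cons del: upt_Suc)
qed simp

text \<open>Conjugation moves the letter at site \<open>a\<close> to \<open>\<sigma> a\<close>, and
  permutations correspond to placements of \<open>d\<close> letters at \<open>d\<close> distinct
  sites.\<close>

lemma sum_P_Op:
  assumes "w \<in> W"
  shows "(\<Sum>\<sigma> | \<sigma> permutes S0. P \<sigma> * Op w * P (inv \<sigma>)) = Tm S0 w"
proof -
  have len: "length w = d" using assms by (simp add: W_def)
  have w: "set (enumerate 0 w) \<subseteq> S0 \<times> letters"
    using assms by (intro enumerate_S0) (auto simp: W_def)
  have "(\<Sum>\<sigma> | \<sigma> permutes S0. P \<sigma> * Op w * P (inv \<sigma>)) =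
      (\<Sum>\<sigma> | \<sigma> permutes S0. opz (zip (map \<sigma> [0..<d]) w))"
    by (intro sum.cong refl) (simp add: Op_def P_opz w map_enumerate len)
  also have "\<dots> = (\<Sum>as\<in>dlists S0 d. opz (zip as w))"
    by (rule sum.reindex_bij_betw[OF dlists_permutes])
  finally show ?thesis by (simp add: Tm_dlists len)
qed

section \<open>The commutant of the super permutations and colour projections\<close>

definition PQcomm :: "(nat \<Rightarrow> nat) lop \<Rightarrow> bool" where
  "PQcomm N \<longleftrightarrow> inL N \<and> (\<forall>\<sigma>. \<sigma> permutes S0 \<longrightarrow> P \<sigma> * N = N * P \<sigma>) \<and>
     (\<forall>F \<subseteq> S0. Q F * N = N * Q F)"

lemma W_kletters: "w \<in> W \<Longrightarrow> colors (rows w) = colors (cols w) \<Longrightarrow> set w \<subseteq> kletters"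
proof
  fix x assume w: "w \<in> W" "colors (rows w) = colors (cols w)" and "x \<in> set w"
  then obtain k where k: "k < d" "x = w ! k" by (auto simp: W_def in_set_conv_nth)
  have "k \<in> colors (rows w) \<longleftrightarrow> k \<in> colors (cols w)" using w by simp
  then show "x \<in> kletters"
    using k w \<open>x \<in> set w\<close> by (auto simp: W_def kletters_def colors_def rows_def cols_def S0_def)
qed

lemma finite_permutes [simp]: "finite {\<sigma>. \<sigma> permutes S0}"
  by (simp add: finite_permutations)

definition nperm :: complex where "nperm = of_nat (card {\<sigma>. \<sigma> permutes S0})"

lemma nperm_nz [simp]: "nperm \<noteq> 0"
proof -
  have "id \<in> {\<sigma>. \<sigma> permutes S0}" by (simp add: permutes_id)
  then show ?thesis using finite_permutes by (auto simp: nperm_def simp del: mem_Collect_eq)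
qed

lemma sum_const_sc: "(\<Sum>i\<in>I. A) = sc (of_nat (card I)) A"
  by (induction I rule: infinite_finite_induct) (auto simp: lop.scale_left_distrib simp del: sum_constant)

lemma ent_Q: "w \<in> W \<Longrightarrow> ent (Q F * A) w = (if colors (rows w) = F then ent A w else 0)"
  by (auto simp: ent_def Q_def rows_cols_L)

lemma ent_Q':
  assumes "w \<in> W" shows "ent (A * Q F) w = (if colors (cols w) = F then ent A w else 0)"
proof -
  have "ap (Q F) (bv (cols w)) = (if colors (cols w) = F then bv (cols w) else 0)"
    using rows_cols_L[OF assms] by (intro ext) (auto simp: Q_def bv_def)
  then show ?thesis by (simp add: ent_def ap_zero)
qed

text \<open>Commuting with the \<open>Q F\<close> removes all words with a letter outside k.
  Commuting with the \<open>P \<sigma>\<close> makes \<open>N\<close> equal to the average of its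
  conjugates, and averaging turns \<open>Op w\<close> into a multiple of
  \<open>Tm S0 w\<close>.\<close>

lemma PQcomm_Tm:
  assumes "PQcomm N"
  shows "\<exists>c. N = (\<Sum>w\<in>W \<inter> {w. set w \<subseteq> kletters}. sc (c w) (Tm S0 w))"
proof -
  have N: "inL N" using assms by (simp add: PQcomm_def)
  have "Ten N w = 0" if "w \<in> W" "\<not> set w \<subseteq> kletters" for w
  proof -
    have "colors (rows w) \<noteq> colors (cols w)" using W_kletters that by blast
    moreover have "ent (Q (colors (rows w)) * N) w = ent (N * Q (colors (rows w))) w"
      using assms colors_sub by (simp add: PQcomm_def)
    ultimately have "ent N w = 0" using that by (simp add: ent_Q ent_Q')
    then show ?thesis by (simp add: Ten_def)
  qed
  then have N_eq: "N = (\<Sum>w\<in>W \<inter> {w. set w \<subseteq> kletters}. sc (Ten N w) (Op w))"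
    by (subst inL_expand[OF N], intro sum.mono_neutral_right) auto
  have conj: "P \<sigma> * N * P (inv \<sigma>) = N" if "\<sigma> permutes S0" for \<sigma>
    using assms that P_inv(1)[OF that] N by (simp add: PQcomm_def inL_def mult.assoc)
  have "sc nperm N = (\<Sum>\<sigma> | \<sigma> permutes S0. P \<sigma> * N * P (inv \<sigma>))"
    by (simp add: conj sum_const_sc nperm_def del: sum_constant)
  also have "\<dots> = (\<Sum>\<sigma> | \<sigma> permutes S0. \<Sum>w\<in>W \<inter> {w. set w \<subseteq> kletters}.
      sc (Ten N w) (P \<sigma> * Op w * P (inv \<sigma>)))"
    by (subst N_eq) (simp add: sum_distrib_left sum_distrib_right sc_simps)
  also have "\<dots> = (\<Sum>w\<in>W \<inter> {w. set w \<subseteq> kletters}. sc (Ten N w) (Tm S0 w))"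
    by (subst sum.swap) (simp add: sum_P_Op flip: lop.scale_sum_right)
  finally have "sc (1 / nperm) (sc nperm N) = (\<Sum>w\<in>W \<inter> {w. set w \<subseteq> kletters}. sc (Ten N w / nperm) (Tm S0 w))"
    by (simp add: lop.scale_sum_right)
  then have "N = (\<Sum>w\<in>W \<inter> {w. set w \<subseteq> kletters}. sc (Ten N w / nperm) (Tm S0 w))"
    by simp
  then show ?thesis by (intro exI[of _ "\<lambda>w. Ten N w / nperm"])
qed

text \<open>By \<open>P_Q\<close> a product of two spanning elements is again a spanning element or
  0, so this is an algebra; its unit is \<open>U\<close>.\<close>

definition PQspan :: "(nat \<Rightarrow> nat) lop set" where
  "PQspan = lop.span {P \<sigma> * Q F | \<sigma> F. \<sigma> permutes S0 \<and> F \<subseteq> S0}"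

lemma subspace_PQspan: "lop.subspace PQspan"
  by (simp add: PQspan_def lop.subspace_span)

lemma PQspan_inL: "A \<in> PQspan \<Longrightarrow> inL A"
  unfolding PQspan_def
proof (induction rule: lop.span_induct_alt)
  case base
  show ?case by (simp add: inL_def)
next
  case (step c x y)
  then have "inL x" by (auto simp: inL_def mult.assoc simp flip: mult.assoc[of U])
  then show ?case using step by (simp add: inL_def sc_simps distrib_left distrib_right)
qed

lemma PQspan_left:
  assumes "A \<in> PQspan" "\<And>\<sigma> F. \<sigma> permutes S0 \<Longrightarrow> F \<subseteq> S0 \<Longrightarrow> B * (P \<sigma> * Q F) \<in> PQspan"
  shows "B * A \<in> PQspan"
  using assms(1) unfolding PQspan_def
proof (induction rule: lop.span_induct_alt)
  case base
  show ?case by (simp add: lop.span_zero)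
next
  case (step c x y)
  then have "B * x \<in> PQspan" using assms(2) by auto
  then show ?case using step unfolding PQspan_def
    by (simp add: distrib_left sc_simps lop.span_add lop.span_scale)
qed

lemma PQ_in_PQspan: "\<sigma> permutes S0 \<Longrightarrow> F \<subseteq> S0 \<Longrightarrow> P \<sigma> * Q F \<in> PQspan"
  unfolding PQspan_def by (rule lop.span_base) blast

lemma P_PQspan: "\<tau> permutes S0 \<Longrightarrow> A \<in> PQspan \<Longrightarrow> P \<tau> * A \<in> PQspan"
  by (rule PQspan_left) (auto simp: P_mult permutes_compose PQ_in_PQspan simp flip: mult.assoc)

lemma Q_PQspan: "A \<in> PQspan \<Longrightarrow> Q G * A \<in> PQspan"
proof (rule PQspan_left)
  fix \<sigma> F assume *: "\<sigma> permutes S0" "F \<subseteq> S0"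
  have "Q G * (P \<sigma> * Q F) = Q G * Q (\<sigma> ` F) * P \<sigma>"
    using * by (simp add: P_Q mult.assoc)
  also have "\<dots> = (if G = \<sigma> ` F then P \<sigma> * Q F else 0)"
    using * by (auto simp: Q_Q P_Q)
  also have "\<dots> \<in> PQspan"
    using * by (auto simp: PQ_in_PQspan lop.subspace_0[OF subspace_PQspan])
  finally show "Q G * (P \<sigma> * Q F) \<in> PQspan" .
qed

lemma U_PQspan: "U \<in> PQspan"
proof -
  have "U = (\<Sum>F\<in>Pow S0. P id * Q F)" by (simp add: P_id sum_Q)
  also have "\<dots> \<in> PQspan"
    by (rule lop.subspace_sum[OF subspace_PQspan]) (auto intro: PQ_in_PQspan permutes_id)
  finally show ?thesis .
qed

end

interpretation lop2: vector_space_pair "sc :: complex \<Rightarrow> 'i lop \<Rightarrow> 'i lop" "sc :: complex \<Rightarrow> 'i lop \<Rightarrow> 'i lop" ..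

lemma lop_projection:
  assumes "lop.subspace (V :: 'i lop set)"
  obtains g :: "'i lop \<Rightarrow> 'i lop" where
    "\<And>A. g A \<in> V" "\<And>A. A \<in> V \<Longrightarrow> g A = A" "\<And>A B. g (A + B) = g A + g B" "\<And>c A. g (sc c A) = sc c (g A)"
proof -
  have "Vector_Spaces.linear sc sc (\<lambda>A :: 'i lop. A)"
    by (simp add: lop.linear_ident)
  from lop2.linear_exists_left_inverse_on[OF this assms]
  obtain g where g: "range g \<subseteq> V" "Vector_Spaces.linear sc sc g" "\<forall>v\<in>V. g v = v" by auto
  interpret g: Vector_Spaces.linear sc sc g by (rule g)
  show ?thesis using that[of g] g by (auto simp: g.add g.scale)
qed

context sites
begin

lemma bij_comp_permutes:
  assumes "\<tau> permutes S0"
  shows "bij_betw (\<lambda>\<sigma>. \<sigma> \<circ> \<tau>) {\<sigma>. \<sigma> permutes S0} {\<sigma>. \<sigma> permutes S0}"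
  by (rule bij_betw_byWitness[of _ "\<lambda>\<sigma>. \<sigma> \<circ> inv \<tau>"])
    (use assms in \<open>auto simp: comp_assoc permutes_inv_o permutes_compose permutes_inv\<close>)

text \<open>Maschke averaging of a linear projection onto the algebra spanned by the \<open>P \<sigma> * Q F\<close>.\<close>
lemma averaged_projection:
  obtains g :: "(nat \<Rightarrow> nat) lop \<Rightarrow> (nat \<Rightarrow> nat) lop" where
    "\<And>A. g A \<in> PQspan" "\<And>A. A \<in> PQspan \<Longrightarrow> g A = A" "\<And>A B. g (A + B) = g A + g B"
    "\<And>c A. g (sc c A) = sc c (g A)" "\<And>\<sigma> A. \<sigma> permutes S0 \<Longrightarrow> g (P \<sigma> * A) = P \<sigma> * g A"
    "\<And>F A. F \<subseteq> S0 \<Longrightarrow> g (Q F * A) = Q F * g A"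
proof -
  obtain h where h: "\<And>A. h A \<in> PQspan" "\<And>A. A \<in> PQspan \<Longrightarrow> h A = A"
    and h_add: "\<And>A B. h (A + B) = h A + h B" and h_sc: "\<And>c A. h (sc c A) = sc c (h A)"
    using lop_projection[OF subspace_PQspan] by metis
  have h_zero: "h 0 = 0" using h_sc[of 0 0] by simp
  \<comment> \<open>The pairs of \<open>\<sigma>\<close> and \<open>F\<close> take the place of
    group elements: \<open>Q F * P (inv \<sigma>)\<close> times \<open>P \<sigma> * Q F\<close> is
    \<open>Q F\<close>, and the \<open>Q F\<close> sum to \<open>U\<close>.\<close>
  define g where "g A = sc (1 / nperm) (\<Sum>\<sigma> | \<sigma> permutes S0. \<Sum>F\<in>Pow S0. Q F * P (inv \<sigma>) * h (P \<sigma> * Q F * A))" for A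
  show ?thesis
  proof
    show "g A \<in> PQspan" for A unfolding g_def
      by (intro lop.subspace_scale[OF subspace_PQspan] lop.subspace_sum[OF subspace_PQspan])
        (auto simp: mult.assoc intro!: Q_PQspan P_PQspan permutes_inv h)
    show "g A = A" if A: "A \<in> PQspan" for A
    proof -
      have "Q F * P (inv \<sigma>) * h (P \<sigma> * Q F * A) = Q F * A" if "\<sigma> permutes S0" for \<sigma> F
      proof -
        have "h (P \<sigma> * Q F * A) = P \<sigma> * (Q F * A)"
          using h(2)[OF P_PQspan[OF that Q_PQspan[OF A]]] by (simp add: mult.assoc)
        then have "Q F * P (inv \<sigma>) * h (P \<sigma> * Q F * A) = Q F * (P (inv \<sigma>) * P \<sigma>) * (Q F * A)"
          by (simp add: mult.assoc)
        also have "\<dots> = Q F * Q F * A"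
          unfolding P_inv(2)[OF that] by (simp add: mult.assoc)
        finally show ?thesis by (simp add: Q_Q)
      qed
      moreover have "(\<Sum>F\<in>Pow S0. Q F * A) = A"
        using PQspan_inL[OF A] by (simp add: sum_Q inL_def flip: sum_distrib_right)
      ultimately show ?thesis by (simp add: g_def sum_const_sc nperm_def[symmetric] del: sum_constant)
    qed
    show "g (A + B) = g A + g B" for A B
      by (simp add: g_def distrib_left h_add sum.distrib lop.scale_right_distrib)
    show "g (sc c A) = sc c (g A)" for c A
      by (simp add: g_def sc_simps h_sc mult.commute flip: lop.scale_sum_right)
    show "g (Q G * A) = Q G * g A" if G: "G \<subseteq> S0" for G A
    proof -
      have 1: "(\<Sum>F\<in>Pow S0. Q F * P (inv \<sigma>) * h (P \<sigma> * Q F * (Q G * A))) =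
          Q G * P (inv \<sigma>) * h (P \<sigma> * Q G * A)" for \<sigma>
      proof -
        have "P \<sigma> * Q F * (Q G * A) = (if F = G then P \<sigma> * Q G * A else 0)" for F
          by (simp add: mult.assoc Q_Q flip: mult.assoc[of "Q F"])
        then have "(\<Sum>F\<in>Pow S0. Q F * P (inv \<sigma>) * h (P \<sigma> * Q F * (Q G * A))) =
           (\<Sum>F\<in>Pow S0. if F = G then Q G * P (inv \<sigma>) * h (P \<sigma> * Q G * A) else 0)"
          by (intro sum.cong) (auto simp: h_zero)
        then show ?thesis using G by simp
      qed
      have 2: "(\<Sum>F\<in>Pow S0. Q G * (Q F * P (inv \<sigma>) * h (P \<sigma> * Q F * A))) =
          Q G * P (inv \<sigma>) * h (P \<sigma> * Q G * A)" for \<sigma>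
      proof -
        have "Q G * (Q F * P (inv \<sigma>) * h (P \<sigma> * Q F * A)) =
           (if F = G then Q G * P (inv \<sigma>) * h (P \<sigma> * Q G * A) else 0)" for F
          by (simp add: Q_Q flip: mult.assoc)
        then show ?thesis using G by simp
      qed
      show ?thesis unfolding g_def 1 by (simp add: 2 sc_simps sum_distrib_left)
    qed
    show "g (P \<tau> * A) = P \<tau> * g A" if t: "\<tau> permutes S0" for \<tau> A
    proof -
      let ?G = "\<lambda>\<sigma> F. Q F * P (inv \<sigma>) * h (P \<sigma> * Q F * A)"
      have inj: "inj \<tau>" using t by (rule permutes_inj)
      \<comment> \<open>The summand for \<open>\<sigma>\<close> and the image of \<open>F\<close>,
        evaluated at \<open>P \<tau> * A\<close>, is \<open>P \<tau>\<close> times the summand for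
        \<open>\<sigma> \<circ> \<tau>\<close> and \<open>F\<close> at \<open>A\<close>; the average
        is only reindexed.\<close>
      have step: "Q (\<tau> ` F) * P (inv \<sigma>) * h (P \<sigma> * Q (\<tau> ` F) * (P \<tau> * A)) = P \<tau> * ?G (\<sigma> \<circ> \<tau>) F"
        if s: "\<sigma> permutes S0" and F: "F \<in> Pow S0" for \<sigma> F
      proof -
        have F': "F \<subseteq> S0" using F by simp
        have "P \<sigma> * Q (\<tau> ` F) * (P \<tau> * A) = P \<sigma> * (Q (\<tau> ` F) * P \<tau>) * A" by (simp add: mult.assoc)
        also have "\<dots> = P \<sigma> * P \<tau> * Q F * A"
          unfolding P_Q[OF t F', symmetric] by (simp add: mult.assoc)
        finally have 1: "P \<sigma> * Q (\<tau> ` F) * (P \<tau> * A) = P (\<sigma> \<circ> \<tau>) * Q F * A"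
          by (simp add: P_mult s t)
        have "P \<tau> * P (inv \<tau> \<circ> inv \<sigma>) = P \<tau> * P (inv \<tau>) * P (inv \<sigma>)"
          by (simp only: mult.assoc P_mult[OF permutes_inv[OF t] permutes_inv[OF s]])
        moreover have "inv (\<sigma> \<circ> \<tau>) = inv \<tau> \<circ> inv \<sigma>"
          using s t by (intro o_inv_distrib permutes_bij)
        ultimately have "P \<tau> * P (inv (\<sigma> \<circ> \<tau>)) = P (inv \<sigma>)"
          by (simp add: P_inv t)
        moreover have "P \<tau> * (Q F * P (inv (\<sigma> \<circ> \<tau>))) = Q (\<tau> ` F) * (P \<tau> * P (inv (\<sigma> \<circ> \<tau>)))"
          using P_Q[OF t F'] by (simp flip: mult.assoc)
        ultimately have "Q (\<tau> ` F) * P (inv \<sigma>) = P \<tau> * (Q F * P (inv (\<sigma> \<circ> \<tau>)))"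
          by simp
        then show ?thesis unfolding 1 by (simp add: mult.assoc)
      qed
      have "(\<Sum>F\<in>Pow S0. Q F * P (inv \<sigma>) * h (P \<sigma> * Q F * (P \<tau> * A))) =
          (\<Sum>F\<in>Pow S0. P \<tau> * ?G (\<sigma> \<circ> \<tau>) F)" if s: "\<sigma> permutes S0" for \<sigma>
      proof -
        have bij: "bij_betw (image \<tau>) (Pow S0) (Pow S0)"
          by (rule bij_betw_Pow[OF permutes_imp_bij[OF t]])
        show ?thesis
          by (subst sum.reindex_bij_betw[OF bij, symmetric]) (intro sum.cong refl step s)
      qed
      then have "(\<Sum>\<sigma> | \<sigma> permutes S0. \<Sum>F\<in>Pow S0. Q F * P (inv \<sigma>) * h (P \<sigma> * Q F * (P \<tau> * A))) =
         (\<Sum>\<sigma> | \<sigma> permutes S0. \<Sum>F\<in>Pow S0. P \<tau> * ?G (\<sigma> \<circ> \<tau>) F)"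
        by (rule sum.cong[OF refl]) simp
      also have "\<dots> = (\<Sum>\<sigma> | \<sigma> permutes S0. \<Sum>F\<in>Pow S0. P \<tau> * ?G \<sigma> F)"
        by (rule sum.reindex_bij_betw[OF bij_comp_permutes[OF t], of "\<lambda>\<sigma>. \<Sum>F\<in>Pow S0. P \<tau> * ?G \<sigma> F"])
      finally show ?thesis by (simp add: g_def sc_simps sum_distrib_left)
    qed
  qed
qed

text \<open>An equivariant projection \<open>g\<close> is built columnwise from operators in the
  commutant, so it respects left multiplication by \<open>M\<close> on \<open>U\<close>. Then
  \<open>M = M * g U = g M\<close> lies in the image of \<open>g\<close>.\<close>

lemma double_commutant:
  assumes M: "inL M" and comm: "\<And>N. PQcomm N \<Longrightarrow> M * N = N * M"
  shows "M \<in> PQspan"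
proof -
  obtain g where g: "\<And>A. g A \<in> PQspan" "\<And>A. A \<in> PQspan \<Longrightarrow> g A = A"
    and g_add: "\<And>A B. g (A + B) = g A + g B" and g_sc: "\<And>c A. g (sc c A) = sc c (g A)"
    and g_P: "\<And>\<sigma> A. \<sigma> permutes S0 \<Longrightarrow> g (P \<sigma> * A) = P \<sigma> * g A"
    and g_Q: "\<And>F A. F \<subseteq> S0 \<Longrightarrow> g (Q F * A) = Q F * g A"
    by (rule averaged_projection) blast
  have g_zero: "g 0 = 0" using g_sc[of 0 0] by simp
  have g_sum: "g (sum f S) = (\<Sum>s\<in>S. g (f s))" for f :: "(nat \<Rightarrow> nat) \<Rightarrow> (nat \<Rightarrow> nat) lop" and S
    by (induction S rule: infinite_finite_induct) (auto simp: g_add g_zero)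
  have inLg: "inL (g A)" for A using g(1) PQspan_inL by blast
  have outer_add: "outer (f + f') K = outer f K + outer f' K"
    and outer_smul: "outer (smul c f) K = sc c (outer f K)" for c f f' and K :: "nat \<Rightarrow> nat"
    by (rule lop_eqI; simp add: smul_def algebra_simps)+
  \<comment> \<open>Column \<open>J\<close> of \<open>g\<close> on matrices supported in column \<open>K\<close>; it lies in the commutant since \<open>g\<close> is equivariant.\<close>
  define N where "N J K = Lop (\<lambda>f. ap (g (outer (ap U f) K)) (bv J))" for J K
  have ap_N: "ap (N J K) f = ap (g (outer (ap U f) K)) (bv J)" for J K f
    unfolding N_def
    by (subst Lop_inverse) (auto simp: ap_add ap_smul outer_add outer_smul g_add g_sc)
  have "PQcomm (N J K)" for J K
    unfolding PQcomm_def
  proof (intro conjI allI impI)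
    have "ap U (ap (g A) f) = ap (g A) f" "ap U (ap U f) = ap U f" for A f
      using inLg[of A] U_idem by (metis ap_simps(3) inL_def)+
    then show "inL (N J K)"
      unfolding inL_def by (auto intro!: lop_eqI simp: ap_N)
    show "P \<sigma> * N J K = N J K * P \<sigma>" if s: "\<sigma> permutes S0" for \<sigma>
    proof (rule lop_eqI)
      fix f i
      have "ap U (ap (P \<sigma>) f) = ap (P \<sigma>) (ap U f)"
        using U_P(1)[of \<sigma>] U_P(2)[OF s] by (metis ap_simps(3))
      then show "ap (P \<sigma> * N J K) f i = ap (N J K * P \<sigma>) f i"
        by (simp add: ap_N g_P s flip: mult_outer)
    qed
    show "Q F * N J K = N J K * Q F" if F: "F \<subseteq> S0" for F
    proof (rule lop_eqI)
      fix f i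
      have "ap U (ap (Q F) f) = ap (Q F) (ap U f)"
        using U_Q[of F] by (metis ap_simps(3))
      then show "ap (Q F * N J K) f i = ap (N J K * Q F) f i"
        by (simp add: ap_N g_Q F flip: mult_outer)
    qed
  qed
  from comm[OF this] have MN: "ap M (ap (N J K) f) = ap (N J K) (ap M f)" for J K f
    by (metis ap_simps(3))
  have U_sum: "U = (\<Sum>K\<in>L. outer (bv K) K)"
    by (rule lop_eqI) (simp add: ap_sum sum_fun_app U_def smul_def bv_def if_distrib[of "\<lambda>z. _ * z"] cong: if_cong)
  have U_bv: "K \<in> L \<Longrightarrow> ap U (bv K) = bv K" for K
    by (intro ext) (auto simp: U_def bv_def)
  have UM: "ap U (ap M f) = ap M f" for f using M by (metis ap_simps(3) inL_def)
  \<comment> \<open>Write \<open>U\<close> and \<open>M\<close> as sums of their columns. Column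
    \<open>J\<close> of \<open>g M\<close> is the sum of \<open>N J K\<close> applied to column
    \<open>K\<close> of \<open>M\<close>, and \<open>M\<close> can be pulled out in front of
    \<open>N J K\<close>.\<close>
  have "M * g U = g M"
  proof (rule inL_eqI)
    show "inL (M * g U)" by (intro inL_mult M inLg)
    fix w assume w: "w \<in> W"
    let ?J = "cols w"
    have "ap (g U) (bv ?J) = (\<Sum>K\<in>L. ap (N ?J K) (bv K))"
      by (subst U_sum) (simp add: g_sum ap_sum ap_N U_bv)
    then have "ap M (ap (g U) (bv ?J)) = (\<Sum>K\<in>L. ap (N ?J K) (ap M (bv K)))"
      by (simp add: ap_sum_arg MN)
    also have "\<dots> = ap (g (\<Sum>K\<in>L. M * outer (bv K) K)) (bv ?J)"
      by (simp add: ap_N UM g_sum ap_sum mult_outer)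
    also have "(\<Sum>K\<in>L. M * outer (bv K) K) = M"
      using M by (simp add: inL_def flip: sum_distrib_left U_sum)
    finally show "ent (M * g U) w = ent (g M) w" by (simp add: ent_def)
  qed (rule inLg)
  then have "g M = M" using M by (simp add: g(2) U_PQspan inL_def)
  then show ?thesis using g(1)[of M] by simp
qed

text \<open>The commutant of \<open>PQspan\<close> consists of symmetrised words in k, with which an
  operator commuting with k commutes; so it lies in the double commutant.\<close>

lemma invariant_in_PQspan:
  assumes inL: "inL A" and comm: "\<And>x. x \<in> kletters \<Longrightarrow> A * Delta x = Delta x * A"
  shows "A \<in> PQspan"
proof (rule double_commutant[OF inL])
  fix N assume "PQcomm N"
  then obtain c where "N = (\<Sum>w\<in>W \<inter> {w. set w \<subseteq> kletters}. sc (c w) (Tm S0 w))"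
    using PQcomm_Tm by blast
  then show "A * N = N * A"
    using commute_Tm[OF inL comm] by (simp add: sum_distrib_left sum_distrib_right sc_simps)
qed

end

section \<open>The tensor algebra and its ideals\<close>

declare plus_fun_apply [simp del] zero_fun_apply [simp del] minus_apply [simp del]

lemmas fun_app = plus_fun_apply zero_fun_apply minus_apply

lemma tens_ops: "tadd = (+)" "tsub = (-)" "tzero = 0" "tscale = smul"
  by (auto simp: fun_eq_iff fun_app tadd_def tsub_def tzero_def tscale_def smul_def)

global_interpretation vs: vector_space "smul :: complex \<Rightarrow> ('i \<Rightarrow> complex) \<Rightarrow> 'i \<Rightarrow> complex"
  by standard (auto simp: smul_def fun_eq_iff fun_app algebra_simps)

definition wd :: "word \<Rightarrow> tens" where "wd w = (\<lambda>v. if v = w then 1 else 0)"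

lemma gen_wd: "gen i j = wd [(i, j)]"
  by (auto simp: gen_def wd_def)

lemma tmul_add_left: "tmul (a + b) c = tmul a c + tmul b c"
  and tmul_add_right: "tmul c (a + b) = tmul c a + tmul c b"
  and tmul_smul_left: "tmul (smul k a) c = smul k (tmul a c)"
  and tmul_smul_right: "tmul c (smul k a) = smul k (tmul c a)"
  by (auto simp: tmul_def fun_eq_iff fun_app smul_def algebra_simps sum.distrib sum_distrib_left)

lemma tmul_diff_left: "tmul (a - b) c = tmul a c - tmul b c"
  and tmul_diff_right: "tmul c (a - b) = tmul c a - tmul c b"
  by (auto simp: tmul_def fun_eq_iff fun_app algebra_simps sum_subtractf)

lemma tmul_zero [simp]: "tmul 0 c = 0" "tmul c 0 = 0"
  by (auto simp: tmul_def fun_eq_iff fun_app)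

lemma tmul_wd: "tmul (wd u) (wd v) = wd (u @ v)"
proof
  fix w
  have "tmul (wd u) (wd v) w = (\<Sum>i\<le>length w. if i = length u then (if w = u @ v then 1 else 0) else 0)"
    unfolding tmul_def
  proof (rule sum.cong[OF refl])
    fix i assume "i \<in> {..length w}"
    then have "i = length (take i w)" by simp
    then have "take i w = u \<and> drop i w = v \<longleftrightarrow> i = length u \<and> w = u @ v"
      by (metis append_eq_conv_conj append_take_drop_id)
    moreover have "wd u (take i w) * wd v (drop i w) = (if take i w = u \<and> drop i w = v then 1 else 0)"
      by (simp add: wd_def)
    ultimately show "wd u (take i w) * wd v (drop i w) = (if i = length u then (if w = u @ v then 1 else 0) else 0)"
      by (simp only: if_if_eq_conj simp_thms split: if_split)
  qed
  then show "tmul (wd u) (wd v) w = wd (u @ v) w" by (simp add: wd_def)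
qed

lemmas tmul_lin = tmul_add_left tmul_add_right tmul_smul_left tmul_smul_right
  tmul_diff_left tmul_diff_right

context sites
begin

lemma tens_ok_iff: "tens_ok p q a \<longleftrightarrow> finite {w. a w \<noteq> 0} \<and> (\<forall>w. a w \<noteq> 0 \<longrightarrow> set w \<subseteq> letters)"
  by (force simp: tens_ok_def fin_supp_def letters_def idx_def)

lemma ok_zero: "tens_ok p q 0"
  by (simp add: tens_ok_iff fun_app)

lemma ok_wd: "set w \<subseteq> letters \<Longrightarrow> tens_ok p q (wd w)"
  by (auto simp: tens_ok_iff wd_def)

lemma ok_add: "tens_ok p q a \<Longrightarrow> tens_ok p q b \<Longrightarrow> tens_ok p q (a + b)"
proof -
  assume ab: "tens_ok p q a" "tens_ok p q b"
  have sub: "{w. (a + b) w \<noteq> 0} \<subseteq> {w. a w \<noteq> 0} \<union> {w. b w \<noteq> 0}" by (auto simp: fun_app)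
  then have "finite {w. (a + b) w \<noteq> 0}"
    using ab by (auto simp: tens_ok_iff intro: finite_subset)
  then show ?thesis using ab sub unfolding tens_ok_iff by blast
qed

lemma ok_smul: "tens_ok p q a \<Longrightarrow> tens_ok p q (smul c a)"
  by (auto simp: tens_ok_iff smul_def intro: finite_subset[of _ "{w. a w \<noteq> 0}"])

lemma ok_diff: "tens_ok p q a \<Longrightarrow> tens_ok p q b \<Longrightarrow> tens_ok p q (a - b)"
  using ok_add[of a "smul (-1) b"] ok_smul[of b "-1"] by (simp add: vs.scale_minus_left)

lemma tens_expand: "finite S \<Longrightarrow> {w. a w \<noteq> 0} \<subseteq> S \<Longrightarrow> a = (\<Sum>w\<in>S. smul (a w) (wd w))"
  by (rule ext) (auto simp: fun_app sum_fun_app smul_def wd_def if_distrib[of "\<lambda>z. _ * z"] cong: if_cong)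

lemma tens_ok_induct [consumes 1, case_names zero step]:
  assumes "tens_ok p q a" "R 0"
    "\<And>a c w. tens_ok p q a \<Longrightarrow> set w \<subseteq> letters \<Longrightarrow> R a \<Longrightarrow> R (a + smul c (wd w))"
  shows "R a"
proof -
  let ?S = "{w. a w \<noteq> 0}"
  have fin: "finite ?S" and sub: "\<forall>w\<in>?S. set w \<subseteq> letters" using assms(1) by (auto simp: tens_ok_iff)
  have "finite T \<Longrightarrow> T \<subseteq> ?S \<Longrightarrow> R (\<Sum>w\<in>T. smul (a w) (wd w)) \<and> tens_ok p q (\<Sum>w\<in>T. smul (a w) (wd w))" for T
  proof (induction T rule: finite_induct)
    case empty
    show ?case using assms(2) ok_zero by simp
  next
    case (insert w T)
    then have w: "set w \<subseteq> letters" using sub by auto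
    have "(\<Sum>w\<in>insert w T. smul (a w) (wd w)) = (\<Sum>w\<in>T. smul (a w) (wd w)) + smul (a w) (wd w)"
      by (simp only: sum.insert[OF insert(1,2)] add.commute)
    then show ?case using insert w assms(3) by (simp only: ok_add ok_smul ok_wd insert_subset simp_thms)
  qed
  from this[OF fin order.refl] show ?thesis
    by (simp only: tens_expand[OF fin order.refl, symmetric])
qed

lemma ok_tmul: "tens_ok p q a \<Longrightarrow> tens_ok p q b \<Longrightarrow> tens_ok p q (tmul a b)"
proof (induction a rule: tens_ok_induct)
  case (step a c w)
  have "tens_ok p q (tmul (wd w) b)" using step.prems
    by (induction b rule: tens_ok_induct)
      (use step.hyps in \<open>auto simp: tmul_lin tmul_wd intro!: ok_zero ok_add ok_smul ok_wd\<close>)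
  then show ?case using step by (simp only: tmul_lin ok_add ok_smul)
qed (simp add: ok_zero)

lemma tmul_assoc:
  assumes "tens_ok p q a" "tens_ok p q b" "tens_ok p q c"
  shows "tmul (tmul a b) c = tmul a (tmul b c)"
  using assms(1)
proof (induction a rule: tens_ok_induct)
  case (step a k u)
  have "tmul (tmul (wd u) b) c = tmul (wd u) (tmul b c)"
    using assms(2)
  proof (induction b rule: tens_ok_induct)
    case (step b k v)
    have "tmul (wd (u @ v)) c = tmul (wd u) (tmul (wd v) c)"
      using assms(3) by (induction c rule: tens_ok_induct) (simp_all add: tmul_lin tmul_wd)
    then show ?case using step by (simp only: tmul_lin tmul_wd)
  qed simp
  then show ?case using step by (simp only: tmul_lin)
qed simp

section \<open>The ideal of relations and the left ideal generated by k\<close>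

abbreviation "II \<equiv> Irel p q"
abbreviation "KK \<equiv> Uk_pre p q"

lemma II_zero: "0 \<in> II" and II_add: "a \<in> II \<Longrightarrow> b \<in> II \<Longrightarrow> a + b \<in> II"
  and II_smul: "a \<in> II \<Longrightarrow> smul c a \<in> II"
  and II_lmul: "a \<in> II \<Longrightarrow> tens_ok p q x \<Longrightarrow> tmul x a \<in> II"
  and II_rmul: "a \<in> II \<Longrightarrow> tens_ok p q x \<Longrightarrow> tmul a x \<in> II"
  using tideal.intros[where R = "urels p q" and ok = "tens_ok p q"]
  by (simp_all add: Irel_def tens_ops)

lemma subspace_II: "vs.subspace II"
  by (simp add: vs.subspace_def II_zero II_add II_smul)

lemma KK_II: "a \<in> II \<Longrightarrow> a \<in> KK" by (rule Uk_pre.rel)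

lemma KK_add: "a \<in> KK \<Longrightarrow> b \<in> KK \<Longrightarrow> a + b \<in> KK"
  using Uk_pre.add[of a p q b] by (simp add: tens_ops)

lemma kidx_kletters: "kidx p q i j \<longleftrightarrow> (i, j) \<in> kletters"
  by (auto simp: kidx_def kletters_def letters_def idx_def valid_idx_def)

lemma KK_gen: "tens_ok p q a \<Longrightarrow> x \<in> kletters \<Longrightarrow> tmul a (wd [x]) \<in> KK"
  using Uk_pre.kgen[of p q a "fst x" "snd x"] by (simp add: kidx_kletters gen_wd)

lemma KK_smul: "a \<in> KK \<Longrightarrow> smul c a \<in> KK"
proof (induction rule: Uk_pre.induct)
  case (kgen a i j)
  then show ?case using KK_gen[of "smul c a" "(i, j)"] ok_smul[of a c]
    by (simp add: kidx_kletters gen_wd tmul_lin)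
next
  case (add a b)
  then show ?case by (simp add: tens_ops vs.scale_right_distrib KK_add)
qed (rule KK_II, rule II_smul)

lemma subspace_KK: "vs.subspace KK"
  by (simp add: vs.subspace_def KK_II[OF II_zero] KK_add KK_smul)

lemma KK_lmul: "a \<in> KK \<Longrightarrow> tens_ok p q x \<Longrightarrow> tmul x a \<in> KK"
proof (induction rule: Uk_pre.induct)
  case (rel a)
  then show ?case by (intro KK_II II_lmul)
next
  case (kgen a i j)
  then have ij: "(i, j) \<in> kletters" by (simp add: kidx_kletters)
  then have "tens_ok p q (wd [(i, j)])" by (auto intro!: ok_wd simp: kletters_letters)
  then have "tmul x (tmul a (gen i j)) = tmul (tmul x a) (wd [(i, j)])"
    using kgen by (simp add: gen_wd tmul_assoc)
  then show ?case using KK_gen[OF ok_tmul ij] kgen by simp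
next
  case (add a b)
  then show ?case by (simp add: tens_ops tmul_lin KK_add)
qed

section \<open>Calculation modulo the left ideal and lower degree\<close>

definition low :: "nat \<Rightarrow> tens set" where
  "low n = {a. tens_ok p q a \<and> (\<forall>w. a w \<noteq> 0 \<longrightarrow> length w < n)}"

text \<open>The left ideal generated by \<open>k\<close> up to terms of degree less than \<open>d\<close>.\<close>
definition Kd :: "tens set" where
  "Kd = {a. \<exists>b\<in>KK. a - b \<in> low d}"

lemma subspace_low: "vs.subspace (low n)"
  unfolding vs.subspace_def
proof (intro conjI ballI allI)
  show "0 \<in> low n" by (simp add: low_def ok_zero fun_app)
  show "a + b \<in> low n" if "a \<in> low n" "b \<in> low n" for a b
  proof -
    have "a w \<noteq> 0 \<or> b w \<noteq> 0" if "(a + b) w \<noteq> 0" for w using that by (auto simp: fun_app)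
    then show ?thesis using that ok_add unfolding low_def by blast
  qed
  show "smul c a \<in> low n" if "a \<in> low n" for c a
    using that by (auto simp: low_def ok_smul) (auto simp: smul_def)
qed

lemma KK_Kd: "a \<in> KK \<Longrightarrow> a \<in> Kd"
  using vs.subspace_0[OF subspace_low] by (auto simp: Kd_def intro!: bexI[of _ a])

lemma II_Kd: "a \<in> II \<Longrightarrow> a \<in> Kd"
  by (intro KK_Kd KK_II)

lemma low_Kd: "a \<in> low d \<Longrightarrow> a \<in> Kd"
  using vs.subspace_0[OF subspace_KK] by (auto simp: Kd_def intro!: bexI[of _ 0])

lemma subspace_Kd: "vs.subspace Kd"
proof -
  have "0 \<in> Kd" by (intro KK_Kd vs.subspace_0 subspace_KK)
  moreover have "a + b \<in> Kd" if ab: "a \<in> Kd" "b \<in> Kd" for a b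
  proof -
    obtain a' b' where "a' \<in> KK" "b' \<in> KK" "a - a' \<in> low d" "b - b' \<in> low d"
      using ab by (auto simp: Kd_def)
    then have "a' + b' \<in> KK" "(a - a') + (b - b') \<in> low d"
      by (auto intro: KK_add vs.subspace_add[OF subspace_low])
    then show ?thesis unfolding Kd_def by (auto intro!: bexI[of _ "a' + b'"] simp: add_diff_add)
  qed
  moreover have "smul c a \<in> Kd" if a: "a \<in> Kd" for c a
  proof -
    obtain a' where "a' \<in> KK" "a - a' \<in> low d" using a by (auto simp: Kd_def)
    then have "smul c a' \<in> KK" "smul c (a - a') \<in> low d"
      by (auto intro: KK_smul vs.subspace_scale[OF subspace_low])
    then show ?thesis unfolding Kd_def by (auto intro!: bexI[of _ "smul c a'"] simp: vs.scale_right_diff_distrib)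
  qed
  ultimately show ?thesis unfolding vs.subspace_def by blast
qed

lemmas Kd_add = vs.subspace_add[OF subspace_Kd] and Kd_smul = vs.subspace_scale[OF subspace_Kd]
  and Kd_diff = vs.subspace_diff[OF subspace_Kd] and Kd_sum = vs.subspace_sum[OF subspace_Kd]

lemma low_smul_wd: "set w \<subseteq> letters \<Longrightarrow> length w < n \<Longrightarrow> smul c (wd w) \<in> low n"
  by (auto simp: low_def smul_def wd_def tens_ok_iff)

definition brk :: "nat \<times> nat \<Rightarrow> nat \<times> nat \<Rightarrow> word \<Rightarrow> word \<Rightarrow> tens" where
  "brk x y u v = smul (kron (snd x) (fst y)) (wd (u @ (fst x, snd y) # v))
     - smul (ss x y * kron (snd y) (fst x)) (wd (u @ (fst y, snd x) # v))"

lemma swap_II: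
  assumes "x \<in> letters" "y \<in> letters" "set u \<subseteq> letters" "set v \<subseteq> letters"
  shows "wd (u @ x # y # v) - smul (ss x y) (wd (u @ y # x # v)) - brk x y u v \<in> II"
proof -
  define r where "r = urel p (fst x) (snd x) (fst y) (snd y)"
  have "r \<in> urels p q"
    using assms unfolding urels_def r_def by (fastforce simp: letters_def idx_def valid_idx_def)
  then have "r \<in> II" unfolding Irel_def by (rule tideal.base)
  then have "tmul (tmul (wd u) r) (wd v) \<in> II"
    using assms by (intro II_rmul II_lmul ok_wd)
  also have "tmul (tmul (wd u) r) (wd v) =
      wd (u @ x # y # v) - smul (ss x y) (wd (u @ y # x # v)) - brk x y u v"
    by (simp add: r_def urel_def sbracket_def tens_ops gen_wd tmul_lin tmul_wd brk_def ss_def)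
  finally show ?thesis .
qed

text \<open>The bracket replaces two letters by one and so has length \<open>d - 1\<close>: modulo
  \<open>Kd\<close>, words of length \<open>d\<close> are supercommutative.\<close>

lemma swap_Kd:
  assumes "x \<in> letters" "y \<in> letters" "set u \<subseteq> letters" "set v \<subseteq> letters" "length u + length v + 2 = d"
  shows "wd (u @ x # y # v) - smul (ss x y) (wd (u @ y # x # v)) \<in> Kd"
proof -
  have "brk x y u v \<in> low d"
    unfolding brk_def using assms
    by (intro vs.subspace_diff[OF subspace_low] low_smul_wd) (auto simp: letters_def)
  from Kd_add[OF II_Kd[OF swap_II[OF assms(1-4)]] low_Kd[OF this]] show ?thesis by simp
qed

text \<open>Swaps carry the letter of k to the right end, where the word visibly lies in the left
  ideal. What survives in degree \<open>d\<close> are words in letters of p.\<close>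

lemma kword_Kd:
  assumes "w \<in> W" "\<not> set w \<inter> kletters = {}" shows "wd w \<in> Kd"
proof -
  obtain x u v where x: "x \<in> kletters" and w: "w = u @ x # v"
    using assms(2) by (metis disjoint_iff in_set_conv_decomp)
  have xl: "x \<in> letters" by (rule kletters_letters[OF x])
  have "set u \<subseteq> letters" "set v \<subseteq> letters" "length u + length v + 1 = d"
    using assms(1) w by (auto simp: W_def)
  then have "wd (u @ x # v) \<in> Kd"
  proof (induction v arbitrary: u)
    case Nil
    then show ?case using KK_Kd[OF KK_gen[OF ok_wd x]] by (auto simp: tmul_wd)
  next
    case (Cons y v)
    have "wd (u @ x # y # v) - smul (ss x y) (wd (u @ y # x # v)) \<in> Kd"
      using Cons.prems xl by (intro swap_Kd) auto
    moreover have "wd ((u @ [y]) @ x # v) \<in> Kd"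
      using Cons.prems by (intro Cons.IH) auto
    ultimately show ?case
      using Kd_add[of _ "smul (ss x y) (wd (u @ y # x # v))"] Kd_smul by fastforce
  qed
  then show ?thesis by (simp add: w)
qed

end

text \<open>Any rearrangement is reached by adjacent swaps. Keeping the multiset \<open>M\<close> in
  the swap hypothesis makes properties of the entries, such as distinct sites, available at each
  swap.\<close>

lemma adjacent_swap_induct:
  assumes swap: "\<And>us x y vs. mset (us @ x # y # vs) = M \<Longrightarrow> R (us @ x # y # vs) \<Longrightarrow> R (us @ y # x # vs)"
    and "R xs" "mset xs = M" "mset ys = M"
  shows "R ys"
proof -
  have front: "R (us @ y # l @ r)" if "R (us @ l @ y # r)" "mset (us @ l @ y # r) = M" for us l y r
    using that
  proof (induction l arbitrary: r rule: rev_induct)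
    case (snoc x l)
    have "R (us @ l @ y # x # r)"
      using swap[of "us @ l" x y r] snoc.prems by simp
    then show ?case using snoc.IH[of "x # r"] snoc.prems by (simp add: add_mset_commute)
  qed simp
  have "R (us @ ys)" if "R (us @ xs)" "mset (us @ xs) = M" "mset xs = mset ys" for us xs ys
    using that
  proof (induction ys arbitrary: us xs)
    case (Cons y ys)
    then have "y \<in> set xs" by (metis list.set_intros(1) set_mset_mset)
    then obtain l r where xs: "xs = l @ y # r" by (metis split_list)
    have "R (us @ y # l @ r)" using front[of us l y r] Cons.prems by (simp add: xs)
    then show ?case using Cons.IH[of "us @ [y]" "l @ r"] Cons.prems by (simp add: xs)
  qed simp
  from this[of "[]" xs ys] show ?thesis using assms by simp
qed

context sites
begin

section \<open>Operators as tensors modulo lower degree\<close>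

lemma Ten_add: "Ten (A + B) = Ten A + Ten B" and Ten_sc: "Ten (sc c A) = smul c (Ten A)"
  and Ten_diff: "Ten (A - B) = Ten A - Ten B" and Ten_zero: "Ten 0 = 0"
  by (auto simp: Ten_def ent_simps smul_def fun_eq_iff fun_app algebra_simps)

lemma Ten_sum: "Ten (sum f S) = (\<Sum>s\<in>S. Ten (f s))"
  by (induction S rule: infinite_finite_induct) (auto simp: Ten_zero Ten_add)

lemma Ten_Op: "w \<in> W \<Longrightarrow> Ten (Op w) = wd w"
  by (rule ext) (auto simp: fun_app Ten_def wd_def ent_Op)

lemma ok_Ten: "tens_ok p q (Ten A)"
  by (auto simp: tens_ok_iff Ten_def W_def[symmetric] intro!: finite_subset[OF _ finite_W])
    (auto simp: W_def split: if_splits)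

lemma Ten_expand: "Ten A = (\<Sum>w\<in>W. smul (Ten A w) (wd w))"
  by (rule tens_expand) (auto simp: Ten_def split: if_splits)

lemma opz_swap:
  assumes "a \<noteq> b" "a \<in> S0" "b \<in> S0" "x \<in> letters" "y \<in> letters"
  shows "opz (us @ (a, x) # (b, y) # vs) = sc (ss x y) (opz (us @ (b, y) # (a, x) # vs))"
proof (induction us)
  case Nil
  show ?case using e_mult_diff[OF assms] by (simp add: sc_simps flip: mult.assoc)
next
  case (Cons z us)
  then show ?case by (cases z) (simp add: sc_simps)
qed

text \<open>Exchanging two neighbouring letters costs the same Koszul sign for operators at distinct
  sites as for words modulo \<open>Kd\<close>. So the claim passes between all orders of
  \<open>zs\<close>, and in the order of the sites it holds by \<open>Ten_Op\<close>.\<close>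

lemma Ten_opz:
  assumes "set zs \<subseteq> S0 \<times> letters" "distinct (map fst zs)" "length zs = d"
  shows "Ten (opz zs) - wd (map snd zs) \<in> Kd"
proof -
  have fst_zs: "set (map fst zs) = S0"
  proof (rule card_subset_eq)
    show "set (map fst zs) \<subseteq> S0" using assms(1) by auto
    show "card (set (map fst zs)) = card S0" using assms distinct_card[of "map fst zs"] by (simp add: S0_def)
  qed simp
  \<comment> \<open>The letters of \<open>zs\<close> read off in the order of their sites.\<close>
  define w where "w = map (\<lambda>a. the (map_of zs a)) [0..<d]"
  have enum: "enumerate 0 w = map (\<lambda>a. (a, the (map_of zs a))) [0..<d]"
    by (simp add: w_def enumerate_eq_zip zip_map2 zip_same_conv_map)
  have "set (enumerate 0 w) = set zs"
  proof -
    have "(\<lambda>a. (a, the (map_of zs a))) ` S0 = (\<lambda>a. (a, the (map_of zs a))) ` fst ` set zs"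
      using fst_zs by simp
    also have "\<dots> = set zs" using assms(2) by (force simp: image_image image_iff)
    finally show ?thesis unfolding enum by (simp add: S0_def atLeast0LessThan)
  qed
  moreover have "distinct (enumerate 0 w)" "distinct zs"
    using assms(2) by (auto simp: distinct_enumerate distinct_map)
  ultimately have mset: "mset (enumerate 0 w) = mset zs"
    by (metis set_eq_iff_mset_eq_distinct)
  have sub: "set zs' \<subseteq> S0 \<times> letters" "distinct (map fst zs')" "length zs' = d" if "mset zs' = mset zs" for zs'
  proof -
    show "set zs' \<subseteq> S0 \<times> letters" "length zs' = d"
      using assms mset_eq_setD[OF that] mset_eq_length[OF that] by auto
    have "mset (map fst zs') = mset (map fst zs)" using that by simp
    then show "distinct (map fst zs')" using assms(2) by (metis distinct_count_atmost_1 set_mset_mset)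
  qed
  let ?R = "\<lambda>zs. Ten (opz zs) - wd (map snd zs) \<in> Kd"
  show "?R zs"
  proof (rule adjacent_swap_induct[where R = ?R and M = "mset zs"])
    fix us z z' vs
    assume m: "mset (us @ z # z' # vs) = mset zs" and R: "?R (us @ z # z' # vs)"
    obtain a x b y where [simp]: "z = (a, x)" "z' = (b, y)" by (cases z, cases z') auto
    note * = sub[OF m]
    have "opz (us @ z' # z # vs) = sc (ss x y) (opz (us @ z # z' # vs))"
      using * opz_swap[of b a y x us vs] by (auto simp: ss_commute)
    moreover have "set (map snd us) \<subseteq> letters" "set (map snd vs) \<subseteq> letters"
      using *(1) by auto
    then have "wd (map snd us @ y # x # map snd vs) - smul (ss x y) (wd (map snd us @ x # y # map snd vs)) \<in> Kd"
      using * swap_Kd[of y x "map snd us" "map snd vs"] by (auto simp: ss_commute)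
    ultimately have "smul (ss x y) (Ten (opz (us @ z # z' # vs)) - wd (map snd (us @ z # z' # vs))) -
      (wd (map snd us @ y # x # map snd vs) - smul (ss x y) (wd (map snd us @ x # y # map snd vs))) \<in> Kd"
      "Ten (opz (us @ z' # z # vs)) = smul (ss x y) (Ten (opz (us @ z # z' # vs)))"
      by (auto intro: Kd_diff Kd_smul[OF R] simp only: Ten_sc)
    then show "?R (us @ z' # z # vs)"
      by (simp add: vs.scale_right_diff_distrib)
  next
    have "set w = snd ` set (enumerate 0 w)" by (simp flip: set_map)
    then have "w \<in> W" using sub(1,3)[OF mset] by (auto simp: W_def)
    then show "?R (enumerate 0 w)"
      using Ten_Op[of w] vs.subspace_0[OF subspace_Kd] by (simp add: Op_def)
  qed (use mset in auto)
qed

lemma zip_sub: "set as \<subseteq> S0 \<Longrightarrow> set w \<subseteq> letters \<Longrightarrow> set (zip as w) \<subseteq> S0 \<times> letters"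
  by (auto dest: set_zip_leftD set_zip_rightD)

text \<open>Conjugation only relabels the sites, and modulo \<open>Kd\<close> the tensor depends on
  the sequence of letters alone.\<close>

lemma Ten_conj:
  assumes s: "\<sigma> permutes S0" and A: "inL A"
  shows "Ten (P \<sigma> * A * P (inv \<sigma>)) - Ten A \<in> Kd"
proof -
  have 1: "Ten (P \<sigma> * Op w * P (inv \<sigma>)) - wd w \<in> Kd" if w: "w \<in> W" for w
  proof -
    have len: "length w = d" using w by (simp add: W_def)
    have e: "set (enumerate 0 w) \<subseteq> S0 \<times> letters"
      using w by (intro enumerate_S0) (auto simp: W_def)
    have as: "map \<sigma> [0..<d] \<in> dlists S0 d"
      using bij_betwE[OF dlists_permutes] s by blast
    have "Ten (opz (zip (map \<sigma> [0..<d]) w)) - wd (map snd (zip (map \<sigma> [0..<d]) w)) \<in> Kd"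
      using as w len by (intro Ten_opz) (auto simp: dlists_def W_def zip_sub)
    then show ?thesis
      unfolding Op_def P_opz[OF s e] map_enumerate using len by simp
  qed
  have "Ten (P \<sigma> * A * P (inv \<sigma>)) = Ten (\<Sum>w\<in>W. sc (Ten A w) (P \<sigma> * Op w * P (inv \<sigma>)))"
    by (subst inL_expand[OF A]) (simp add: sum_distrib_left sum_distrib_right sc_simps)
  then have "Ten (P \<sigma> * A * P (inv \<sigma>)) - Ten A =
      (\<Sum>w\<in>W. smul (Ten A w) (Ten (P \<sigma> * Op w * P (inv \<sigma>)) - wd w))"
    by (simp only: Ten_sum Ten_sc vs.scale_right_diff_distrib sum_subtractf Ten_expand[symmetric])
  also have "\<dots> \<in> Kd" by (intro Kd_sum Kd_smul 1)
  finally show ?thesis .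
qed

text \<open>Each of the \<open>nperm\<close> (that is, d!) placements contributes one copy of
  \<open>wd w\<close>.\<close>

lemma Ten_Tm:
  assumes w: "w \<in> W"
  shows "Ten (Tm S0 w) - smul nperm (wd w) \<in> Kd"
proof -
  have len: "length w = d" using w by (simp add: W_def)
  have card: "card (dlists S0 d) = card {\<sigma>. \<sigma> permutes S0}"
    using bij_betw_same_card[OF dlists_permutes] by simp
  have const: "(\<Sum>i\<in>I. wd w) = smul (of_nat (card I)) (wd w)" for I :: "nat list set"
    by (rule ext) (simp add: fun_app sum_fun_app smul_def)
  have "Ten (Tm S0 w) - smul nperm (wd w) = (\<Sum>as\<in>dlists S0 d. Ten (opz (zip as w)) - wd w)"
    by (simp only: Tm_dlists[OF order.refl] len Ten_sum sum_subtractf const card nperm_def)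
  also have "\<dots> \<in> Kd"
  proof (rule Kd_sum)
    fix as assume as: "as \<in> dlists S0 d"
    have "Ten (opz (zip as w)) - wd (map snd (zip as w)) \<in> Kd"
      using as w len by (intro Ten_opz) (auto simp: dlists_def W_def zip_sub)
    then show "Ten (opz (zip as w)) - wd w \<in> Kd" using as len by (simp add: dlists_def)
  qed
  finally show ?thesis .
qed

section \<open>Central elements\<close>

text \<open>The derivation \<open>ad x\<close> on words, as a list of coefficients and words.\<close>
primrec adl :: "nat \<times> nat \<Rightarrow> word \<Rightarrow> (complex \<times> word) list" where
  "adl x [] = []"
| "adl x (y # ys) = (kron (snd x) (fst y), (fst x, snd y) # ys) #
     (- (ss x y * kron (snd y) (fst x)), (fst y, snd x) # ys) #
     map (\<lambda>(c, zs). (ss x y * c, y # zs)) (adl x ys)"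

definition sw :: "nat \<times> nat \<Rightarrow> word \<Rightarrow> complex" where
  "sw x w = (-1) ^ (gpar p x * wpar p w)"

lemma sw_simps [simp]: "sw x [] = 1" "sw x (y # w) = ss x y * sw x w"
proof -
  show "sw x [] = 1" by (simp add: sw_def wpar_def)
  show "sw x (y # w) = ss x y * sw x w"
    using gpar_cases[of x] by (auto simp: sw_def wpar_def ss_def minus_one_power_iff)
qed

lemma adl_length: "(c, zs) \<in> set (adl x w) \<Longrightarrow> x \<in> letters \<Longrightarrow> set w \<subseteq> letters \<Longrightarrow>
    length zs = length w \<and> set zs \<subseteq> letters"
  by (induction w arbitrary: c zs) (force simp: letters_def)+

lemma smul_sum_list: "smul a (sum_list (map f l)) = (\<Sum>z\<leftarrow>l. smul a (f z))"
  by (induction l) (auto simp: vs.scale_right_distrib)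

lemma tmul_sum_list: "tmul a (sum_list (map f l)) = (\<Sum>z\<leftarrow>l. tmul a (f z))"
  by (induction l) (auto simp: tmul_lin)

lemma adl_II:
  assumes x: "x \<in> letters"
  shows "set w \<subseteq> letters \<Longrightarrow>
    wd (x # w) - smul (sw x w) (wd (w @ [x])) - (\<Sum>(c, zs)\<leftarrow>adl x w. smul c (wd zs)) \<in> II"
proof (induction w)
  case Nil
  show ?case using II_zero by simp
next
  case (Cons y w)
  let ?S = "\<Sum>(c, zs)\<leftarrow>adl x w. smul c (wd zs)"
  have y: "y \<in> letters" and w: "set w \<subseteq> letters" using Cons.prems by auto
  have 1: "wd (x # y # w) - smul (ss x y) (wd (y # x # w)) - brk x y [] w \<in> II"
    using swap_II[OF x y, of "[]" w] w by simp
  have "tmul (wd [y]) (wd (x # w) - smul (sw x w) (wd (w @ [x])) - ?S) \<in> II"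
    using y Cons by (intro II_lmul ok_wd) auto
  then have 2: "smul (ss x y) (wd (y # x # w) - smul (sw x w) (wd (y # w @ [x])) -
      (\<Sum>(c, zs)\<leftarrow>adl x w. smul c (wd (y # zs)))) \<in> II"
    by (intro II_smul) (simp add: tmul_lin tmul_wd tmul_sum_list case_prod_unfold)
  have "wd (x # y # w) - smul (sw x (y # w)) (wd ((y # w) @ [x])) - (\<Sum>(c, zs)\<leftarrow>adl x (y # w). smul c (wd zs)) =
     (wd (x # y # w) - smul (ss x y) (wd (y # x # w)) - brk x y [] w) +
     smul (ss x y) (wd (y # x # w) - smul (sw x w) (wd (y # w @ [x])) -
      (\<Sum>(c, zs)\<leftarrow>adl x w. smul c (wd (y # zs))))"
    by (simp add: vs.scale_right_diff_distrib smul_sum_list case_prod_unfold comp_def brk_def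
        algebra_simps vs.scale_minus_left)
  then show ?case using II_add[OF 1 2] by (simp only:)
qed

lemma Delta_e:
  assumes a: "a \<in> S0" and x: "x \<in> letters" and y: "y \<in> letters"
  shows "Delta x * e a y = sc (ss x y) (e a y * Delta x) + sc (kron (snd x) (fst y)) (e a (fst x, snd y))
      - sc (ss x y * kron (snd y) (fst x)) (e a (fst y, snd x))"
proof -
  have *: "Delta z = e a z + (\<Sum>b\<in>S0-{a}. e b z)" for z
    unfolding Delta_def by (rule sum.remove) (use a in auto)
  have "(\<Sum>b\<in>S0-{a}. e b x) * e a y = sc (ss x y) (e a y * (\<Sum>b\<in>S0-{a}. e b x))"
    unfolding sum_distrib_left sum_distrib_right lop.scale_sum_right
    by (rule sum.cong[OF refl]) (use a x y in \<open>auto intro!: e_mult_diff\<close>)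
  then show ?thesis unfolding *
    by (simp add: algebra_simps e_mult_same a x y sc_simps lop.scale_right_distrib)
qed

text \<open>The list \<open>adl\<close> that expresses the adjoint action in the enveloping algebra
  also expresses the supercommutator with \<open>Delta x\<close>. This makes \<open>Ten\<close>
  equivariant.\<close>

lemma adl_Op:
  assumes x: "x \<in> letters"
  shows "set w \<subseteq> letters \<Longrightarrow> a + length w \<le> d \<Longrightarrow>
    Delta x * opz (enumerate a w) - sc (sw x w) (opz (enumerate a w) * Delta x) =
    (\<Sum>(c, zs)\<leftarrow>adl x w. sc c (opz (enumerate a zs)))"
proof (induction w arbitrary: a)
  case Nil
  have "Delta x * U = U * Delta x" using x by (simp add: Delta_def sum_distrib_left sum_distrib_right)
  then show ?case by simp
next
  case (Cons y w)
  have a: "a \<in> S0" and y: "y \<in> letters" using Cons.prems by (auto simp: S0_def)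
  let ?O = "opz (enumerate (Suc a) w)"
  have IH: "Delta x * ?O = sc (sw x w) (?O * Delta x) + (\<Sum>(c, zs)\<leftarrow>adl x w. sc c (opz (enumerate (Suc a) zs)))"
    using Cons.IH[of "Suc a"] Cons.prems by (simp add: algebra_simps)
  have "Delta x * (e a y * ?O) = sc (ss x y) (e a y * (Delta x * ?O)) + sc (kron (snd x) (fst y)) (e a (fst x, snd y) * ?O)
      - sc (ss x y * kron (snd y) (fst x)) (e a (fst y, snd x) * ?O)"
    unfolding mult.assoc[symmetric] Delta_e[OF a x y] by (simp add: algebra_simps sc_simps)
  moreover have sc_sum_list: "sc c (sum_list (map f l)) = (\<Sum>z\<leftarrow>l. sc c (f z))"
    for c and f :: "complex \<times> word \<Rightarrow> (nat \<Rightarrow> nat) lop" and l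
    by (induction l) (auto simp: lop.scale_right_distrib)
  ultimately show ?case unfolding enumerate_simps opz_simps
    by (simp add: IH sc_sum_list distrib_left sc_simps lop.scale_right_distrib case_prod_unfold comp_def
        mult.assoc sum_list_const_mult[symmetric] lop.scale_minus_left)
qed

lemma Par_Op:
  assumes "set zs \<subseteq> S0 \<times> letters"
  shows "Par * opz zs * Par = sc ((-1) ^ wpar p (map snd zs)) (opz zs)"
proof -
  have "Par * opz zs = sc ((-1) ^ wpar p (map snd zs)) (opz zs * Par)"
    using assms
  proof (induction zs)
    case (Cons z zs)
    obtain a x where z: "z = (a, x)" by (cases z)
    have *: "wpar p (x # w) = (gpar p x + wpar p w) mod 2" for w by (simp add: wpar_def mod_simps)
    have **: "(-1::complex) ^ (n mod 2) = (-1) ^ n" for n :: nat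
      by (simp add: minus_one_power_iff)
    have "Par * (e a x * opz zs) = sc ((-1) ^ gpar p x) (e a x * (Par * opz zs))"
      using Cons.prems Par_e[of a x] by (simp add: z sc_simps flip: mult.assoc)
    then show ?case using Cons by (simp add: z * ** power_add sc_simps mult.assoc)
  qed (simp add: wpar_def)
  moreover have "opz zs * (Par * Par) = opz zs" using inL_opz[OF assms] by (simp add: inL_def)
  ultimately show ?thesis by (simp add: sc_simps mult.assoc)
qed

lemma sflip_smul: "sflip p (smul c a) = smul c (sflip p a)" "sflip p (a + b) = sflip p a + sflip p b"
  by (auto simp: sflip_def smul_def fun_eq_iff fun_app algebra_simps)

lemma sflip_wd: "sflip p (wd w) = smul ((-1) ^ wpar p w) (wd w)"
  by (auto simp: sflip_def smul_def wd_def fun_eq_iff fun_app)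

lemma sad_add: "sad p i j (a + b) = sad p i j a + sad p i j b"
  and sad_smul: "sad p i j (smul c a) = smul c (sad p i j a)"
  by (auto simp: sad_def tens_ops tmul_lin sflip_smul vs.scale_right_diff_distrib)

lemma sad_zero: "sad p i j 0 = 0"
  using sad_smul[of i j 0 0] by simp

lemma sad_sum: "sad p i j (sum f S) = (\<Sum>s\<in>S. sad p i j (f s))"
  by (induction S rule: infinite_finite_induct) (auto simp: sad_add sad_zero)

lemma sad_wd: "sad p i j (wd w) = wd ((i, j) # w) - smul (sw (i, j) w) (wd (w @ [(i, j)]))"
  using gpar_cases[of "(i, j)"]
  by (auto simp: sad_def tens_ops gen_wd sflip_wd tmul_lin tmul_wd sw_def)

text \<open>Equivariance turns commutation with all \<open>Delta x\<close> into vanishing of the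
  adjoint action modulo the relations; evenness of \<open>A\<close> reconciles commutators with
  supercommutators.\<close>

lemma central_Ten:
  assumes A: "inL A" and comm: "\<And>x. x \<in> letters \<Longrightarrow> Delta x * A = A * Delta x" and Par: "Par * A = A * Par"
  shows "central p q (Ten A)"
  unfolding central_def
proof (intro conjI allI impI ok_Ten)
  fix i j assume "valid_idx p q i \<and> valid_idx p q j"
  then have x: "(i, j) \<in> letters" by (simp add: letters_def idx_def valid_idx_def)
  let ?x = "(i, j)" and ?a = "Ten A"
  have WE: "set w \<subseteq> letters" "0 + length w \<le> d" "set (enumerate 0 w) \<subseteq> S0 \<times> letters" if "w \<in> W" for w
    using that enumerate_S0[of 0 w] by (auto simp: W_def)
  \<comment> \<open>For odd \<open>x\<close> the sign \<open>sw\<close> is the parity of the word,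
    and weighting the words by it amounts to conjugating \<open>A\<close> by \<open>Par\<close>,
    which fixes \<open>A\<close>.\<close>
  have twist: "(\<Sum>w\<in>W. sc (?a w * sw ?x w) (Op w)) = A"
  proof (cases "gpar p ?x = 0")
    case True
    then show ?thesis using inL_expand[OF A] by (simp add: sw_def)
  next
    case False
    then have "gpar p ?x = 1" using gpar_cases[of ?x] by simp
    then have "(\<Sum>w\<in>W. sc (?a w * sw ?x w) (Op w)) = (\<Sum>w\<in>W. sc (?a w) (Par * Op w * Par))"
      by (intro sum.cong refl) (simp add: sw_def Op_def Par_Op WE)
    also have "\<dots> = Par * (\<Sum>w\<in>W. sc (?a w) (Op w)) * Par"
      by (simp add: sum_distrib_left sum_distrib_right sc_simps)
    also have "\<dots> = Par * A * Par"
      by (simp only: inL_expand[OF A, symmetric])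
    also have "\<dots> = A * (Par * Par)" unfolding Par by (simp add: mult.assoc)
    also have "\<dots> = A" using A by (simp add: inL_def)
    finally show ?thesis .
  qed
  define ad where "ad w = (\<Sum>(c, zs)\<leftarrow>adl ?x w. smul c (wd zs))" for w
  have ad: "ad w = Ten (Delta ?x * Op w - sc (sw ?x w) (Op w * Delta ?x))" if w: "w \<in> W" for w
  proof -
    have "Ten (sum_list (map f l)) = (\<Sum>z\<leftarrow>l. Ten (f z))" for f and l :: "(complex \<times> word) list"
      by (induction l) (auto simp: Ten_zero Ten_add)
    then have "Ten (Delta ?x * Op w - sc (sw ?x w) (Op w * Delta ?x)) = (\<Sum>(c, zs)\<leftarrow>adl ?x w. smul c (Ten (Op zs)))"
      unfolding Op_def by (subst adl_Op[OF x]) (use WE[OF w] in \<open>auto simp: case_prod_unfold Ten_sc\<close>)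
    also have "\<dots> = ad w"
      unfolding ad_def
    proof (intro arg_cong[where f = sum_list] map_cong refl, clarify)
      fix c zs assume "(c, zs) \<in> set (adl ?x w)"
      from adl_length[OF this x] w have "zs \<in> W" by (auto simp: W_def)
      then show "smul c (Ten (Op zs)) = smul c (wd zs)" by (simp add: Ten_Op)
    qed
    finally show ?thesis ..
  qed
  have "(\<Sum>w\<in>W. smul (?a w) (ad w)) =
      Ten (\<Sum>w\<in>W. sc (?a w) (Delta ?x * Op w - sc (sw ?x w) (Op w * Delta ?x)))"
    by (simp add: Ten_sum Ten_sc ad)
  also have "(\<Sum>w\<in>W. sc (?a w) (Delta ?x * Op w - sc (sw ?x w) (Op w * Delta ?x))) =
      Delta ?x * (\<Sum>w\<in>W. sc (?a w) (Op w)) - (\<Sum>w\<in>W. sc (?a w * sw ?x w) (Op w)) * Delta ?x"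
    by (simp add: lop.scale_right_diff_distrib sum_subtractf sum_distrib_left sum_distrib_right sc_simps)
  also have "\<dots> = 0" unfolding twist inL_expand[OF A, symmetric] by (simp add: comm[OF x])
  finally have ad0: "(\<Sum>w\<in>W. smul (?a w) (ad w)) = 0" by (simp add: Ten_zero)
  have "sad p i j ?a = (\<Sum>w\<in>W. smul (?a w) (sad p i j (wd w)))"
    by (subst Ten_expand) (simp only: sad_sum sad_smul)
  also have "\<dots> = (\<Sum>w\<in>W. smul (?a w) (sad p i j (wd w) - ad w))"
    by (simp add: vs.scale_right_diff_distrib sum_subtractf ad0)
  also have "\<dots> \<in> II"
    using adl_II[OF x] WE
    by (intro vs.subspace_sum[OF subspace_II] II_smul) (simp add: sad_wd ad_def)
  finally show "sad p i j ?a \<in> II" .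
qed

text \<open>For the cycle sending a to a+1 mod d this is a signed sum of the products
  \<open>E(I0,I1) E(I1,I2) ... E(I(d-1),I0)\<close>, the classical Gelfand invariant.\<close>

lemma central_P: "\<sigma> permutes S0 \<Longrightarrow> central p q (Ten (P \<sigma>))"
  by (rule central_Ten) (auto simp: inL_def P_Delta P_Par)

section \<open>The action of the enveloping algebra by supercommutators\<close>

text \<open>Conjugation by \<open>Par\<close> produces the sign of the supercommutator without
  \<open>A\<close> having to be homogeneous.\<close>

definition fl :: "nat \<times> nat \<Rightarrow> (nat \<Rightarrow> nat) lop \<Rightarrow> (nat \<Rightarrow> nat) lop" where
  "fl x A = (if gpar p x = 1 then Par * A * Par else A)"

definition ad :: "nat \<times> nat \<Rightarrow> (nat \<Rightarrow> nat) lop \<Rightarrow> (nat \<Rightarrow> nat) lop" where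
  "ad x A = Delta x * A - fl x A * Delta x"

definition act :: "word \<Rightarrow> (nat \<Rightarrow> nat) lop \<Rightarrow> (nat \<Rightarrow> nat) lop" where
  "act w A = foldr ad w A"

definition actl :: "tens \<Rightarrow> (nat \<Rightarrow> nat) lop \<Rightarrow> (nat \<Rightarrow> nat) lop" where
  "actl a A = (\<Sum>w | a w \<noteq> 0. sc (a w) (act w A))"

lemma act_simps [simp]: "act [] A = A" "act (x # w) A = ad x (act w A)"
  by (auto simp: act_def)

lemma act_append: "act (u @ v) A = act u (act v A)"
  by (simp add: act_def)

lemma fl_lin: "fl x (A + B) = fl x A + fl x B" "fl x (sc c A) = sc c (fl x A)" "fl x (A - B) = fl x A - fl x B" "fl x 0 = 0"
  by (auto simp: fl_def algebra_simps sc_simps)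

lemma ad_lin: "ad x (A + B) = ad x A + ad x B" "ad x (sc c A) = sc c (ad x A)" "ad x 0 = 0"
  by (auto simp: ad_def fl_lin algebra_simps sc_simps lop.scale_right_diff_distrib)

lemma act_lin: "act w (A + B) = act w A + act w B" "act w (sc c A) = sc c (act w A)" "act w 0 = 0"
  by (induction w) (auto simp: ad_lin)

lemma actl_superset:
  "finite S \<Longrightarrow> {w. a w \<noteq> 0} \<subseteq> S \<Longrightarrow> actl a A = (\<Sum>w\<in>S. sc (a w) (act w A))"
  unfolding actl_def by (rule sum.mono_neutral_left) auto

lemma actl_add:
  assumes "tens_ok p q a" "tens_ok p q b"
  shows "actl (a + b) A = actl a A + actl b A"
proof -
  let ?S = "{w. a w \<noteq> 0} \<union> {w. b w \<noteq> 0}"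
  have fin: "finite ?S" using assms by (simp add: tens_ok_iff)
  show ?thesis
    by (subst (1 2 3) actl_superset[OF fin])
      (auto simp: fun_app sum.distrib lop.scale_left_distrib)
qed

lemma actl_smul: "tens_ok p q a \<Longrightarrow> actl (smul c a) A = sc c (actl a A)"
  by (subst (1 2) actl_superset[of "{w. a w \<noteq> 0}"])
    (auto simp: tens_ok_iff smul_def lop.scale_sum_right)

lemma actl_wd: "actl (wd w) A = act w A"
  by (subst actl_superset[of "{w}"]) (auto simp: wd_def)

lemma actl_zero: "actl 0 A = 0"
  by (simp add: actl_def fun_app)

lemma actl_diff: "tens_ok p q a \<Longrightarrow> tens_ok p q b \<Longrightarrow> actl (a - b) A = actl a A - actl b A"
  using actl_add[of a "smul (-1) b" A] ok_smul[of b "-1"] actl_smul[of b "-1" A]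
  by (simp add: vs.scale_minus_left lop.scale_minus_left)

lemma actl_arg: "actl a (A + B) = actl a A + actl a B" "actl a (sc c A) = sc c (actl a A)" "actl a 0 = 0"
  by (auto simp: actl_def act_lin lop.scale_right_distrib sum.distrib lop.scale_sum_right mult.commute)

lemma actl_tmul:
  assumes "tens_ok p q a" "tens_ok p q b"
  shows "actl (tmul a b) A = actl a (actl b A)"
  using assms(1)
proof (induction a rule: tens_ok_induct)
  case zero
  show ?case by (simp add: actl_zero)
next
  case (step a c u)
  have "actl (tmul (wd u) b) A = act u (actl b A)"
    using assms(2)
  proof (induction b rule: tens_ok_induct)
    case zero
    show ?case by (simp add: actl_zero act_lin)
  next
    case (step b k v)
    have "tens_ok p q (tmul (wd u) b)" "tens_ok p q (tmul (wd u) (wd v))" "tens_ok p q (wd v)"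
      using step.hyps \<open>set u \<subseteq> letters\<close> by (auto intro!: ok_tmul ok_wd)
    then show ?case using step
      by (simp add: tmul_lin actl_add actl_smul ok_smul actl_wd tmul_wd act_append act_lin)
  qed
  moreover have "tens_ok p q (tmul a b)" "tens_ok p q (tmul (wd u) b)" "tens_ok p q (wd u)"
    using step.hyps assms by (auto intro!: ok_tmul ok_wd)
  ultimately show ?case using step
    by (simp add: tmul_lin actl_add actl_smul ok_smul actl_wd)
qed

lemma U_Delta [simp]: "U * Delta x = Delta x" "x \<in> letters \<Longrightarrow> Delta x * U = Delta x"
  by (auto simp: Delta_def sum_distrib_left sum_distrib_right)

lemma Par_Delta: "x \<in> letters \<Longrightarrow> Par * Delta x = sc ((-1) ^ gpar p x) (Delta x * Par)"
  by (simp add: Delta_def sum_distrib_left sum_distrib_right Par_e lop.scale_sum_right)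

lemma inL_Delta: "x \<in> letters \<Longrightarrow> inL (Delta x)" by (simp add: inL_def)

lemma inL_Par: "inL Par" by (simp add: inL_def)

lemma inL_fl: "inL A \<Longrightarrow> inL (fl x A)"
  by (auto simp: fl_def intro!: inL_mult inL_Par)

lemma inL_diff: "inL A \<Longrightarrow> inL B \<Longrightarrow> inL (A - B)"
  by (simp add: inL_def algebra_simps)

lemma inL_zero: "inL 0" by (simp add: inL_def)

lemma inL_ad: "inL A \<Longrightarrow> x \<in> letters \<Longrightarrow> inL (ad x A)"
  unfolding ad_def by (intro inL_diff inL_mult inL_Delta inL_fl)

lemma inL_act: "inL A \<Longrightarrow> set w \<subseteq> letters \<Longrightarrow> inL (act w A)"
  by (induction w) (auto intro: inL_ad)

lemma inL_actl: "inL A \<Longrightarrow> tens_ok p q a \<Longrightarrow> inL (actl a A)"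
  unfolding actl_def by (intro inL_sum inL_sc inL_act) (auto simp: tens_ok_iff)

lemma fl_mult:
  assumes "inL A" shows "fl x (A * B) = fl x A * fl x B"
proof -
  have "Par * A * Par * (Par * B * Par) = Par * (A * (Par * Par)) * B * Par" by (simp only: mult.assoc)
  also have "\<dots> = Par * (A * B) * Par" using assms by (simp add: inL_def mult.assoc)
  finally show ?thesis by (simp add: fl_def)
qed

lemma fl_Delta:
  assumes "y \<in> letters" shows "fl x (Delta y) = sc (ss x y) (Delta y)"
proof -
  have "Par * Delta y * Par = sc ((-1) ^ gpar p y) (Delta y * (Par * Par))"
    by (simp add: Par_Delta[OF assms] sc_simps mult.assoc)
  then have "Par * Delta y * Par = sc ((-1) ^ gpar p y) (Delta y)" using assms by simp
  then show ?thesis using gpar_cases[of x] by (auto simp: fl_def ss_def)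
qed

lemma Delta_Delta:
  assumes x: "x \<in> letters" and y: "y \<in> letters"
  shows "Delta x * Delta y = sc (ss x y) (Delta y * Delta x) + sc (kron (snd x) (fst y)) (Delta (fst x, snd y))
      - sc (ss x y * kron (snd y) (fst x)) (Delta (fst y, snd x))"
proof -
  have "Delta x * Delta y = (\<Sum>a\<in>S0. Delta x * e a y)" by (simp add: Delta_def[of y] sum_distrib_left)
  also have "\<dots> = (\<Sum>a\<in>S0. sc (ss x y) (e a y * Delta x) + sc (kron (snd x) (fst y)) (e a (fst x, snd y))
      - sc (ss x y * kron (snd y) (fst x)) (e a (fst y, snd x)))"
    by (rule sum.cong[OF refl]) (rule Delta_e[OF _ x y])
  finally show ?thesis
    by (simp add: sum.distrib sum_subtractf Delta_def sum_distrib_right flip: lop.scale_sum_right)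
qed

lemma fl_fl:
  assumes "inL A"
  shows "snd x = fst y \<Longrightarrow> fl x (fl y A) = fl (fst x, snd y) A"
    "fst x = snd y \<Longrightarrow> fl x (fl y A) = fl (fst y, snd x) A" "fl x (fl y A) = fl y (fl x A)"
proof -
  have "Par * (Par * A * Par) * Par = (Par * Par) * A * (Par * Par)" by (simp only: mult.assoc)
  then have *: "Par * (Par * A * Par) * Par = A" using assms by (simp add: inL_def)
  show "snd x = fst y \<Longrightarrow> fl x (fl y A) = fl (fst x, snd y) A"
    "fst x = snd y \<Longrightarrow> fl x (fl y A) = fl (fst y, snd x) A" "fl x (fl y A) = fl y (fl x A)"
    by (auto simp: fl_def * gpar_def ipar_def)
qed

text \<open>The terms with one factor on each side of \<open>A\<close> cancel. What remains is the
  supercommutator of \<open>Delta x\<close> and \<open>Delta y\<close> to the left and to the right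
  of \<open>A\<close>.\<close>

lemma ad_relation:
  assumes x: "x \<in> letters" and y: "y \<in> letters" and A: "inL A"
  shows "ad x (ad y A) = sc (ss x y) (ad y (ad x A)) + sc (kron (snd x) (fst y)) (ad (fst x, snd y) A)
    - sc (ss x y * kron (snd y) (fst x)) (ad (fst y, snd x) A)"
proof -
  let ?B = "fl x (fl y A)" and ?X = "Delta x" and ?Y = "Delta y"
  note iA = inL_fl[OF A]
  have 1: "ad x (ad y A) = ?X * ?Y * A - ?X * fl y A * ?Y - sc (ss x y) (?Y * fl x A * ?X) + sc (ss x y) (?B * ?Y * ?X)"
    by (simp add: ad_def fl_lin fl_mult inL_Delta[OF y] iA fl_Delta[OF y] algebra_simps sc_simps)
  have 2: "ad y (ad x A) = ?Y * ?X * A - ?Y * fl x A * ?X - sc (ss x y) (?X * fl y A * ?Y) + sc (ss x y) (?B * ?X * ?Y)"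
    by (simp add: ad_def fl_lin fl_mult inL_Delta[OF x] iA fl_Delta[OF x] algebra_simps sc_simps
        ss_commute[of y x] fl_fl(3)[OF A, of y x])
  let ?C = "sc (kron (snd x) (fst y)) (Delta (fst x, snd y)) - sc (ss x y * kron (snd y) (fst x)) (Delta (fst y, snd x))"
  have C: "?X * ?Y = sc (ss x y) (?Y * ?X) + ?C" unfolding Delta_Delta[OF x y] by simp
  have "ad x (ad y A) - sc (ss x y) (ad y (ad x A)) =
      (?X * ?Y - sc (ss x y) (?Y * ?X)) * A - ?B * (?X * ?Y - sc (ss x y) (?Y * ?X))"
    unfolding 1 2 by (simp add: algebra_simps sc_simps lop.scale_right_diff_distrib lop.scale_right_distrib)
  also have "\<dots> = ?C * A - ?B * ?C" unfolding C by simp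
  also have "\<dots> = sc (kron (snd x) (fst y)) (ad (fst x, snd y) A) - sc (ss x y * kron (snd y) (fst x)) (ad (fst y, snd x) A)"
    using fl_fl(1)[OF A, of x y] fl_fl(2)[OF A, of x y]
    by (auto simp: ad_def kron_def algebra_simps sc_simps lop.scale_right_diff_distrib)
  finally show ?thesis by (simp add: algebra_simps)
qed

text \<open>The conclusion includes \<open>tens_ok\<close> because \<open>actl\<close> is additive
  only on finitely supported arguments. The operators are restricted by \<open>inL\<close> because
  only there does flipping twice give back \<open>A\<close>.\<close>

lemma II_act:
  assumes "a \<in> II" shows "tens_ok p q a \<and> (\<forall>A. inL A \<longrightarrow> actl a A = 0)"
  using assms unfolding Irel_def
proof (induction rule: tideal.induct)
  case zero
  show ?case by (simp add: tens_ops ok_zero actl_zero)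
next
  case (base r)
  then obtain x y where x: "x \<in> letters" and y: "y \<in> letters" and
    r: "r = urel p (fst x) (snd x) (fst y) (snd y)"
    by (fastforce simp: urels_def letters_def idx_def valid_idx_def)
  have r: "r = wd [x, y] - smul (ss x y) (wd [y, x]) -
     (smul (kron (snd x) (fst y)) (wd [(fst x, snd y)]) - smul (ss x y * kron (snd y) (fst x)) (wd [(fst y, snd x)]))"
    by (simp add: r urel_def sbracket_def tens_ops gen_wd tmul_lin tmul_wd ss_def)
  have ok: "tens_ok p q (wd [x, y])" "tens_ok p q (wd [y, x])" "tens_ok p q (wd [(fst x, snd y)])"
      "tens_ok p q (wd [(fst y, snd x)])"
    using x y by (auto intro!: ok_wd simp: letters_def)
  show ?case unfolding r
    using ad_relation[OF x y] ok by (simp add: ok_diff ok_smul actl_diff actl_smul actl_wd)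
next
  case (lmul a x)
  then show ?case by (simp add: ok_tmul actl_tmul actl_arg)
next
  case (rmul a x)
  then show ?case by (simp add: ok_tmul actl_tmul inL_actl)
qed (simp_all add: tens_ops ok_add ok_smul actl_add actl_smul)

section \<open>The invariant vector and the leading term of the action\<close>

text \<open>The product of the \<open>D a\<close> over \<open>S\<close>; for \<open>S0\<close> this
  is the d-fold tensor power of J up to the factor 2 at each site.\<close>

definition DS :: "nat set \<Rightarrow> (nat \<Rightarrow> nat) lop" where
  "DS S = wcomp id (\<lambda>I. if I \<in> L then (\<Prod>a\<in>S. cs (I a)) else 0)"

lemma DS_empty [simp]: "DS {} = U"
  by (simp add: DS_def U_def cong: if_cong)

lemma DS_remove: "S \<subseteq> S0 \<Longrightarrow> a \<in> S \<Longrightarrow> DS S = D a * DS (S - {a})"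
  unfolding DS_def D_def wcomp_mult using finite_sub_S0[of S]
  by (intro wcomp_eqI) (auto simp: prod.remove)

lemma DS_D: "D a * DS S = DS S * D a" and DS_Par: "Par * DS S = DS S * Par"
  and inL_DS: "inL (DS S)"
  unfolding DS_def D_def Par_def U_def inL_def wcomp_mult by (auto intro!: wcomp_eqI)

lemma DS_e: "a \<in> S0 \<Longrightarrow> a \<notin> S \<Longrightarrow> x \<in> letters \<Longrightarrow> DS S * e a x = e a x * DS S"
  unfolding DS_def e_def wcomp_mult
  by (intro wcomp_eqI) (auto simp: upd_L lettersD intro!: prod.cong)

lemma DS_e_k:
  assumes "a \<in> S0" "x \<in> kletters" shows "DS S * e a x = e a x * DS S"
proof -
  have "(\<Prod>b\<in>S. cs ((I(a := snd x)) b)) = (\<Prod>b\<in>S. cs (I b))" if "I a = fst x" for I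
    by (rule prod.cong) (use assms that in \<open>auto simp: cs_def kletters_def\<close>)
  then show ?thesis unfolding DS_def e_def wcomp_mult
    using assms kletters_letters by (intro wcomp_eqI) (auto simp: upd_L lettersD)
qed

lemma DS_Delta: "x \<in> kletters \<Longrightarrow> DS S * Delta x = Delta x * DS S"
  by (simp add: Delta_def sum_distrib_left sum_distrib_right DS_e_k)

lemma fl_DS: "fl x (DS S) = DS S"
proof -
  have "Par * DS S * Par = DS S * (Par * Par)" by (simp add: DS_Par mult.assoc)
  then show ?thesis using inL_DS[of S] by (simp add: fl_def inL_def)
qed

text \<open>Letters of k commute with J at every site and J is even, so they kill
  \<open>DS S0\<close>; the left ideal they generate does the same.\<close>

lemma KK_act:
  assumes "a \<in> KK" shows "tens_ok p q a \<and> actl a (DS S0) = 0"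
  using assms
proof (induction rule: Uk_pre.induct)
  case (rel a)
  then show ?case using II_act inL_DS by blast
next
  case (kgen a i j)
  then have x: "(i, j) \<in> kletters" by (simp add: kidx_kletters)
  then have ok: "tens_ok p q (wd [(i, j)])" by (auto intro!: ok_wd simp: kletters_letters)
  have "ad (i, j) (DS S0) = 0" by (simp add: ad_def fl_DS DS_Delta x)
  then show ?case using kgen ok by (simp add: gen_wd ok_tmul actl_tmul actl_wd actl_arg)
next
  case (add a b)
  then show ?case by (simp add: tens_ops ok_add actl_add)
qed

text \<open>Filtration by the number of sites at which an operator preserves the colour.\<close>
definition Fil :: "nat set \<Rightarrow> nat \<Rightarrow> (nat \<Rightarrow> nat) lop set" where
  "Fil S n = lop.span {A. inL A \<and> (\<exists>R \<subseteq> S. n \<le> card R \<and> (\<forall>b\<in>R \<union> (S0 - S). D b * A = A * D b))}"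

lemma subspace_Fil: "lop.subspace (Fil S n)"
  by (simp add: Fil_def lop.subspace_span)

lemmas Fil_add = lop.subspace_add[OF subspace_Fil] and Fil_sc = lop.subspace_scale[OF subspace_Fil]
  and Fil_sum = lop.subspace_sum[OF subspace_Fil] and Fil_zero = lop.subspace_0[OF subspace_Fil]

lemma Fil_base: "inL A \<Longrightarrow> R \<subseteq> S \<Longrightarrow> n \<le> card R \<Longrightarrow>
    (\<And>b. b \<in> R \<union> (S0 - S) \<Longrightarrow> D b * A = A * D b) \<Longrightarrow> A \<in> Fil S n"
  unfolding Fil_def by (rule lop.span_base) blast

lemma Fil_induct [consumes 1, case_names base add sc zero]:
  assumes "A \<in> Fil S n"
    "\<And>A R. inL A \<Longrightarrow> R \<subseteq> S \<Longrightarrow> n \<le> card R \<Longrightarrow>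
      (\<And>b. b \<in> R \<union> (S0 - S) \<Longrightarrow> D b * A = A * D b) \<Longrightarrow> T A"
    "\<And>A B. T A \<Longrightarrow> T B \<Longrightarrow> T (A + B)" "\<And>c A. T A \<Longrightarrow> T (sc c A)" "T 0"
  shows "T A"
  using assms(1) unfolding Fil_def
proof (induction rule: lop.span_induct_alt)
  case (step c x y)
  then have "T x" using assms(2) by blast
  then show ?case using step assms(3,4) by blast
qed (rule assms(5))

lemma mult_commute_trans: "z * A = A * z \<Longrightarrow> z * B = B * z \<Longrightarrow> z * (A * B) = A * B * (z :: 'a :: semigroup_mult)"
  by (metis mult.assoc)

lemma Fil_mono:
  assumes "S \<subseteq> S'" "m \<le> n" "A \<in> Fil S n"
  shows "A \<in> Fil S' m"
  using assms(3)
proof (induction rule: Fil_induct)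
  case (base A R)
  then show ?case using assms(1,2) by (intro Fil_base[of _ R]) auto
qed (auto intro: Fil_add Fil_sc Fil_zero)

lemma inL_e: "a \<in> S0 \<Longrightarrow> x \<in> letters \<Longrightarrow> inL (e a x)" by (simp add: inL_def)

lemma Fil_e:
  assumes "A \<in> Fil (S - {a}) n" "S \<subseteq> S0" "a \<in> S" "x \<in> letters"
  shows "e a x * A \<in> Fil S n"
  using assms(1)
proof (induction rule: Fil_induct)
  case (base A R)
  have a: "a \<in> S0" using assms by auto
  show ?case
  proof (rule Fil_base[of _ R])
    fix b assume "b \<in> R \<union> (S0 - S)"
    then have "b \<in> R \<union> (S0 - (S - {a}))" "a \<noteq> b" using base(2) assms(3) by auto
    then show "D b * (e a x * A) = e a x * A * D b"
      using base(4) D_e_diff[of a b x] a assms(4) by (intro mult_commute_trans) auto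
  qed (use base a assms in \<open>auto intro!: inL_mult inL_e\<close>)
qed (auto simp: distrib_left sc_simps intro: Fil_add Fil_sc Fil_zero)

text \<open>A factor that preserves the colour everywhere lets the site \<open>a\<close>, left free
  by \<open>A\<close>, count as a further preserved site.\<close>

lemma Fil_Suc:
  assumes "A \<in> Fil (S - {a}) n" "S \<subseteq> S0" "a \<in> S" "inL C" "\<And>b. D b * C = C * D b"
  shows "C * A \<in> Fil S (Suc n)"
  using assms(1)
proof (induction rule: Fil_induct)
  case (base A R)
  show ?case
  proof (rule Fil_base[of _ "insert a R"])
    have "finite R" "a \<notin> R" using base(2) finite_sub_S0[OF assms(2)] by (auto intro: finite_subset)
    then show "Suc n \<le> card (insert a R)" using base(3) by simp
    fix b assume "b \<in> insert a R \<union> (S0 - S)"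
    then have "b \<in> R \<union> (S0 - (S - {a}))" using assms(2,3) by auto
    then show "D b * (C * A) = C * A * D b"
      using base(4) assms(5) by (intro mult_commute_trans) auto
  qed (use base assms in \<open>auto intro!: inL_mult\<close>)
qed (auto simp: distrib_left sc_simps intro: Fil_add Fil_sc Fil_zero)

lemma fl_D: "D b * A = A * D b \<Longrightarrow> D b * fl x A = fl x A * D b"
  unfolding fl_def using Par_D[of b] by (auto intro!: mult_commute_trans)

lemma ad_sum: "ad x A = (\<Sum>a\<in>S0. e a x * A - fl x A * e a x)"
  by (simp add: ad_def Delta_def sum_distrib_left sum_distrib_right sum_subtractf)

lemma diff_commute: "z * A = A * z \<Longrightarrow> z * B = B * z \<Longrightarrow> z * (A - B) = (A - B) * (z :: 'a :: ring)"
  by (simp add: algebra_simps)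

text \<open>The summand of \<open>ad x\<close> at site \<open>a\<close> disturbs the colour at
  \<open>a\<close> only, so at most one preserved site is lost.\<close>

lemma ad_Fil:
  assumes "A \<in> Fil S0 (Suc n)" "x \<in> letters"
  shows "ad x A \<in> Fil S0 n"
  using assms(1)
proof (induction rule: Fil_induct)
  case (base A R)
  have "e a x * A - fl x A * e a x \<in> Fil S0 n" if a: "a \<in> S0" for a
  proof (rule Fil_base[of _ "R - {a}"])
    show "n \<le> card (R - {a})" using base(3) by (cases "a \<in> R") auto
    show "D b * (e a x * A - fl x A * e a x) = (e a x * A - fl x A * e a x) * D b" if "b \<in> R - {a} \<union> (S0 - S0)" for b
      using that base a assms(2) D_e_diff[of a b x]
      by (intro diff_commute mult_commute_trans fl_D) auto
  qed (use base a assms(2) in \<open>auto intro!: inL_diff inL_mult inL_e inL_fl\<close>)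
  then show ?case unfolding ad_sum by (rule Fil_sum)
qed (auto simp: ad_lin intro: Fil_add Fil_sc Fil_zero)

lemma ad_Fil_k:
  assumes "A \<in> Fil S0 n" "x \<in> kletters"
  shows "ad x A \<in> Fil S0 n"
  using assms(1)
proof (induction rule: Fil_induct)
  case (base A R)
  have "e a x * A - fl x A * e a x \<in> Fil S0 n" if a: "a \<in> S0" for a
  proof (rule Fil_base[of _ R])
    show "D b * (e a x * A - fl x A * e a x) = (e a x * A - fl x A * e a x) * D b" if "b \<in> R \<union> (S0 - S0)" for b
      using that base a assms(2) D_e_k[of a x b]
      by (intro diff_commute mult_commute_trans fl_D) auto
  qed (use base a kletters_letters[OF assms(2)] in \<open>auto intro!: inL_diff inL_mult inL_e inL_fl\<close>)
  then show ?case unfolding ad_sum by (rule Fil_sum)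
qed (auto simp: ad_lin intro: Fil_add Fil_sc Fil_zero)

lemma DS_Fil: "n \<le> card S \<Longrightarrow> DS S \<in> Fil S n"
  by (rule Fil_base[of _ S]) (auto simp: DS_D inL_DS)

lemma act_Fil:
  "set w \<subseteq> letters \<Longrightarrow> n + length (filter (\<lambda>x. x \<notin> kletters) w) \<le> d \<Longrightarrow> act w (DS S0) \<in> Fil S0 n"
proof (induction w arbitrary: n)
  case Nil
  then show ?case by (simp add: DS_Fil S0_def)
next
  case (Cons x w)
  then show ?case
    using ad_Fil[of "act w (DS S0)" n x] ad_Fil_k[of "act w (DS S0)" n x] by (cases "x \<in> kletters") auto
qed

lemma inL_Tg: "(\<And>S. S \<subseteq> S0 \<Longrightarrow> inL (Z S)) \<Longrightarrow> S \<subseteq> S0 \<Longrightarrow> set xs \<subseteq> letters \<Longrightarrow> inL (Tg Z S xs)"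
proof (induction xs arbitrary: S)
  case (Cons x xs)
  have "inL (Tg Z (S - {a}) xs)" for a by (rule Cons.IH) (use Cons.prems in auto)
  then show ?case using Cons.prems by (auto intro!: inL_sum inL_mult inL_e)
qed auto

lemma Tg_Fil:
  "S \<subseteq> S0 \<Longrightarrow> set xs \<subseteq> letters \<Longrightarrow> n + length xs \<le> card S \<or> n = 0 \<Longrightarrow>
    Tg DS S xs \<in> Fil S n"
proof (induction xs arbitrary: S)
  case Nil
  then show ?case by (auto simp: DS_Fil)
next
  case (Cons x xs)
  have "e a x * Tg DS (S - {a}) xs \<in> Fil S n" if a: "a \<in> S" for a
  proof -
    have "Tg DS (S - {a}) xs \<in> Fil (S - {a}) n"
      by (rule Cons.IH) (use Cons.prems a finite_sub_S0[OF Cons.prems(1)] in auto)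
    then show ?thesis using Cons.prems a by (intro Fil_e) auto
  qed
  then show ?case by (simp add: Fil_sum)
qed

lemma Tg_e:
  "S \<subseteq> S0 \<Longrightarrow> set xs \<subseteq> letters \<Longrightarrow> a \<in> S0 - S \<Longrightarrow> x \<in> letters \<Longrightarrow>
    Tg DS S xs * e a x = sc (sw x xs) (e a x * Tg DS S xs)"
proof (induction xs arbitrary: S)
  case Nil
  then show ?case by (simp add: DS_e)
next
  case (Cons y ys)
  have "e b y * Tg DS (S - {b}) ys * e a x = sc (sw x (y # ys)) (e a x * (e b y * Tg DS (S - {b}) ys))"
    if b: "b \<in> S" for b
  proof -
    have "Tg DS (S - {b}) ys * e a x = sc (sw x ys) (e a x * Tg DS (S - {b}) ys)"
      by (rule Cons.IH) (use Cons.prems in auto)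
    moreover have "e b y * e a x = sc (ss x y) (e a x * e b y)"
      using e_mult_diff[of b a y x] Cons.prems b by (auto simp: ss_commute)
    ultimately show ?thesis by (simp add: mult.assoc sc_simps) (simp add: sc_simps mult.commute flip: mult.assoc)
  qed
  then show ?case by (simp add: sum_distrib_left sum_distrib_right lop.scale_sum_right)
qed

lemma Tg_Par:
  "S \<subseteq> S0 \<Longrightarrow> set xs \<subseteq> letters \<Longrightarrow> fl x (Tg DS S xs) = sc (sw x xs) (Tg DS S xs)"
proof (induction xs arbitrary: S)
  case Nil
  then show ?case by (simp add: fl_DS)
next
  case (Cons y ys)
  have fl_sum: "fl x (sum f T) = (\<Sum>t\<in>T. fl x (f t))" for f :: "nat \<Rightarrow> (nat \<Rightarrow> nat) lop" and T
    by (induction T rule: infinite_finite_induct) (auto simp: fl_lin)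
  have "fl x (e a y * Tg DS (S - {a}) ys) = sc (sw x (y # ys)) (e a y * Tg DS (S - {a}) ys)"
    if a: "a \<in> S" for a
  proof -
    have "a \<in> S0" "y \<in> letters" using Cons.prems a by auto
    then have "Par * e a y * Par = sc ((-1) ^ gpar p y) (e a y * (Par * Par))"
      by (simp add: Par_e sc_simps mult.assoc)
    then have "fl x (e a y) = sc (ss x y) (e a y)"
      using gpar_cases[of x] \<open>a \<in> S0\<close> \<open>y \<in> letters\<close> by (auto simp: fl_def ss_def)
    moreover have "fl x (Tg DS (S - {a}) ys) = sc (sw x ys) (Tg DS (S - {a}) ys)"
      by (rule Cons.IH) (use Cons.prems in auto)
    ultimately show ?thesis
      using \<open>a \<in> S0\<close> \<open>y \<in> letters\<close> by (simp add: fl_mult inL_e sc_simps)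
  qed
  then show ?case by (simp add: fl_sum lop.scale_sum_right)
qed

section \<open>The leading term of the action on the invariant vector\<close>

definition pletters :: "(nat \<times> nat) set" where "pletters = letters - kletters"

text \<open>Two letters of p reverse the colour twice, so their product at one site is 0 or a letter
  of k.\<close>

lemma D_ee:
  assumes "a \<in> S0" "x \<in> pletters" "y \<in> pletters"
  shows "D b * (e a x * e a y) = (e a x * e a y) * D b"
proof -
  have *: "x \<in> letters" "y \<in> letters" "snd x = fst y \<Longrightarrow> (fst x, snd y) \<in> kletters"
    using assms by (auto simp: pletters_def kletters_def letters_def)
  then have "D b * e a (fst x, snd y) = e a (fst x, snd y) * D b" if "snd x = fst y"
    using D_e_k assms(1) that by blast
  then show ?thesis using * assms by (auto simp: e_mult_same kron_def)
qed

text \<open>At a site still carrying J the bracket with \<open>x\<close> places the letter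
  \<open>x\<close>. At a site already carrying a letter of p the bracket lies in k and restores the
  colour, and such terms form the error. The bound on \<open>n\<close> lets the error preserve one
  site more than the main term.\<close>

lemma leading_term:
  assumes x: "x \<in> pletters"
  shows "S \<subseteq> S0 \<Longrightarrow> set xs \<subseteq> pletters \<Longrightarrow> n + length xs \<le> card S + 1 \<Longrightarrow>
    (\<Sum>a\<in>S. e a x * Tg DS S xs - sc (sw x xs) (Tg DS S xs * e a x))
      - sc (2 * cs (snd x)) (Tg DS S (x # xs)) \<in> Fil S n"
proof (induction xs arbitrary: S)
  case Nil
  have xl: "x \<in> letters" "x \<notin> kletters" using x by (auto simp: pletters_def)
  \<comment> \<open>A letter of p anticommutes with \<open>D a\<close>, so the commutator doubles
    the product; this is the origin of the 2.\<close>
  have "e a x * DS S - DS S * e a x = sc (2 * cs (snd x)) (e a x * DS (S - {a}))" if a: "a \<in> S" for a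
  proof -
    have aS: "a \<in> S0" using a Nil by auto
    have "e a x * DS S = e a x * D a * DS (S - {a})"
      by (simp add: DS_remove[OF Nil(1) a] mult.assoc)
    moreover have "DS S * e a x = D a * e a x * DS (S - {a})"
      by (simp add: DS_remove[OF Nil(1) a] mult.assoc DS_e[OF aS _ xl(1)])
    moreover have "2 * cs (snd x) = cs (snd x) + cs (snd x)" by simp
    ultimately show ?thesis
      by (simp only: e_D_p[OF aS xl(1)] D_e_p[OF aS xl] sc_simps lop.scale_minus_left
          lop.scale_left_distrib) (simp add: lop.scale_minus_left sc_simps)
  qed
  then show ?case using Fil_zero by (simp add: lop.scale_sum_right)
next
  case (Cons y ys)
  note S = Cons.prems(1)
  have fin: "finite S" by (rule finite_sub_S0[OF S])
  have xl: "x \<in> letters" and yp: "y \<in> pletters" and yl: "y \<in> letters" and ysp: "set ys \<subseteq> pletters" and ysl: "set ys \<subseteq> letters"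
    using x Cons.prems by (auto simp: pletters_def)
  let ?B = "\<lambda>b. Tg DS (S - {b}) ys" and ?c = "2 * cs (snd x)"
  \<comment> \<open>The bracket of the new letter with the one already placed at \<open>b\<close>;
    \<open>r\<close> is the error at the remaining sites.\<close>
  define C where "C b = e b x * e b y - sc (ss x y) (e b y * e b x)" for b
  define r where "r b = (\<Sum>a\<in>S-{b}. e a x * ?B b - sc (sw x ys) (?B b * e a x))
      - sc ?c (Tg DS (S - {b}) (x # ys))" for b
  have expand: "e a x * (e b y * ?B b) - sc (sw x (y # ys)) (e b y * ?B b * e a x) =
      (if a = b then C b * ?B b else sc (ss x y) (e b y * (e a x * ?B b - sc (sw x ys) (?B b * e a x))))"
    if ab: "a \<in> S" "b \<in> S" for a b
  proof (cases "a = b")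
    case True
    have "?B b * e b x = sc (sw x ys) (e b x * ?B b)"
      by (rule Tg_e) (use ab S ysl xl in auto)
    moreover have "sw x ys * sw x ys = 1" by (simp add: sw_def flip: power_mult_distrib)
    ultimately show ?thesis using True
      by (simp add: C_def algebra_simps sc_simps)
  next
    case False
    then have "e a x * e b y = sc (ss x y) (e b y * e a x)"
      using ab S xl yl by (intro e_mult_diff) auto
    then show ?thesis using False
      by (simp add: right_diff_distrib sc_simps lop.scale_right_diff_distrib flip: mult.assoc)
  qed
  have "(\<Sum>a\<in>S. e a x * Tg DS S (y # ys) - sc (sw x (y # ys)) (Tg DS S (y # ys) * e a x)) =
     (\<Sum>a\<in>S. \<Sum>b\<in>S. e a x * (e b y * ?B b) - sc (sw x (y # ys)) (e b y * ?B b * e a x))"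
    by (simp add: sum_distrib_left sum_distrib_right lop.scale_sum_right sum_subtractf)
  also have "\<dots> = (\<Sum>b\<in>S. \<Sum>a\<in>S. e a x * (e b y * ?B b) - sc (sw x (y # ys)) (e b y * ?B b * e a x))"
    by (rule sum.swap)
  also have "\<dots> = (\<Sum>b\<in>S. C b * ?B b + sc (ss x y) (e b y * (sc ?c (Tg DS (S - {b}) (x # ys)) + r b)))"
  proof (rule sum.cong[OF refl])
    fix b assume b: "b \<in> S"
    have "(\<Sum>a\<in>S. e a x * (e b y * ?B b) - sc (sw x (y # ys)) (e b y * ?B b * e a x)) =
       C b * ?B b + (\<Sum>a\<in>S-{b}. sc (ss x y) (e b y * (e a x * ?B b - sc (sw x ys) (?B b * e a x))))"
      by (subst sum.remove[OF fin b]) (simp add: expand b del: sw_simps)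
    also have "(\<Sum>a\<in>S-{b}. sc (ss x y) (e b y * (e a x * ?B b - sc (sw x ys) (?B b * e a x)))) =
      sc (ss x y) (e b y * (sc ?c (Tg DS (S - {b}) (x # ys)) + r b))"
      by (simp only: r_def sum_distrib_left[symmetric] lop.scale_sum_right[symmetric]) simp
    finally show "(\<Sum>a\<in>S. e a x * (e b y * ?B b) - sc (sw x (y # ys)) (e b y * ?B b * e a x)) =
      C b * ?B b + sc (ss x y) (e b y * (sc ?c (Tg DS (S - {b}) (x # ys)) + r b))" .
  qed
  also have "\<dots> = (\<Sum>b\<in>S. C b * ?B b + sc (ss x y) (e b y * r b)) + sc ?c (sc (ss x y) (Tg DS S (y # x # ys)))"
    unfolding Tg.simps(2)[of DS S y "x # ys"]
    by (simp add: distrib_left sum.distrib lop.scale_right_distrib sc_simps lop.scale_sum_right mult_ac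
        del: Tg.simps)
  also have "sc (ss x y) (Tg DS S (y # x # ys)) = Tg DS S (x # y # ys)"
    by (rule Tg_swap[OF S xl yl, symmetric])
  finally have eq: "(\<Sum>a\<in>S. e a x * Tg DS S (y # ys) - sc (sw x (y # ys)) (Tg DS S (y # ys) * e a x))
      - sc ?c (Tg DS S (x # y # ys)) = (\<Sum>b\<in>S. C b * ?B b + sc (ss x y) (e b y * r b))"
    by simp
  have "C b * ?B b + sc (ss x y) (e b y * r b) \<in> Fil S n" if b: "b \<in> S" for b
  proof (intro Fil_add Fil_sc)
    have bS: "b \<in> S0" and cardS: "Suc (card (S - {b})) = card S"
      using b S card_Suc_Diff1[OF fin b] by auto
    have iC: "inL (C b)" unfolding C_def
      using bS xl yl by (intro inL_diff inL_mult inL_sc inL_e)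
    have DC: "D c * C b = C b * D c" for c
      using D_ee[OF bS x yp, of c] D_ee[OF bS yp x, of c] by (simp add: C_def algebra_simps sc_simps)
    show "C b * ?B b \<in> Fil S n"
    proof -
      \<comment> \<open>For \<open>n = 0\<close> the truncated \<open>n - 1\<close> is again 0, and
        \<open>Fil_Suc\<close> then gives more than is asked, which \<open>Fil_mono\<close>
        discards.\<close>
      have B: "?B b \<in> Fil (S - {b}) (n - 1)"
        by (rule Tg_Fil) (use S ysl Cons.prems(3) cardS in auto)
      from Fil_Suc[OF this S b iC DC] show ?thesis by (rule Fil_mono[rotated 2]) auto
    qed
    have "r b \<in> Fil (S - {b}) n"
      unfolding r_def by (rule Cons.IH) (use S ysp Cons.prems(3) cardS in auto)
    then show "e b y * r b \<in> Fil S n" by (rule Fil_e[OF _ S b yl])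
  qed
  then show ?case unfolding eq by (rule Fil_sum)
qed

definition eta :: "word \<Rightarrow> complex" where "eta w = (\<Prod>x\<leftarrow>w. cs (snd x))"

lemma eta_simps [simp]: "eta [] = 1" "eta (x # w) = cs (snd x) * eta w"
  by (auto simp: eta_def)

lemma eta_sq [simp]: "eta w * eta w = 1"
proof (induction w)
  case (Cons x w)
  have "eta (x # w) * eta (x # w) = (cs (snd x) * cs (snd x)) * (eta w * eta w)" by simp
  then show ?case using Cons by (simp add: cs_def del: eta_simps)
qed simp

text \<open>With \<open>d + 1\<close> in the bound, the error of a word of length \<open>d\<close>
  still preserves the colour at one site, just enough to be killed by \<open>PR\<close>.\<close>

lemma act_leading:
  "set w \<subseteq> pletters \<Longrightarrow> n + length w \<le> d + 1 \<Longrightarrow>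
    act w (DS S0) - sc (2 ^ length w * eta w) (Tg DS S0 w) \<in> Fil S0 n"
proof (induction w arbitrary: n)
  case Nil
  then show ?case by (simp add: Fil_zero)
next
  case (Cons x w)
  have x: "x \<in> pletters" "x \<in> letters" and w: "set w \<subseteq> pletters" "set w \<subseteq> letters"
    using Cons.prems by (auto simp: pletters_def)
  let ?k = "2 ^ length w * eta w"
  define r where "r = act w (DS S0) - sc ?k (Tg DS S0 w)"
  have "r \<in> Fil S0 (Suc n)" unfolding r_def by (rule Cons.IH) (use w Cons.prems in auto)
  then have 1: "ad x r \<in> Fil S0 n" by (rule ad_Fil) (rule x)
  define r' where "r' = (\<Sum>a\<in>S0. e a x * Tg DS S0 w - sc (sw x w) (Tg DS S0 w * e a x))
      - sc (2 * cs (snd x)) (Tg DS S0 (x # w))"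
  have 2: "r' \<in> Fil S0 n" unfolding r'_def
    by (rule leading_term) (use x w Cons.prems in \<open>auto simp: S0_def\<close>)
  have "ad x (Tg DS S0 w) = sc (2 * cs (snd x)) (Tg DS S0 (x # w)) + r'"
    unfolding ad_sum r'_def by (simp add: Tg_Par w sc_simps)
  moreover have "act w (DS S0) = sc ?k (Tg DS S0 w) + r" by (simp add: r_def)
  ultimately have "act (x # w) (DS S0) - sc (2 ^ length (x # w) * eta (x # w)) (Tg DS S0 (x # w)) =
      sc ?k r' + ad x r"
    by (simp add: ad_lin lop.scale_right_distrib mult_ac del: Tg.simps)
  then show ?case using 1 2 by (simp only: Fil_add Fil_sc)
qed

text \<open>Projection onto the operators that reverse the colour at every site, i.e. onto the
  tensor power of the odd part of the symmetric pair.\<close>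
definition PR :: "(nat \<Rightarrow> nat) lop \<Rightarrow> (nat \<Rightarrow> nat) lop" where
  "PR A = (\<Sum>F\<in>Pow S0. Q (S0 - F) * A * Q F)"

lemma PR_lin: "PR (A + B) = PR A + PR B" "PR (sc c A) = sc c (PR A)" "PR 0 = 0" "PR (A - B) = PR A - PR B"
  by (simp_all add: PR_def algebra_simps sum.distrib sum_subtractf sc_simps lop.scale_sum_right)

lemma PR_sum: "PR (sum f S) = (\<Sum>s\<in>S. PR (f s))"
  by (induction S rule: infinite_finite_induct) (auto simp: PR_lin)

text \<open>At a preserved site \<open>b\<close> the operator commutes with \<open>D b\<close>, but
  \<open>D b\<close> has opposite eigenvalues on the two projections around it.\<close>

lemma PR_Fil: "A \<in> Fil S0 (Suc 0) \<Longrightarrow> PR A = 0"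
proof (induction rule: Fil_induct)
  case (base A R)
  then have "R \<noteq> {}" by auto
  then obtain b where b: "b \<in> R" "b \<in> S0" and comm: "D b * A = A * D b" using base by blast
  have "Q (S0 - F) * A * Q F = 0" for F
  proof -
    let ?s = "if b \<in> F then 1 else - 1 :: complex"
    have "sc ?s (Q (S0 - F) * A * Q F) = Q (S0 - F) * A * (D b * Q F)"
      by (simp add: D_Q(1)[OF b(2)] sc_simps)
    also have "\<dots> = Q (S0 - F) * D b * A * Q F"
      using comm by (metis mult.assoc)
    also have "\<dots> = sc (- ?s) (Q (S0 - F) * A * Q F)"
      using b(2) by (simp add: D_Q(2)[OF b(2)] sc_simps)
    finally have "sc (?s - - ?s) (Q (S0 - F) * A * Q F) = 0"
      by (simp only: lop.scale_left_diff_distrib) simp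
    moreover have "?s - - ?s \<noteq> 0" by simp
    ultimately show ?thesis by (simp only: lop.scale_eq_0_iff) blast
  qed
  then show ?case by (simp add: PR_def)
qed (auto simp: PR_lin)

lemma Q_e_p:
  assumes "a \<in> S0" "x \<in> pletters" "F \<subseteq> S0"
  shows "e a x * Q F = Q (if a \<in> F then F - {a} else insert a F) * e a x"
proof -
  let ?G = "if a \<in> F then F - {a} else insert a F"
  have "colors (I(a := snd x)) = F \<longleftrightarrow> colors I = ?G" if "I a = fst x" for I
  proof -
    have "Jplus p q (snd x) \<longleftrightarrow> \<not> Jplus p q (I a)" using assms that by (auto simp: pletters_def kletters_def)
    moreover have "a \<in> colors I \<longleftrightarrow> Jplus p q (I a)" using assms by (simp add: colors_def)
    ultimately show ?thesis using assms(1) by (auto simp: colors_upd)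
  qed
  then show ?thesis using assms unfolding Q_def e_def wcomp_mult
    by (intro wcomp_eqI) (auto simp: upd_L lettersD pletters_def)
qed

text \<open>Each letter of p reverses the colour at its site, so filling all of \<open>S\<close>
  replaces \<open>F\<close> by its symmetric difference with \<open>S\<close>.\<close>

lemma Tm_Q:
  "S \<subseteq> S0 \<Longrightarrow> F \<subseteq> S0 \<Longrightarrow> set xs \<subseteq> pletters \<Longrightarrow> length xs = card S \<Longrightarrow>
    Tm S xs * Q F = Q ((F - S) \<union> (S - F)) * Tm S xs"
proof (induction xs arbitrary: S)
  case Nil
  then show ?case using finite_sub_S0[of S] by simp
next
  case (Cons x xs)
  note fin = finite_sub_S0[OF Cons.prems(1)]
  have "e a x * Tm (S - {a}) xs * Q F = Q ((F - S) \<union> (S - F)) * (e a x * Tm (S - {a}) xs)" if a: "a \<in> S" for a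
  proof -
    let ?G = "(F - (S - {a})) \<union> (S - {a} - F)"
    have "Tm (S - {a}) xs * Q F = Q ?G * Tm (S - {a}) xs"
      by (rule Cons.IH) (use Cons.prems a fin in auto)
    moreover have "e a x * Q ?G = Q (if a \<in> ?G then ?G - {a} else insert a ?G) * e a x"
      by (rule Q_e_p) (use Cons.prems a in auto)
    moreover have "(if a \<in> ?G then ?G - {a} else insert a ?G) = (F - S) \<union> (S - F)"
      using a by auto
    ultimately show ?thesis by (simp add: mult.assoc) (simp flip: mult.assoc)
  qed
  then show ?case by (simp add: sum_distrib_left sum_distrib_right)
qed

lemma PR_Tm:
  assumes "set w \<subseteq> pletters" "length w = d" shows "PR (Tm S0 w) = Tm S0 w"
proof -
  have "Q (S0 - F) * Tm S0 w * Q F = Tm S0 w * Q F" if F: "F \<in> Pow S0" for F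
  proof -
    have "(F - S0) \<union> (S0 - F) = S0 - F" using F by auto
    then have "Tm S0 w * Q F = Q (S0 - F) * Tm S0 w"
      using Tm_Q[of S0 F w] assms F by (simp add: S0_def)
    then have "Q (S0 - F) * Tm S0 w * Q F = Tm S0 w * Q F * Q F" by simp
    then show ?thesis by (simp add: mult.assoc Q_Q)
  qed
  then have "PR (Tm S0 w) = Tm S0 w * U"
    unfolding PR_def sum_Q[symmetric] sum_distrib_left by (intro sum.cong) auto
  moreover have "inL (Tm S0 w)"
    using assms by (intro inL_Tg) (auto simp: inL_def pletters_def)
  ultimately show ?thesis by (simp add: inL_def)
qed

lemma Tg_DS_Tm: "S \<subseteq> S0 \<Longrightarrow> length xs = card S \<Longrightarrow> Tg DS S xs = Tm S xs"
proof (induction xs arbitrary: S)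
  case Nil
  then show ?case using finite_sub_S0[of S] by simp
next
  case (Cons x xs)
  have "Tg DS (S - {a}) xs = Tm (S - {a}) xs" if "a \<in> S" for a
    using that Cons finite_sub_S0[of S] by (intro Cons.IH) auto
  then show ?case by simp
qed

text \<open>When every site carries a letter, multiplying by J on the right gives exactly the signs
  \<open>eta\<close> that appear in \<open>act_leading\<close>; their product is 1.\<close>

lemma Tm_DS:
  "S \<subseteq> S0 \<Longrightarrow> set xs \<subseteq> letters \<Longrightarrow> length xs = card S \<Longrightarrow> Tm S xs * DS S = sc (eta xs) (Tm S xs)"
proof (induction xs arbitrary: S)
  case Nil
  then show ?case using finite_sub_S0[of S] by simp
next
  case (Cons x xs)
  have D: "D a * Tm S xs = Tm S xs * D a" if "S \<subseteq> S0 - {a}" "set xs \<subseteq> letters" for a S xs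
    using that
  proof (induction xs arbitrary: S)
    case (Cons x xs)
    have "D a * (e b x * Tm (S - {b}) xs) = e b x * Tm (S - {b}) xs * D a" if "b \<in> S" for b
      by (intro mult_commute_trans D_e_diff Cons.IH) (use Cons.prems that in auto)
    then show ?case by (simp add: sum_distrib_left sum_distrib_right)
  qed simp
  have "e a x * Tm (S - {a}) xs * DS S = sc (eta (x # xs)) (e a x * Tm (S - {a}) xs)" if a: "a \<in> S" for a
  proof -
    have S: "S - {a} \<subseteq> S0 - {a}" "a \<in> S0" "x \<in> letters" using Cons.prems a by auto
    have "Tm (S - {a}) xs * DS (S - {a}) = sc (eta xs) (Tm (S - {a}) xs)"
      by (rule Cons.IH) (use Cons.prems a finite_sub_S0[of S] in auto)
    moreover have "Tm (S - {a}) xs * D a = D a * Tm (S - {a}) xs"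
      using D[OF S(1)] Cons.prems by simp
    moreover have "e a x * Tm (S - {a}) xs * (D a * DS (S - {a})) =
        e a x * (Tm (S - {a}) xs * DS (S - {a})) * D a"
      by (simp only: DS_D mult.assoc)
    ultimately have "e a x * Tm (S - {a}) xs * (D a * DS (S - {a})) =
        e a x * D a * sc (eta xs) (Tm (S - {a}) xs)"
      by (simp only: sc_simps mult.assoc)
    then show ?thesis
      unfolding DS_remove[OF Cons.prems(1) a] e_D_p[OF S(2,3)] by (simp add: sc_simps mult_ac)
  qed
  then show ?case by (simp add: sum_distrib_right lop.scale_sum_right)
qed

definition Wp :: "word set" where "Wp = {w \<in> W. set w \<subseteq> pletters}"

text \<open>Any other word has fewer than \<open>d\<close> letters outside k, so it leaves the
  colour preserved somewhere and is killed.\<close>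

lemma PR_act:
  assumes "set w \<subseteq> letters" "length w \<le> d"
  shows "PR (act w (DS S0)) = (if w \<in> Wp then sc (2 ^ d * eta w) (Tm S0 w) else 0)"
proof (cases "w \<in> Wp")
  case True
  then have w: "set w \<subseteq> pletters" "length w = d" by (auto simp: Wp_def W_def)
  have "PR (act w (DS S0) - sc (2 ^ length w * eta w) (Tg DS S0 w)) = 0"
    by (rule PR_Fil, rule act_leading) (use w in auto)
  then show ?thesis using True w PR_Tm[OF w] Tg_DS_Tm[of S0 w] by (simp add: PR_lin S0_def)
next
  case False
  have "length (filter (\<lambda>x. x \<notin> kletters) w) < d"
  proof (rule ccontr)
    assume "\<not> ?thesis"
    moreover have "length (filter (\<lambda>x. x \<notin> kletters) w) \<le> length w" by (rule length_filter_le)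
    ultimately have len: "length w = d" "length (filter (\<lambda>x. x \<notin> kletters) w) = length w"
      using assms(2) by linarith+
    then have "set w \<inter> kletters = {}" by (metis disjoint_iff filter_id_conv length_filter_less less_irrefl)
    then have "w \<in> Wp" using len assms(1) by (auto simp: Wp_def W_def pletters_def)
    with False show False by simp
  qed
  then have "act w (DS S0) \<in> Fil S0 (Suc 0)" using assms(1) by (intro act_Fil) auto
  then show ?thesis using False by (simp add: PR_Fil)
qed

section \<open>Invariant elements modulo lower degree\<close>

text \<open>Needed to turn the supercommutator with odd letters of k into an ordinary commutator,
  since the double commutant theorem is about ordinary commutation.\<close>

lemma even_of_weight:
  assumes v: "inL v" and comm: "\<And>i. (i, i) \<in> letters \<Longrightarrow> Delta (i, i) * v = v * Delta (i, i)"
  shows "Par * v = v * Par"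
proof -
  define m where "m I = (\<Sum>a\<in>S0. ipar p (I a))" for I :: "nat \<Rightarrow> nat"
  \<comment> \<open>\<open>Z\<close> counts the odd tensor factors and \<open>Par\<close> is -1 to
    that count, so entries joining different counts vanish.\<close>
  define Z where "Z = (\<Sum>i\<in>idx. sc (of_nat (ipar p i)) (Delta (i, i)))"
  have fin: "finite idx" by (simp add: idx_def)
  have ap_Z: "ap Z f I = (if I \<in> L then of_nat (m I) * f I else 0)" for f I
  proof (cases "I \<in> L")
    case True
    then have idx: "a \<in> S0 \<Longrightarrow> I a \<in> idx" for a by (auto simp: L_def)
    have "ap Z f I = (\<Sum>i\<in>idx. \<Sum>a\<in>S0. if I a = i then of_nat (ipar p i) * f I else 0)"
      using True by (auto simp: Z_def Delta_def ap_sum sum_fun_app smul_def e_def psg_def gpar_def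
          sum_distrib_left intro!: sum.cong)
    also have "\<dots> = (\<Sum>a\<in>S0. \<Sum>i\<in>idx. if I a = i then of_nat (ipar p i) * f I else 0)"
      by (rule sum.swap)
    also have "\<dots> = (\<Sum>a\<in>S0. of_nat (ipar p (I a)) * f I)"
      by (intro sum.cong refl) (use fin idx in simp)
    finally show ?thesis using True by (simp add: m_def flip: sum_distrib_right)
  next
    case False
    then show ?thesis by (simp add: Z_def Delta_def ap_sum sum_fun_app smul_def e_def)
  qed
  have Zv: "Z * v = v * Z"
    unfolding Z_def sum_distrib_left sum_distrib_right
    by (intro sum.cong refl) (use comm in \<open>auto simp: sc_simps letters_def\<close>)
  have Z_bv: "ap Z (bv J) = smul (of_nat (m J)) (bv J)" if "J \<in> L" for J
    using that by (intro ext) (auto simp: ap_Z smul_def bv_def)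
  have Par_bv: "ap Par (bv J) = smul ((-1) ^ m J) (bv J)" if "J \<in> L" for J
    using that by (intro ext) (auto simp: Par_def smul_def bv_def m_def S0_def power_sum)
  have Par_app: "ap Par f I = (if I \<in> L then (-1) ^ m I * f I else 0)" for f I
    by (simp add: Par_def m_def S0_def power_sum)
  have ap_smul_app: "ap A (smul k f) I = k * ap A f I" for A k f I
    unfolding ap_smul by (simp add: smul_def)
  show ?thesis
  proof (rule inL_eqI)
    fix w assume w: "w \<in> W"
    note LL = rows_cols_L[OF w]
    have "ent (Z * v) w = ent (v * Z) w" by (simp add: Zv)
    then have "of_nat (m (rows w)) * ent v w = of_nat (m (cols w)) * ent v w"
      by (simp add: ent_def ap_Z LL Z_bv ap_smul_app)
    then have "m (rows w) = m (cols w) \<or> ent v w = 0" by auto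
    then show "ent (Par * v) w = ent (v * Par) w"
      by (auto simp: ent_def Par_bv LL ap_smul_app Par_app)
  qed (use v in \<open>auto intro: inL_mult inL_Par\<close>)
qed

text \<open>The hypothesis concerns only the class of \<open>u\<close> modulo the left ideal. As
  that ideal kills \<open>DS S0\<close>, the vector \<open>actl u (DS S0)\<close> is k-invariant,
  and \<open>PR\<close> and \<open>DS S0\<close> commute with k.\<close>

lemma invariant_operator:
  assumes u: "tens_ok p q u" and inv: "\<And>x. x \<in> kletters \<Longrightarrow> tmul (wd [x]) u \<in> KK"
  shows "PR (actl u (DS S0)) * DS S0 \<in> PQspan"
proof -
  define v where "v = actl u (DS S0)"
  have v: "inL v" unfolding v_def by (rule inL_actl[OF inL_DS u])
  have ad0: "ad x v = 0" if x: "x \<in> kletters" for x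
  proof -
    have "tens_ok p q (wd [x])" using kletters_letters[OF x] by (intro ok_wd) simp
    then have "actl (tmul (wd [x]) u) (DS S0) = ad x v" by (simp add: actl_tmul u actl_wd v_def)
    then show ?thesis using KK_act[OF inv[OF x]] by simp
  qed
  have "Delta (i, i) * v = v * Delta (i, i)" if "(i, i) \<in> letters" for i
  proof -
    have "(i, i) \<in> kletters" using that by (simp add: kletters_def)
    from ad0[OF this] show ?thesis by (simp add: ad_def fl_def gpar_def)
  qed
  from even_of_weight[OF v this] have "Par * v = v * Par" by blast
  then have "fl x v = v" for x using v by (simp add: fl_def mult.assoc inL_def)
  then have comm: "v * Delta x = Delta x * v" if "x \<in> kletters" for x
    using ad0[OF that] by (simp add: ad_def)
  have Q_comm: "Q F * Delta x = Delta x * Q F" if "x \<in> kletters" for x F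
    using that by (simp add: Delta_def sum_distrib_left sum_distrib_right Q_e_k)
  have inLQ: "inL (Q F)" for F by (simp add: inL_def)
  show ?thesis unfolding v_def[symmetric]
  proof (rule invariant_in_PQspan)
    show "inL (PR v * DS S0)"
      unfolding PR_def by (intro inL_mult inL_sum inL_DS inLQ v)
    fix x assume x: "x \<in> kletters"
    have "Q (S0 - F) * v * Q F * Delta x = Delta x * (Q (S0 - F) * v * Q F)" for F
      using Q_comm[OF x] comm[OF x] by (metis mult.assoc)
    then have "PR v * Delta x = Delta x * PR v"
      by (simp add: PR_def sum_distrib_left sum_distrib_right)
    then show "PR v * DS S0 * Delta x = Delta x * (PR v * DS S0)"
      using DS_Delta[OF x] by (metis mult.assoc)
  qed
qed

lemma Ten_PQ_nonalternating:
  assumes s: "\<sigma> permutes S0" and F: "F \<subseteq> S0" and na: "\<sigma> ` F \<noteq> S0 - F"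
  shows "Ten (P \<sigma> * Q F) \<in> Kd"
proof -
  have "smul (Ten (P \<sigma> * Q F) w) (wd w) \<in> Kd" if w: "w \<in> W" for w
  proof (cases "Ten (P \<sigma> * Q F) w = 0")
    case True
    then show ?thesis using vs.subspace_0[OF subspace_Kd] by simp
  next
    case False
    then have "ent (P \<sigma> * Q F) w \<noteq> 0" by (auto simp: Ten_def split: if_splits)
    then have c: "colors (cols w) = F" "colors (rows w) = \<sigma> ` F"
      using ent_Q'[OF w, of "P \<sigma>" F] ent_Q[OF w, of "\<sigma> ` F" "P \<sigma>"] P_Q[OF s F]
      by (auto split: if_splits)
    have "set w \<inter> kletters \<noteq> {}"
    proof
      assume k: "set w \<inter> kletters = {}"
      have "a \<in> colors (rows w) \<longleftrightarrow> a \<notin> colors (cols w)" if a: "a \<in> S0" for a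
      proof -
        have "w ! a \<in> set w" using a w by (auto simp: S0_def W_def)
        moreover have "w ! a \<in> letters" using calculation w by (auto simp: W_def)
        ultimately have "Jplus p q (fst (w ! a)) \<noteq> Jplus p q (snd (w ! a))"
          using k by (auto simp: kletters_def)
        then show ?thesis using a by (simp add: colors_def rows_def cols_def)
      qed
      then have "\<sigma> ` F = S0 - F" using c colors_sub[of "rows w"] by blast
      with na show False by simp
    qed
    then show ?thesis using kword_Kd[OF w] Kd_smul by blast
  qed
  then show ?thesis by (subst Ten_expand) (rule Kd_sum)
qed

text \<open>Two alternating colourings of the cycles of \<open>\<sigma>\<close> differ by a union \<open>A\<close> of cycles, and
  conjugation by the restriction of \<open>\<sigma>\<close> to \<open>A\<close> exchanges them.\<close>
lemma Ten_PQ_alternating: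
  assumes s: "\<sigma> permutes S0" and F: "F \<subseteq> S0" "\<sigma> ` F = S0 - F" and G: "G \<subseteq> S0" "\<sigma> ` G = S0 - G"
  shows "Ten (P \<sigma> * Q G) - Ten (P \<sigma> * Q F) \<in> Kd"
proof -
  define A where "A = (F - G) \<union> (G - F)"
  define \<tau> where "\<tau> a = (if a \<in> A then \<sigma> a else a)" for a
  have inj: "inj \<sigma>" by (rule permutes_inj[OF s])
  have A: "\<sigma> ` A = A"
    using F G unfolding A_def image_Un image_set_diff[OF inj] by auto
  have mem: "\<sigma> a \<in> A \<longleftrightarrow> a \<in> A" for a
    using A inj by (metis image_eqI inj_image_mem_iff)
  have t: "\<tau> permutes S0"
  proof (rule bij_imp_permutes)
    have "inj_on \<tau> S0"
    proof (rule inj_onI)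
      fix a b assume eq: "\<tau> a = \<tau> b"
      have "\<tau> c \<in> A \<longleftrightarrow> c \<in> A" for c by (simp add: \<tau>_def mem)
      then have "a \<in> A \<longleftrightarrow> b \<in> A" using eq by metis
      then show "a = b" using eq injD[OF inj, of a b] by (auto simp: \<tau>_def split: if_splits)
    qed
    moreover have "\<tau> ` S0 \<subseteq> S0" using permutes_in_image[OF s] by (auto simp: \<tau>_def)
    ultimately show "bij_betw \<tau> S0 S0" by (simp add: bij_betw_def endo_inj_surj)
    show "\<tau> a = a" if "a \<notin> S0" for a using that F(1) G(1) by (auto simp: \<tau>_def A_def)
  qed
  have comm: "\<tau> \<circ> \<sigma> = \<sigma> \<circ> \<tau>" using mem by (auto simp: \<tau>_def fun_eq_iff)
  have "\<tau> ` F = \<sigma> ` (F - G) \<union> (F \<inter> G)"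
  proof -
    have "F = (F - G) \<union> (F \<inter> G)" by auto
    then have "\<tau> ` F = \<tau> ` (F - G) \<union> \<tau> ` (F \<inter> G)" by (metis image_Un)
    moreover have "\<tau> ` (F - G) = \<sigma> ` (F - G)" "\<tau> ` (F \<inter> G) = F \<inter> G"
      by (auto simp: \<tau>_def A_def)
    ultimately show ?thesis by simp
  qed
  also have "\<sigma> ` (F - G) = G - F" using F G by (auto simp: image_set_diff[OF inj])
  finally have tF: "\<tau> ` F = G" by auto
  have "P \<tau> * (P \<sigma> * Q F) * P (inv \<tau>) = P \<tau> * P \<sigma> * Q F * P (inv \<tau>)" by (simp add: mult.assoc)
  also have "\<dots> = P \<sigma> * (P \<tau> * Q F) * P (inv \<tau>)"
    by (simp add: P_mult s t comm) (simp add: P_mult[OF s t, symmetric] mult.assoc)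
  also have "\<dots> = P \<sigma> * Q G * (P \<tau> * P (inv \<tau>))"
    by (simp only: P_Q[OF t F(1)] tF mult.assoc)
  also have "\<dots> = P \<sigma> * Q G" by (simp add: P_inv(1)[OF t] mult.assoc)
  finally have "P \<tau> * (P \<sigma> * Q F) * P (inv \<tau>) = P \<sigma> * Q G" .
  moreover have "inL (P \<sigma> * Q F)" by (rule PQspan_inL[OF PQ_in_PQspan[OF s F(1)]])
  ultimately show ?thesis using Ten_conj[OF t, of "P \<sigma> * Q F"] by simp
qed

lemma central_zero: "central p q 0"
  using central_Ten[of 0] by (simp add: inL_zero Ten_zero)

lemma central_add: "central p q a \<Longrightarrow> central p q b \<Longrightarrow> central p q (a + b)"
  by (auto simp: central_def sad_add intro: ok_add II_add)

lemma central_smul: "central p q a \<Longrightarrow> central p q (smul c a)"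
  by (auto simp: central_def sad_smul intro: ok_smul II_smul)

text \<open>Expand \<open>P \<sigma>\<close> over all colourings. Modulo \<open>Kd\<close> the
  non-alternating ones vanish and the \<open>n\<close> alternating ones agree, so
  \<open>Ten (P \<sigma>)\<close> is \<open>n\<close> times the wanted tensor, with \<open>n\<close>
  nonzero because \<open>F\<close> itself alternates.\<close>

lemma Ten_PQ_central:
  assumes s: "\<sigma> permutes S0" and F: "F \<subseteq> S0"
  shows "\<exists>z. central p q z \<and> Ten (P \<sigma> * Q F) - z \<in> Kd"
proof (cases "\<sigma> ` F = S0 - F")
  case False
  then show ?thesis using Ten_PQ_nonalternating[OF s F] central_zero by (intro exI[of _ 0]) simp
next
  case True
  define Alt where "Alt = {G \<in> Pow S0. \<sigma> ` G = S0 - G}"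
  define n :: complex where "n = of_nat (card Alt)"
  have fin: "finite Alt" and "F \<in> Alt" using True F by (auto simp: Alt_def)
  then have n: "n \<noteq> 0" by (auto simp: n_def)
  have const: "(\<Sum>i\<in>I. a) = smul (of_nat (card I)) a" for I :: "nat set set" and a :: tens
    by (rule ext) (simp add: sum_fun_app smul_def)
  have "P \<sigma> = (\<Sum>G\<in>Pow S0. P \<sigma> * Q G)"
    using s by (simp add: sum_Q flip: sum_distrib_left)
  then have "Ten (P \<sigma>) = (\<Sum>G\<in>Pow S0. Ten (P \<sigma> * Q G))" by (metis Ten_sum)
  also have "\<dots> = (\<Sum>G\<in>Pow S0 - Alt. Ten (P \<sigma> * Q G)) + (\<Sum>G\<in>Alt. Ten (P \<sigma> * Q G))"
    by (rule sum.subset_diff) (auto simp: Alt_def)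
  also have "\<dots> = (\<Sum>G\<in>Pow S0 - Alt. Ten (P \<sigma> * Q G)) +
      ((\<Sum>G\<in>Alt. Ten (P \<sigma> * Q G) - Ten (P \<sigma> * Q F)) + smul n (Ten (P \<sigma> * Q F)))"
    by (simp add: sum_subtractf const n_def del: sum_constant)
  finally have "Ten (P \<sigma>) - smul n (Ten (P \<sigma> * Q F)) = (\<Sum>G\<in>Pow S0 - Alt. Ten (P \<sigma> * Q G)) +
      (\<Sum>G\<in>Alt. Ten (P \<sigma> * Q G) - Ten (P \<sigma> * Q F))" by simp
  also have "\<dots> \<in> Kd"
    by (intro Kd_add Kd_sum Ten_PQ_nonalternating Ten_PQ_alternating s F True) (auto simp: Alt_def)
  finally have "smul (- (1 / n)) (Ten (P \<sigma>) - smul n (Ten (P \<sigma> * Q F))) \<in> Kd" by (rule Kd_smul)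
  then have "Ten (P \<sigma> * Q F) - smul (1 / n) (Ten (P \<sigma>)) \<in> Kd"
    using n by (simp add: vs.scale_right_diff_distrib vs.scale_minus_left)
  then show ?thesis using central_smul[OF central_P[OF s]] by blast
qed

lemma PQspan_central:
  assumes "A \<in> PQspan" shows "\<exists>z. central p q z \<and> Ten A - z \<in> Kd"
  using assms unfolding PQspan_def
proof (induction rule: lop.span_induct_alt)
  case base
  show ?case using central_zero vs.subspace_0[OF subspace_Kd] by (intro exI[of _ 0]) (simp add: Ten_zero)
next
  case (step c x y)
  then obtain \<sigma> F where "x = P \<sigma> * Q F" "\<sigma> permutes S0" "F \<subseteq> S0" by blast
  then obtain z where z: "central p q z" "Ten x - z \<in> Kd" using Ten_PQ_central by blast
  from step obtain z' where z': "central p q z'" "Ten y - z' \<in> Kd" by blast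
  have "smul c (Ten x - z) + (Ten y - z') \<in> Kd" by (intro Kd_add Kd_smul z z')
  then have "Ten (sc c x + y) - (smul c z + z') \<in> Kd"
    by (simp add: Ten_add Ten_sc vs.scale_right_diff_distrib algebra_simps)
  then show ?case using z z' central_add central_smul by blast
qed

section \<open>Lifting the leading term and descent on the degree\<close>

lemma low_word_Kd: "set w \<subseteq> letters \<Longrightarrow> length w < d \<Longrightarrow> wd w \<in> Kd"
  using low_Kd[OF low_smul_wd[of w d 1]] by simp

text \<open>Modulo \<open>Kd\<close> only the words of length \<open>d\<close> in letters of p
  matter, and by \<open>Ten_Tm\<close> their sum is \<open>Ten M\<close> divided by d!. Invariance
  of \<open>u\<close> puts \<open>M\<close> into \<open>PQspan\<close>, where central lifts
  exist.\<close>

lemma central_mod_lower: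
  assumes u: "u \<in> low (Suc d)" and inv: "\<And>x. x \<in> kletters \<Longrightarrow> tmul (wd [x]) u \<in> KK"
  shows "\<exists>z. central p q z \<and> u - z \<in> Kd"
proof -
  let ?S = "{w. u w \<noteq> 0}"
  have ok: "tens_ok p q u" and fin: "finite ?S" and S: "\<And>w. w \<in> ?S \<Longrightarrow> set w \<subseteq> letters \<and> length w \<le> d"
    using u by (auto simp: low_def tens_ok_iff less_Suc_eq_le)
  \<comment> \<open>The symmetrised leading part of \<open>u\<close>. The action recovers it up to
    \<open>2 ^ d\<close> and the signs \<open>eta\<close>, which \<open>Tm_DS\<close>
    cancels.\<close>
  define M where "M = (\<Sum>w\<in>?S \<inter> Wp. sc (u w) (Tm S0 w))"
  have Tm_eta: "Tm S0 w * DS S0 = sc (eta w) (Tm S0 w)" if "w \<in> Wp" for w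
    using that by (intro Tm_DS) (auto simp: Wp_def W_def S0_def)
  have "PR (actl u (DS S0)) = (\<Sum>w\<in>?S. sc (u w) (if w \<in> Wp then sc (2 ^ d * eta w) (Tm S0 w) else 0))"
    unfolding actl_def PR_sum PR_lin using S by (intro sum.cong refl) (simp add: PR_act)
  also have "\<dots> = (\<Sum>w\<in>?S \<inter> Wp. sc (u w * (2 ^ d * eta w)) (Tm S0 w))"
    using fin by (intro sum.mono_neutral_cong_right) auto
  finally have "PR (actl u (DS S0)) * DS S0 = (\<Sum>w\<in>?S \<inter> Wp. sc (u w * (2 ^ d * eta w)) (Tm S0 w * DS S0))"
    by (simp add: sum_distrib_right sc_simps)
  also have "\<dots> = sc (2 ^ d) M"
    unfolding M_def lop.scale_sum_right
  proof (rule sum.cong[OF refl])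
    fix w assume "w \<in> ?S \<inter> Wp"
    then have "sc (u w * (2 ^ d * eta w)) (Tm S0 w * DS S0) = sc (u w * 2 ^ d * (eta w * eta w)) (Tm S0 w)"
      by (simp add: Tm_eta mult.assoc del: eta_sq)
    then show "sc (u w * (2 ^ d * eta w)) (Tm S0 w * DS S0) = sc (2 ^ d) (sc (u w) (Tm S0 w))"
      by (simp add: mult.commute)
  qed
  finally have "sc (2 ^ d) M \<in> PQspan" using invariant_operator[OF ok inv] by simp
  from lop.subspace_scale[OF subspace_PQspan this, of "1 / 2 ^ d"] have "M \<in> PQspan" by simp
  then obtain z where z: "central p q z" "Ten M - z \<in> Kd" using PQspan_central by blast
  have "smul (u w) (wd w) - smul (1 / nperm) (if w \<in> Wp then smul (u w) (Ten (Tm S0 w)) else 0) \<in> Kd"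
    if w: "w \<in> ?S" for w
  proof (cases "w \<in> Wp")
    case True
    then have "w \<in> W" by (simp add: Wp_def)
    from Kd_smul[OF Ten_Tm[OF this], of "- (u w / nperm)"] show ?thesis
      using True by (simp add: vs.scale_right_diff_distrib vs.scale_minus_left)
  next
    case False
    have "wd w \<in> Kd"
    proof (cases "length w < d")
      case True
      then show ?thesis using S[OF w] low_word_Kd by blast
    next
      case False
      then have "w \<in> W" using S[OF w] by (simp add: W_def)
      moreover from this have "set w \<inter> kletters \<noteq> {}"
        using \<open>w \<notin> Wp\<close> by (auto simp: Wp_def W_def pletters_def)
      ultimately show ?thesis by (rule kword_Kd)
    qed
    then show ?thesis using False Kd_smul by simp
  qed
  then have "(\<Sum>w\<in>?S. smul (u w) (wd w) - smul (1 / nperm) (if w \<in> Wp then smul (u w) (Ten (Tm S0 w)) else 0)) \<in> Kd"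
    by (rule Kd_sum)
  also have "(\<Sum>w\<in>?S. smul (u w) (wd w) - smul (1 / nperm) (if w \<in> Wp then smul (u w) (Ten (Tm S0 w)) else 0)) =
     u - smul (1 / nperm) (Ten M)"
  proof -
    have "(\<Sum>w\<in>?S. if w \<in> Wp then smul (u w) (Ten (Tm S0 w)) else 0) = Ten M"
      unfolding M_def Ten_sum Ten_sc using fin by (intro sum.mono_neutral_cong_right) auto
    then show ?thesis
      by (simp only: sum_subtractf lop.scale_sum_right vs.scale_sum_right[symmetric]
          tens_expand[OF fin order.refl, symmetric])
  qed
  finally have "(u - smul (1 / nperm) (Ten M)) + smul (1 / nperm) (Ten M - z) \<in> Kd"
    using z(2) by (intro Kd_add Kd_smul)
  then have "u - smul (1 / nperm) z \<in> Kd" by (simp add: vs.scale_right_diff_distrib)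
  then show ?thesis using central_smul[OF z(1)] by blast
qed

text \<open>A supercentral \<open>z\<close> can be exchanged with \<open>x\<close> up to sign, and
  then \<open>x\<close> stands on the right. So central elements meet the invariance condition and
  may be subtracted in the descent.\<close>

lemma central_KK:
  assumes "central p q z" "x \<in> kletters" shows "tmul (wd [x]) z \<in> KK"
proof -
  let ?z = "if gpar p x = 1 then sflip p z else z"
  have ok: "tens_ok p q z" using assms(1) by (simp add: central_def)
  then have "tens_ok p q ?z" by (auto simp: tens_ok_iff sflip_def)
  then have 1: "tmul ?z (wd [x]) \<in> KK" using KK_gen assms(2) by blast
  have "valid_idx p q (fst x) \<and> valid_idx p q (snd x)"
    using assms(2) by (auto simp: kletters_def letters_def idx_def valid_idx_def)
  then have "sad p (fst x) (snd x) z \<in> II" using assms(1) by (auto simp: central_def)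
  then have "tmul (wd [x]) z - tmul ?z (wd [x]) \<in> KK"
    by (intro KK_II) (simp add: sad_def tens_ops gen_wd)
  from KK_add[OF this 1] show ?thesis by simp
qed

lemma k_invariant_KK:
  assumes "k_invariant p q u" "x \<in> kletters" shows "tmul (wd [x]) u \<in> KK"
proof -
  let ?u = "if gpar p x = 1 then sflip p u else u"
  have ok: "tens_ok p q u" using assms(1) by (simp add: k_invariant_def)
  then have "tens_ok p q ?u" by (auto simp: tens_ok_iff sflip_def)
  then have 1: "tmul ?u (wd [x]) \<in> KK" using KK_gen assms(2) by blast
  have "sad p (fst x) (snd x) u \<in> II"
    using assms by (auto simp: k_invariant_def kidx_kletters)
  then have "tmul (wd [x]) u - tmul ?u (wd [x]) \<in> KK"
    by (intro KK_II) (simp add: sad_def tens_ops gen_wd)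
  from KK_add[OF this 1] show ?thesis by simp
qed

end

text \<open>Subtracting the central lift \<open>z1\<close> and the element \<open>b\<close> of the
  left ideal lowers the degree bound. The condition on \<open>u\<close> survives because it holds
  for \<open>z1\<close> and because \<open>Uk\<close> is stable under left multiplication.\<close>

lemma low_central:
  assumes "u \<in> sites.low p q n" "\<And>x. x \<in> sites.kletters p q \<Longrightarrow> tmul (wd [x]) u \<in> Uk_pre p q"
  shows "\<exists>z. central p q z \<and> z - u \<in> Uk_pre p q"
  using assms
proof (induction n arbitrary: u)
  case 0
  then have "u = 0" by (auto simp: sites.low_def fun_eq_iff fun_app)
  then show ?case using sites.central_zero[of p q] sites.KK_II[OF sites.II_zero]
    by (intro exI[of _ 0]) auto
next
  case (Suc n)
  \<comment> \<open>Words shorter than \<open>Suc n\<close> have at most \<open>n\<close> letters,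
    so \<open>n\<close> sites are just enough to see the leading term.\<close>
  interpret sites p q n .
  from central_mod_lower[OF Suc.prems] obtain z1 where z1: "central p q z1" "u - z1 \<in> Kd" by blast
  then obtain b where b: "b \<in> Uk_pre p q" "u - z1 - b \<in> low n" by (auto simp: Kd_def)
  have "tmul (wd [x]) (u - z1 - b) \<in> Uk_pre p q" if x: "x \<in> kletters" for x
  proof -
    have "tens_ok p q (wd [x])" using kletters_letters[OF x] by (intro ok_wd) simp
    then have "tmul (wd [x]) u - tmul (wd [x]) z1 - tmul (wd [x]) b \<in> Uk_pre p q"
      using Suc.prems(2)[OF x] central_KK[OF z1(1) x] KK_lmul[OF b(1)]
      by (intro vs.subspace_diff[OF subspace_KK]) auto
    then show ?thesis by (simp add: tmul_lin)
  qed
  from Suc.IH[OF b(2) this] obtain z2 where z2: "central p q z2" "z2 - (u - z1 - b) \<in> Uk_pre p q" by blast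
  have "(z2 - (u - z1 - b)) - b \<in> Uk_pre p q" by (rule vs.subspace_diff[OF subspace_KK z2(2) b(1)])
  then have "(z1 + z2) - u \<in> Uk_pre p q" by (simp add: algebra_simps)
  then show ?case using central_add[OF z1(1) z2(1)] by blast
qed

theorem theoremB:
  fixes p q :: nat
  assumes "p \<ge> 1" and "q \<ge> 1"
  shows "\<forall>u. k_invariant p q u \<longrightarrow>
           (\<exists>z. central p q z \<and> tsub z u \<in> Uk_pre p q)"
proof (intro allI impI)
  fix u assume u: "k_invariant p q u"
  then have ok: "tens_ok p q u" by (simp add: k_invariant_def)
  then have fin: "finite {w. u w \<noteq> 0}" by (simp add: sites.tens_ok_iff)
  \<comment> \<open>A strict bound on the word lengths; inserting 0 keeps \<open>Max\<close>
    meaningful when \<open>u\<close> is zero.\<close>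
  define n where "n = Suc (Max (insert 0 (length ` {w. u w \<noteq> 0})))"
  have "length w < n" if "u w \<noteq> 0" for w
    using that fin by (simp add: n_def less_Suc_eq_le)
  then have "u \<in> sites.low p q n" using ok by (simp add: sites.low_def)
  from low_central[OF this sites.k_invariant_KK[OF u]]
  show "\<exists>z. central p q z \<and> tsub z u \<in> Uk_pre p q" by (simp add: tens_ops)
qed

end
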